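(* There is a numerical constant $c_0$ such that for every constant $c\ge c_0$ there is a constant $C$ depending only on $c$ with the following property. Let $n\ge 1$, let $\rho_n\in(0,1]$ satisfy $\rho_n\ge\log(n)/n$, and let $\lambda=c\sqrt{\rho_nn}$. Then, for any $k\in[n]$ and any $\boldsymbol\Theta_0\in\mathcal T[k,\rho_n]$, the hard thresholding estimator $\widetilde{\boldsymbol\Theta}_\lambda$ simultaneously satisfies, with probability larger than $1-1/n$, $$\frac1n\|\widetilde{\boldsymbol\Theta}_\lambda-\boldsymbol\Theta_0\|_2\le C\sqrt{\frac{\rho_nk}{n}}$$ and $$\|\widetilde{\boldsymbol\Theta}_\lambda-\boldsymbol\Theta_0\|_\square\le\frac1n\|\widetilde{\boldsymbol\Theta}_\lambda-\boldsymbol\Theta_0\|_{2\to2}\le C\sqrt{\frac{\rho_n}{n}}.$$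
   Context: $[m]=\{1,\dots,m\}$. $\mathcal T[k]$ is the set of $n\times n$ matrices $\boldsymbol\Theta$ for which there exist a map $z:[n]\to[k]$ and a symmetric $\boldsymbol Q\in[0,1]^{k\times k}$ with $\boldsymbol\Theta_{ij}=\boldsymbol Q_{z(i)z(j)}$ for $i\ne j$ and $\boldsymbol\Theta_{ii}=0$ for all $i$. $\mathcal T[k,\rho_n]=\{\boldsymbol\Theta\in\mathcal T[k]:\ \max_{i,j}|\boldsymbol\Theta_{ij}|\le\rho_n\}$. Inhomogeneous random graph model with respect to the fixed matrix $\boldsymbol\Theta_0$: $\boldsymbol A$ is a random symmetric $\{0,1\}$-valued $n\times n$ matrix with zero diagonal whose entries $\boldsymbol A_{ij}$, $i<j$, are independent Bernoulli variables with parameters $(\boldsymbol\Theta_0)_{ij}$. Singular value hard thresholding: write the singular value decomposition $\boldsymbol A=\sum_{j=1}^{\mathrm{rank}(\boldsymbol A)}\sigma_j(\boldsymbol A)u_j(\boldsymbol A)v_j(\boldsymbol A)^T$ with singular values $\sigma_j(\boldsymbol A)>0$ in decreasing order. For $\lambda>0$, $\widetilde{\boldsymbol\Theta}_\lambda=\sum_{j:\sigma_j(\boldsymbol A)\ge\lambda}\sigma_j(\boldsymbol A)u_j(\boldsymbol A)v_j(\boldsymbol A)^T$. Norms of $\boldsymbol B\in\mathbb R^{n\times n}$: $\|\boldsymbol B\|_2=(\sum_{i,j}\boldsymbol B_{ij}^2)^{1/2}$ (Frobenius); $\|\boldsymbol B\|_{2\to2}$ is the $\ell_2\to\ell_2$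 operator norm; $\|\boldsymbol B\|_\square=\frac1{n^2}\max_{S,T\subset[n]}\big|\sum_{i\in S,j\in T}\boldsymbol B_{ij}\big|$. *)

theory Defs
  imports "HOL-Probability.Probability" "Jordan_Normal_Form.DL_Rank"
begin

unbundle no vec_syntax
unbundle no inner_syntax

(* Matrices are of type real mat, so that the size n can be quantified over.
   Indices are 0-based: [m] is rendered as {..<m}. *)

definition block_matrices :: "nat \<Rightarrow> nat \<Rightarrow> real mat set" where
  "block_matrices n k =
    {\<Theta> \<in> carrier_mat n n.
      \<exists>(z :: nat \<Rightarrow> nat) Q.
        (\<forall>i<n. z i < k) \<and>
        Q \<in> carrier_mat k k \<and> Q\<^sup>T = Q \<and>
        (\<forall>a<k. \<forall>b<k. Q $$ (a, b) \<in> {0..1}) \<and>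
        (\<forall>i<n. \<forall>j<n. i \<noteq> j \<longrightarrow> \<Theta> $$ (i, j) = Q $$ (z i, z j)) \<and>
        (\<forall>i<n. \<Theta> $$ (i, i) = 0)}"

definition block_matrices_bounded :: "nat \<Rightarrow> nat \<Rightarrow> real \<Rightarrow> real mat set" where
  "block_matrices_bounded n k \<rho> =
    {\<Theta> \<in> block_matrices n k. \<forall>i<n. \<forall>j<n. \<bar>\<Theta> $$ (i, j)\<bar> \<le> \<rho>}"

definition adjacency_mat :: "nat \<Rightarrow> (nat \<times> nat \<Rightarrow> bool) \<Rightarrow> real mat" where
  "adjacency_mat n e =
    mat n n (\<lambda>(i, j). if i < j then of_bool (e (i, j))
                      else if j < i then of_bool (e (j, i)) else 0)"

(* The law of the adjacency matrix A. The value False is only the default that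
   Pi_pmf assigns outside the index set; it is never read by adjacency_mat. *)
definition inhomogeneous_random_graph :: "nat \<Rightarrow> real mat \<Rightarrow> real mat pmf" where
  "inhomogeneous_random_graph n \<Theta> =
    map_pmf (adjacency_mat n)
      (Pi_pmf {(i, j). i < j \<and> j < n} False (\<lambda>(i, j). bernoulli_pmf (\<Theta> $$ (i, j))))"

(* sum over j in J of s j * u j * (v j)^T, as an m x n matrix *)
definition sum_rank_one ::
  "nat \<Rightarrow> nat \<Rightarrow> nat set \<Rightarrow> (nat \<Rightarrow> real) \<Rightarrow> (nat \<Rightarrow> real vec) \<Rightarrow> (nat \<Rightarrow> real vec) \<Rightarrow> real mat" where
  "sum_rank_one m n J s u v = mat m n (\<lambda>(a, b). \<Sum>j\<in>J. s j * (u j $ a) * (v j $ b))"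

definition is_svd ::
  "real mat \<Rightarrow> (nat \<Rightarrow> real) \<Rightarrow> (nat \<Rightarrow> real vec) \<Rightarrow> (nat \<Rightarrow> real vec) \<Rightarrow> bool" where
  "is_svd A s u v \<longleftrightarrow>
    (let m = dim_row A; n = dim_col A; r = vec_space.rank m A in
      (\<forall>j<r. u j \<in> carrier_vec m \<and> v j \<in> carrier_vec n \<and> 0 < s j) \<and>
      (\<forall>i<r. \<forall>j<r. i \<le> j \<longrightarrow> s j \<le> s i) \<and>
      (\<forall>i<r. \<forall>j<r. u i \<bullet> u j = of_bool (i = j) \<and> v i \<bullet> v j = of_bool (i = j)) \<and>
      A = sum_rank_one m n {..<r} s u v)"

(* The singular vectors are not unique, but the truncated sum is the same for every
   singular value decomposition of A, so the choice made here is immaterial. *)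
definition hard_threshold :: "real \<Rightarrow> real mat \<Rightarrow> real mat" where
  "hard_threshold l A =
    (let (s, u, v) = (SOME (s, u, v). is_svd A s u v)
     in sum_rank_one (dim_row A) (dim_col A)
          {j. j < vec_space.rank (dim_row A) A \<and> l \<le> s j} s u v)"

definition frobenius_norm :: "real mat \<Rightarrow> real" where
  "frobenius_norm B = sqrt (\<Sum>i<dim_row B. \<Sum>j<dim_col B. (B $$ (i, j))\<^sup>2)"

definition l2_norm :: "real vec \<Rightarrow> real" where
  "l2_norm x = sqrt (x \<bullet> x)"

definition op_norm :: "real mat \<Rightarrow> real" where
  "op_norm B = (SUP x \<in> {x \<in> carrier_vec (dim_col B). l2_norm x \<le> 1}. l2_norm (B *\<^sub>v x))"

(* for square B *)
definition cut_norm :: "real mat \<Rightarrow> real" where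
  "cut_norm B =
    1 / (real (dim_row B))\<^sup>2 *
      Max ((\<lambda>(S, T). \<bar>\<Sum>i\<in>S. \<Sum>j\<in>T. B $$ (i, j)\<bar>) ` (Pow {..<dim_row B} \<times> Pow {..<dim_col B}))"

end

theory Submission
  imports Defs
begin

text \<open>
  Deterministic part: \<open>\<Theta>0\<close> differs from a matrix \<open>P\<close> of rank at most \<open>k\<close> only by a diagonal of size \<open>\<rho>\<close>.
  If \<open>A - P\<close> has operator norm at most \<open>lam / 2\<close>, then each left singular vector of \<open>A\<close> with singular value
  at least \<open>lam\<close> has squared projection at least \<open>3/4\<close> onto the range of \<open>P\<close>, so by Bessel's inequality there are
  at most \<open>4 * k / 3\<close> of them. Hence the thresholded matrix is within \<open>2 * lam\<close> of \<open>P\<close> in operator norm, and the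
  difference has rank \<open>O(k)\<close>, which gives the Frobenius bound.

  Probabilistic part: the operator norm of \<open>X = A - \<Theta>0\<close> is \<open>O(sqrt (\<rho> * n))\<close>. With \<open>p\<close> the ceiling of \<open>\<rho> * n\<close>,
  only closed walks traversing every edge at least twice contribute to the expected trace of \<open>X ^ (2 * p)\<close>, and
  a walk on \<open>v\<close> vertices contributes at most \<open>\<rho> ^ (v - 1)\<close>. Since \<open>v \<le> p + 1\<close>, such a walk can be transplanted to
  \<open>2 * p\<close> vertices in at least \<open>p ^ v\<close> ways, so the trace is at most \<open>n / p\<close> times the expected trace of the
  same power of a dense \<open>2 * p\<close> by \<open>2 * p\<close> matrix with bounded entries, in the spirit of Bandeira and van Handel.
  That one is controlled by a net and sub-Gaussian moments. Markov's inequality with \<open>p \<ge> ln n\<close> concludes.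
\<close>


section \<open>Operator norm bounds and orthonormal families\<close>

text \<open>A net applied to \<open>A - \<Theta>0\<close> itself would be too crude: for small
  \<rho> a centered Bernoulli variable of variance about \<rho> is sub-Gaussian only with a variance
  proxy much larger than \<rho>. Walk moments of order \<open>2 * p\<close> see the variance through
  the number of distinct edges, and transplantation leaves a matrix whose entries are of order one.
  There a net of exponential size in \<open>p\<close> costs only a constant factor, because moments
  of order \<open>2 * p\<close> are taken.

  An edge may be traversed three times, and the comparison must not lose such walks. A symmetric
  comparison law would give them weight 0; hence a skewed one, Bernoulli with parameter 1/3.

  The hypothesis ln n \<le> \<rho> n acts twice: for n at least 2 it keeps \<rho> n away from 0, so
  that rounding up to \<open>p\<close> costs a factor 3, and it makes exp (6 p) beat n^6 in Markov's
  inequality.\<close>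

definition ip :: "nat \<Rightarrow> (nat \<Rightarrow> real) \<Rightarrow> (nat \<Rightarrow> real) \<Rightarrow> real" where
  "ip n x y = (\<Sum>i<n. x i * y i)"

abbreviation nrm :: "nat \<Rightarrow> (nat \<Rightarrow> real) \<Rightarrow> real" where
  "nrm n x \<equiv> L2_set x {..<n}"

definition app :: "nat \<Rightarrow> (nat \<Rightarrow> nat \<Rightarrow> real) \<Rightarrow> (nat \<Rightarrow> real) \<Rightarrow> nat \<Rightarrow> real" where
  "app n A x = (\<lambda>i. \<Sum>j<n. A i j * x j)"

definition bil :: "nat \<Rightarrow> (nat \<Rightarrow> nat \<Rightarrow> real) \<Rightarrow> (nat \<Rightarrow> real) \<Rightarrow> (nat \<Rightarrow> real) \<Rightarrow> real" where
  "bil n A x y = (\<Sum>i<n. \<Sum>j<n. x i * A i j * y j)"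

text \<open>A predicate in place of the supremum in \<open>op_norm\<close>, so that bounds can be
  added without arguments about boundedness. The one-sided inequality is enough because
  \<open>x\<close> may be negated.\<close>

definition opbd :: "nat \<Rightarrow> (nat \<Rightarrow> nat \<Rightarrow> real) \<Rightarrow> real \<Rightarrow> bool" where
  "opbd n A M \<longleftrightarrow> 0 \<le> M \<and> (\<forall>x y. bil n A x y \<le> M * nrm n x * nrm n y)"

definition flip_mat :: "('a \<Rightarrow> 'a \<Rightarrow> real) \<Rightarrow> 'a \<Rightarrow> 'a \<Rightarrow> real" where
  "flip_mat A = (\<lambda>i j. A j i)"

definition orthonormal_on :: "nat \<Rightarrow> 'a set \<Rightarrow> ('a \<Rightarrow> nat \<Rightarrow> real) \<Rightarrow> bool" where
  "orthonormal_on n J u \<longleftrightarrow> (\<forall>i\<in>J. \<forall>j\<in>J. ip n (u i) (u j) = of_bool (i = j))"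

lemma ip_self: "ip n x x = (nrm n x)\<^sup>2"
  by (simp only: ip_def L2_set_def real_sqrt_pow2[OF sum_nonneg[OF zero_le_power2]])
    (simp add: power2_eq_square)

lemma ip_commute: "ip n x y = ip n y x"
  by (simp add: ip_def mult.commute)

lemma ip_le: "ip n x y \<le> nrm n x * nrm n y"
proof -
  have "ip n x y \<le> (\<Sum>i<n. \<bar>x i\<bar> * \<bar>y i\<bar>)"
    unfolding ip_def by (intro sum_mono) (metis abs_ge_self abs_mult)
  also have "\<dots> \<le> nrm n x * nrm n y" by (rule L2_set_mult_ineq)
  finally show ?thesis .
qed

lemma ip_diff_right: "ip n x (\<lambda>i. y i - z i) = ip n x y - ip n x z"
  by (simp add: ip_def algebra_simps sum_subtractf)

lemma ip_diff_left: "ip n (\<lambda>i. y i - z i) x = ip n y x - ip n z x"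
  by (simp add: ip_def algebra_simps sum_subtractf)

lemma ip_scale_right: "ip n x (\<lambda>i. c * y i) = c * ip n x y"
  by (simp add: ip_def sum_distrib_left mult_ac)

lemma ip_scale_left: "ip n (\<lambda>i. c * y i) x = c * ip n y x"
  by (simp add: ip_def sum_distrib_left mult_ac)

lemma ip_sum_right: "ip n x (\<lambda>i. \<Sum>j\<in>J. f j i) = (\<Sum>j\<in>J. ip n x (f j))"
  unfolding ip_def by (simp add: sum_distrib_left) (rule sum.swap)

lemma ip_sum_left: "ip n (\<lambda>i. \<Sum>j\<in>J. f j i) x = (\<Sum>j\<in>J. ip n (f j) x)"
  by (simp add: ip_commute[of n _ x] ip_sum_right)

lemmas ip_linear = ip_diff_left ip_diff_right ip_scale_left ip_scale_right ip_sum_left ip_sum_right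

lemma ip_cong: "(\<And>i. i < n \<Longrightarrow> x i = x' i) \<Longrightarrow> (\<And>i. i < n \<Longrightarrow> y i = y' i) \<Longrightarrow> ip n x y = ip n x' y'"
  by (simp add: ip_def)

lemma nrm_cong: "(\<And>i. i < n \<Longrightarrow> x i = x' i) \<Longrightarrow> nrm n x = nrm n x'"
  by (intro L2_set_cong) auto

lemma nrm_0_iff: "nrm n x = 0 \<longleftrightarrow> (\<forall>i<n. x i = 0)"
  by (auto simp: L2_set_eq_0_iff)

lemma nrm_scale: "nrm n (\<lambda>i. c * x i) = \<bar>c\<bar> * nrm n x"
  by (simp add: L2_set_def power_mult_distrib real_sqrt_mult flip: sum_distrib_left)

lemma nrm_diff_sq: "(nrm n (\<lambda>i. x i - y i))\<^sup>2 = (nrm n x)\<^sup>2 - 2 * ip n x y + (nrm n y)\<^sup>2"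
  by (simp add: ip_self[symmetric] ip_linear ip_commute[of n y x])

lemma nrm_sq: "(nrm n x)\<^sup>2 = (\<Sum>i<n. (x i)\<^sup>2)"
  by (simp add: L2_set_def sum_nonneg)

lemma bil_ip: "bil n A x y = ip n x (app n A y)"
  by (simp add: bil_def ip_def app_def sum_distrib_left mult_ac)

lemma bil_flip: "bil n (flip_mat A) x y = bil n A y x"
  unfolding bil_def flip_mat_def by (subst sum.swap) (simp add: mult_ac)

lemma opbd_flip: "opbd n A M \<Longrightarrow> opbd n (flip_mat A) M"
  unfolding opbd_def bil_flip by (metis mult.assoc mult.commute)

lemma bil_ip_left: "bil n A x y = ip n (app n (flip_mat A) x) y"
  by (metis bil_flip bil_ip ip_commute)

text \<open>Testing the form at \<open>app n A x\<close> and \<open>x\<close> gives the squared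
  norm; one factor cancels.\<close>

lemma opbd_app: assumes "opbd n A M" shows "nrm n (app n A x) \<le> M * nrm n x"
proof (cases "nrm n (app n A x) = 0")
  case True thus ?thesis using assms by (simp add: opbd_def)
next
  case False
  have "nrm n (app n A x) * nrm n (app n A x) = bil n A (app n A x) x"
    by (simp add: bil_ip ip_self power2_eq_square)
  also have "\<dots> \<le> M * nrm n (app n A x) * nrm n x" using assms by (simp add: opbd_def)
  finally have "nrm n (app n A x) * nrm n (app n A x) \<le> nrm n (app n A x) * (M * nrm n x)"
    by (simp add: mult_ac)
  moreover have "nrm n (app n A x) > 0" using False by (simp add: order_less_le)
  ultimately show ?thesis by (simp add: mult_le_cancel_left)
qed

lemma opbdI_app:
  assumes "0 \<le> M" "\<And>x. nrm n (app n A x) \<le> M * nrm n x" shows "opbd n A M"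
  unfolding opbd_def
proof (intro conjI allI)
  fix x y
  have "bil n A x y \<le> nrm n x * nrm n (app n A y)" by (simp add: bil_ip ip_le)
  also have "\<dots> \<le> nrm n x * (M * nrm n y)" by (intro mult_left_mono assms) simp
  finally show "bil n A x y \<le> M * nrm n x * nrm n y" by (simp add: mult_ac)
qed fact

lemma opbd_mono: "opbd n A M \<Longrightarrow> M \<le> N \<Longrightarrow> opbd n A N"
  unfolding opbd_def by (meson L2_set_nonneg mult_right_mono order_trans)

lemma opbd_cong: "(\<And>i j. i < n \<Longrightarrow> j < n \<Longrightarrow> A i j = B i j) \<Longrightarrow> opbd n A M = opbd n B M"
  by (simp add: opbd_def bil_def)

lemma opbd_uminus: assumes "opbd n A M" shows "opbd n (\<lambda>i j. - A i j) M"
  unfolding opbd_def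
proof (intro conjI allI)
  show "0 \<le> M" using assms by (simp add: opbd_def)
  fix x y
  have "bil n (\<lambda>i j. - A i j) x y = bil n A (\<lambda>i. -1 * x i) y" by (simp add: bil_def)
  also have "\<dots> \<le> M * nrm n (\<lambda>i. -1 * x i) * nrm n y" using assms unfolding opbd_def by blast
  finally show "bil n (\<lambda>i j. - A i j) x y \<le> M * nrm n x * nrm n y" by (subst (asm) nrm_scale) simp
qed

lemma opbd_add: assumes "opbd n A M" "opbd n B N" shows "opbd n (\<lambda>i j. A i j + B i j) (M + N)"
  unfolding opbd_def
proof (intro conjI allI)
  show "0 \<le> M + N" using assms by (simp add: opbd_def)
  fix x y
  have "bil n (\<lambda>i j. A i j + B i j) x y = bil n A x y + bil n B x y"
    by (simp add: bil_def algebra_simps sum.distrib)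
  also have "\<dots> \<le> M * nrm n x * nrm n y + N * nrm n x * nrm n y"
    using assms unfolding opbd_def by (intro add_mono) blast+
  finally show "bil n (\<lambda>i j. A i j + B i j) x y \<le> (M + N) * nrm n x * nrm n y"
    by (simp add: algebra_simps)
qed

lemma opbd_diff: "opbd n A M \<Longrightarrow> opbd n B N \<Longrightarrow> opbd n (\<lambda>i j. A i j - B i j) (M + N)"
  using opbd_add[OF _ opbd_uminus] by simp

lemma opbd_diag:
  assumes "0 \<le> d" "\<And>i. i < n \<Longrightarrow> \<bar>D i\<bar> \<le> d"
  shows "opbd n (\<lambda>i j. if i = j then D i else 0) d"
proof (rule opbdI_app[OF assms(1)])
  fix x
  have "nrm n (app n (\<lambda>i j. if i = j then D i else 0) x) = nrm n (\<lambda>i. D i * x i)"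
    by (intro nrm_cong) (simp add: app_def mult_delta_left)
  also have "\<dots> \<le> nrm n (\<lambda>i. d * x i)"
    unfolding L2_set_def power_mult_distrib
    by (intro real_sqrt_le_mono sum_mono mult_right_mono)
      (use assms in \<open>auto simp flip: abs_le_square_iff\<close>)
  also have "\<dots> = d * nrm n x" using assms(1) by (simp add: nrm_scale)
  finally show "nrm n (app n (\<lambda>i j. if i = j then D i else 0) x) \<le> d * nrm n x" .
qed

lemma nrm_orthonormal_comb:
  assumes "finite J" "orthonormal_on n J u"
  shows "(nrm n (\<lambda>i. \<Sum>j\<in>J. c j * u j i))\<^sup>2 = (\<Sum>j\<in>J. (c j)\<^sup>2)"
proof -
  have "(nrm n (\<lambda>i. \<Sum>j\<in>J. c j * u j i))\<^sup>2 = (\<Sum>j\<in>J. c j * (\<Sum>i\<in>J. c i * ip n (u i) (u j)))"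
    unfolding ip_self[symmetric] ip_sum_left ip_scale_left unfolding ip_sum_right ip_scale_right
    by (simp only: ip_commute)
  also have "\<dots> = (\<Sum>j\<in>J. c j * (\<Sum>i\<in>J. if i = j then c i else 0))"
    using assms(2) by (intro sum.cong refl arg_cong2[of _ _ _ _ "(*)"]) (auto simp: orthonormal_on_def)
  also have "\<dots> = (\<Sum>j\<in>J. (c j)\<^sup>2)"
    using assms(1) by (simp add: sum.delta power2_eq_square)
  finally show ?thesis .
qed

lemma bessel:
  assumes "finite J" "orthonormal_on n J u"
  shows "(\<Sum>j\<in>J. (ip n (u j) x)\<^sup>2) \<le> (nrm n x)\<^sup>2"
proof -
  let ?y = "\<lambda>i. \<Sum>j\<in>J. ip n (u j) x * u j i"
  have 1: "ip n x ?y = (\<Sum>j\<in>J. (ip n (u j) x)\<^sup>2)"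
    by (simp add: ip_linear ip_commute[of n x] power2_eq_square)
  note 2 = nrm_orthonormal_comb[OF assms]
  have "0 \<le> (nrm n (\<lambda>i. x i - ?y i))\<^sup>2" by simp
  also have "\<dots> = (nrm n x)\<^sup>2 - (\<Sum>j\<in>J. (ip n (u j) x)\<^sup>2)" unfolding nrm_diff_sq 1 2 by simp
  finally show ?thesis by simp
qed

lemma orthonormal_on_nrm: "orthonormal_on n J u \<Longrightarrow> j \<in> J \<Longrightarrow> nrm n (u j) = 1"
proof -
  assume a: "orthonormal_on n J u" "j \<in> J"
  hence "(nrm n (u j))\<^sup>2 = 1" by (simp add: orthonormal_on_def flip: ip_self)
  thus ?thesis by (simp add: power2_eq_1_iff) (metis L2_set_nonneg not_one_le_zero one_neq_neg_one neg_0_le_iff_le)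
qed

lemma orthonormal_on_subset: "orthonormal_on n J u \<Longrightarrow> I \<subseteq> J \<Longrightarrow> orthonormal_on n I u"
  unfolding orthonormal_on_def by blast

definition rank_one_sum :: "'a set \<Rightarrow> ('a \<Rightarrow> real) \<Rightarrow> ('a \<Rightarrow> nat \<Rightarrow> real) \<Rightarrow> ('a \<Rightarrow> nat \<Rightarrow> real) \<Rightarrow> nat \<Rightarrow> nat \<Rightarrow> real" where
  "rank_one_sum J s u v = (\<lambda>a b. \<Sum>j\<in>J. s j * u j a * v j b)"

lemma app_rank_one_sum: "app n (rank_one_sum J s u v) x = (\<lambda>a. \<Sum>j\<in>J. s j * ip n (v j) x * u j a)"
  unfolding app_def rank_one_sum_def ip_def
  by (rule ext, simp add: sum_distrib_left sum_distrib_right, subst sum.swap) (simp add: mult_ac)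

lemma flip_rank_one_sum: "flip_mat (rank_one_sum J s u v) = rank_one_sum J s v u"
  by (simp add: flip_mat_def rank_one_sum_def mult_ac)

lemma bil_rank_one_sum: "bil n (rank_one_sum J s u v) x y = (\<Sum>j\<in>J. s j * ip n (u j) x * ip n (v j) y)"
  by (simp add: bil_ip app_rank_one_sum ip_linear) (simp add: ip_commute[of n x] mult_ac)

text \<open>Cauchy-Schwarz over \<open>J\<close>, then Bessel's inequality for each of the two
  families.\<close>

lemma opbd_rank_one_sum:
  assumes J: "finite J" and u: "orthonormal_on n J u" and v: "orthonormal_on n J v"
    and s: "\<And>j. j \<in> J \<Longrightarrow> 0 \<le> s j" "\<And>j. j \<in> J \<Longrightarrow> s j \<le> M" and M: "0 \<le> M"
  shows "opbd n (rank_one_sum J s u v) M"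
  unfolding opbd_def
proof (intro conjI allI M)
  fix x y
  have "bil n (rank_one_sum J s u v) x y = (\<Sum>j\<in>J. s j * (ip n (u j) x * ip n (v j) y))"
    by (simp add: bil_rank_one_sum mult_ac)
  also have "\<dots> \<le> (\<Sum>j\<in>J. M * (\<bar>ip n (u j) x\<bar> * \<bar>ip n (v j) y\<bar>))"
  proof (rule sum_mono)
    fix j assume j: "j \<in> J"
    have "s j * (ip n (u j) x * ip n (v j) y) \<le> s j * (\<bar>ip n (u j) x\<bar> * \<bar>ip n (v j) y\<bar>)"
      by (intro mult_left_mono s(1) j) (metis abs_ge_self abs_mult)
    also have "\<dots> \<le> M * (\<bar>ip n (u j) x\<bar> * \<bar>ip n (v j) y\<bar>)"
      by (intro mult_right_mono s(2) j) simp
    finally show "s j * (ip n (u j) x * ip n (v j) y) \<le> M * (\<bar>ip n (u j) x\<bar> * \<bar>ip n (v j) y\<bar>)" .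
  qed
  also have "\<dots> = M * (\<Sum>j\<in>J. \<bar>ip n (u j) x\<bar> * \<bar>ip n (v j) y\<bar>)" by (simp add: sum_distrib_left)
  also have "\<dots> \<le> M * (L2_set (\<lambda>j. ip n (u j) x) J * L2_set (\<lambda>j. ip n (v j) y) J)"
    by (intro mult_left_mono L2_set_mult_ineq M)
  also have "\<dots> \<le> M * (nrm n x * nrm n y)"
    unfolding L2_set_def[of _ J]
    by (intro mult_left_mono mult_mono M real_le_lsqrt bessel J u v) (auto simp: sum_nonneg)
  finally show "bil n (rank_one_sum J s u v) x y \<le> M * nrm n x * nrm n y" by (simp add: mult_ac)
qed

section \<open>Singular value decomposition\<close>

lemma continuous_on_coord: "continuous_on S (\<lambda>x::nat \<Rightarrow> real. x i)"
  by (rule continuous_on_subset[OF continuous_on_product_coordinates]) simp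

text \<open>Vectors are functions on all of \<open>nat\<close> with the product topology. Forcing
  the coordinates from \<open>n\<close> on to be 0 puts the sphere inside a product of compact
  intervals.\<close>

lemma compact_coordinate_sphere:
  "compact {x :: nat \<Rightarrow> real. (\<forall>i\<ge>n. x i = 0) \<and> nrm n x = 1}"
proof -
  let ?B = "PiE UNIV (\<lambda>i. if i < n then {-1..1} else {0::real})"
  have "compactin (product_topology (\<lambda>i. euclidean) UNIV) ?B"
    unfolding compactin_PiE by auto
  hence B: "compact ?B" by (simp add: euclidean_product_topology)
  have "continuous_on UNIV (\<lambda>x. nrm n x)"
    unfolding L2_set_def by (intro continuous_intros continuous_on_coord)
  hence C: "closed {x. nrm n x = 1}" by (rule closed_Collect_eq) (rule continuous_on_const)
  have "{x :: nat \<Rightarrow> real. (\<forall>i\<ge>n. x i = 0) \<and> nrm n x = 1} = ?B \<inter> {x. nrm n x = 1}"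
  proof (intro equalityI subsetI)
    fix x assume x: "x \<in> {x :: nat \<Rightarrow> real. (\<forall>i\<ge>n. x i = 0) \<and> nrm n x = 1}"
    have "\<bar>x i\<bar> \<le> 1" if "i < n" for i
      using member_le_L2_set[of "{..<n}" i "\<lambda>i. \<bar>x i\<bar>"] that x by (simp add: L2_set_def)
    hence "x i \<in> (if i < n then {-1..1} else {0})" for i using x by (cases "i < n") (auto simp: abs_le_iff minus_le_iff)
    thus "x \<in> ?B \<inter> {x. nrm n x = 1}" using x by (simp add: PiE_iff)
  next
    fix x assume "x \<in> ?B \<inter> {x. nrm n x = 1}"
    thus "x \<in> {x :: nat \<Rightarrow> real. (\<forall>i\<ge>n. x i = 0) \<and> nrm n x = 1}"
      by (auto simp: PiE_iff) (metis not_less singletonD)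
  qed
  thus ?thesis using compact_Int_closed[OF B C] by simp
qed

lemma nrm_unit: "i < n \<Longrightarrow> nrm n (\<lambda>k. of_bool (k = i)) = 1"
proof -
  assume "i < n"
  moreover have "(of_bool b)\<^sup>2 = (of_bool b :: real)" for b by simp
  ultimately show ?thesis by (simp only: L2_set_def) (simp add: of_bool_def)
qed

lemma ip_unit: "i < n \<Longrightarrow> ip n x (\<lambda>k. of_bool (k = i)) = x i"
proof -
  assume "i < n"
  moreover have "ip n x (\<lambda>k. of_bool (k = i)) = (\<Sum>k<n. if k = i then x k else 0)"
    unfolding ip_def by (intro sum.cong) auto
  ultimately show ?thesis by simp
qed

lemma bil_attains_max:
  assumes "0 < n"
  obtains u v where "nrm n u = 1" "nrm n v = 1"
    "\<And>x y. bil n A x y \<le> bil n A u v * nrm n x * nrm n y"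
proof -
  let ?S = "{x :: nat \<Rightarrow> real. (\<forall>i\<ge>n. x i = 0) \<and> nrm n x = 1}"
  have c: "continuous_on T (\<lambda>p. fst p i)" "continuous_on T (\<lambda>p. snd p i)"
    for T :: "((nat \<Rightarrow> real) \<times> (nat \<Rightarrow> real)) set" and i
    by (rule continuous_on_compose2[OF continuous_on_coord[of UNIV]];
      simp add: continuous_on_fst continuous_on_snd)+
  have cont: "continuous_on (?S \<times> ?S) (\<lambda>p. bil n A (fst p) (snd p))"
    unfolding bil_def by (intro continuous_on_sum continuous_on_mult continuous_on_const c)
  have "(\<lambda>i. of_bool (i = 0)) \<in> ?S"
    unfolding mem_Collect_eq using assms nrm_unit[of 0 n] by (intro conjI) simp_all
  hence ne: "?S \<times> ?S \<noteq> {}" unfolding Times_empty by (metis empty_iff)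
  obtain p where p: "p \<in> ?S \<times> ?S"
    "\<forall>q \<in> ?S \<times> ?S. bil n A (fst q) (snd q) \<le> bil n A (fst p) (snd p)"
    using continuous_attains_sup[OF compact_Times[OF compact_coordinate_sphere compact_coordinate_sphere] ne cont]
    by (rule bexE)
  show thesis
  proof (rule that[of "fst p" "snd p"])
    show "nrm n (fst p) = 1" "nrm n (snd p) = 1" using p(1) by auto
    fix x y
    show "bil n A x y \<le> bil n A (fst p) (snd p) * nrm n x * nrm n y"
    proof (cases "nrm n x = 0 \<or> nrm n y = 0")
      case True
      hence "bil n A x y = 0" unfolding bil_def by (intro sum.neutral ballI) (auto simp: nrm_0_iff)
      thus ?thesis using True by auto
    next
      case False
      let ?c = "inverse (nrm n x)" and ?d = "inverse (nrm n y)"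
      \<comment> \<open>Coordinates from \<open>n\<close> on are cut off so that the normalised
        vectors lie in \<open>?S\<close>; the form does not see them.\<close>
      let ?x = "\<lambda>i. if i < n then ?c * x i else 0" and ?y = "\<lambda>i. if i < n then ?d * y i else 0"
      have 1: "nrm n ?x = 1" "nrm n ?y = 1"
      proof -
        have "nrm n ?x = nrm n (\<lambda>i. ?c * x i)" "nrm n ?y = nrm n (\<lambda>i. ?d * y i)"
          by (rule nrm_cong, simp)+
        thus "nrm n ?x = 1" "nrm n ?y = 1" using False unfolding nrm_scale by simp_all
      qed
      have "?c * ?d * bil n A x y = bil n A ?x ?y"
        unfolding bil_def sum_distrib_left by (intro sum.cong) simp_all
      also have "\<dots> \<le> bil n A (fst p) (snd p)" using p(2)[rule_format, of "(?x, ?y)"] 1 by simp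
      finally have "?c * ?d * bil n A x y \<le> bil n A (fst p) (snd p)" .
      moreover have "0 < nrm n x" "0 < nrm n y" using False by (simp_all add: order_less_le)
      ultimately show ?thesis by (simp add: field_simps)
    qed
  qed
qed

text \<open>A maximiser of the form over pairs of unit vectors is a singular pair:
  \<open>app n A v\<close> has norm at most \<open>s\<close> and inner product \<open>s\<close> with
  the unit vector \<open>u\<close>, the equality case of Cauchy-Schwarz.\<close>

lemma top_singular_triple:
  assumes "i < n" "j < n" "A i j \<noteq> 0"
  obtains s u v where "0 < s" "nrm n u = 1" "nrm n v = 1" "opbd n A s" "bil n A u v = s"
    "\<And>a. a < n \<Longrightarrow> app n A v a = s * u a" "\<And>a. a < n \<Longrightarrow> app n (flip_mat A) u a = s * v a"
proof -
  have n: "0 < n" using assms by simp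
  obtain u v where u: "nrm n u = 1" and v: "nrm n v = 1"
    and m: "\<And>x y. bil n A x y \<le> bil n A u v * nrm n x * nrm n y"
    using bil_attains_max[OF n, of A] by metis
  define s where "s = bil n A u v"
  let ?e = "\<lambda>i k. of_bool (k = i) :: real"
  have e: "nrm n (?e k) = 1" if "k < n" for k using nrm_unit[OF that] .
  have be: "bil n A (?e i) (\<lambda>k. c * ?e j k) = c * A i j" for c
  proof -
    have "bil n A (?e i) (\<lambda>k. c * ?e j k) = app n A (\<lambda>k. c * ?e j k) i"
      unfolding bil_ip ip_commute[of n "?e i"] by (rule ip_unit[OF assms(1)])
    also have "\<dots> = c * ip n (A i) (?e j)"
      unfolding ip_scale_right[symmetric] by (simp only: app_def ip_def)
    finally show ?thesis by (simp only: ip_unit[OF assms(2)])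
  qed
  \<comment> \<open>Coordinate vectors carrying the sign of the nonzero entry show that the maximum
    is positive.\<close>
  have "\<bar>A i j\<bar> = bil n A (?e i) (\<lambda>k. sgn (A i j) * ?e j k)" unfolding be by (simp add: abs_sgn mult.commute)
  also have "\<dots> \<le> s * nrm n (?e i) * nrm n (\<lambda>k. sgn (A i j) * ?e j k)" unfolding s_def by (rule m)
  also have "\<dots> = s"
    unfolding nrm_scale e[OF assms(1)] e[OF assms(2)] using assms(3) by (simp add: abs_sgn_eq)
  finally have s: "0 < s" using assms(3) by simp
  have o: "opbd n A s" unfolding opbd_def using m s by (simp add: s_def)
  have eq: "x a = s * y a" if "ip n y x = s" "nrm n x \<le> s" "nrm n y = 1" "a < n" for x y a
  proof -
    have "(nrm n (\<lambda>i. x i - s * y i))\<^sup>2 = (nrm n x)\<^sup>2 - s\<^sup>2"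
      unfolding nrm_diff_sq nrm_scale ip_scale_right ip_commute[of n x] that(1) that(3)
      using s by (simp add: power2_eq_square)
    also have "\<dots> \<le> 0" using that(2) by (simp add: power_mono)
    finally have "nrm n (\<lambda>i. x i - s * y i) = 0" by simp
    thus ?thesis using that(4) by (simp add: nrm_0_iff)
  qed
  show thesis
  proof (rule that[of s u v])
    show "app n A v a = s * u a" if "a < n" for a
      using opbd_app[OF o, of v] v u that by (intro eq) (simp_all add: s_def bil_ip)
    show "app n (flip_mat A) u a = s * v a" if "a < n" for a
      using opbd_app[OF opbd_flip[OF o], of u] v u that
      by (intro eq) (simp_all add: s_def bil_ip_left ip_commute)
  qed (use s u v o in \<open>auto simp: s_def\<close>)
qed

text \<open>Bessel's inequality summed over the \<open>n\<close> coordinate vectors counts the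
  family, since each member contributes its squared norm 1.\<close>

lemma card_orthonormal_le:
  assumes "finite J" "orthonormal_on n J u" shows "card J \<le> n"
proof -
  let ?e = "\<lambda>i k. of_bool (k = i) :: real"
  have e: "nrm n (?e k) = 1" if "k < n" for k using nrm_unit[OF that] .
  have ie: "ip n x (?e k) = x k" if "k < n" for k x using ip_unit[OF that] .
  have "real (card J) = (\<Sum>j\<in>J. (nrm n (u j))\<^sup>2)" using orthonormal_on_nrm[OF assms(2)] by simp
  also have "\<dots> = (\<Sum>k<n. \<Sum>j\<in>J. (ip n (u j) (?e k))\<^sup>2)"
    unfolding nrm_sq by (subst sum.swap) (intro sum.cong refl, simp only: ie lessThan_iff)
  also have "\<dots> \<le> (\<Sum>k<n. (nrm n (?e k))\<^sup>2)" by (intro sum_mono bessel assms)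
  also have "\<dots> = (\<Sum>k<n. 1)" by (intro sum.cong refl) (simp only: e lessThan_iff power_one)
  finally show ?thesis by simp
qed

text \<open>The last clause is the invariant of the deflation: it makes the top singular vectors of the
  remainder orthogonal to the earlier ones, and its singular value no larger.\<close>
definition partial_svd ::
  "nat \<Rightarrow> (nat \<Rightarrow> nat \<Rightarrow> real) \<Rightarrow> nat \<Rightarrow> (nat \<Rightarrow> real) \<Rightarrow> (nat \<Rightarrow> nat \<Rightarrow> real) \<Rightarrow> (nat \<Rightarrow> nat \<Rightarrow> real) \<Rightarrow> bool"
where
  "partial_svd n A r s u v \<longleftrightarrow>
    orthonormal_on n {..<r} u \<and> orthonormal_on n {..<r} v \<and> (\<forall>j<r. 0 < s j) \<and>
    (\<forall>i<r. \<forall>j<r. i \<le> j \<longrightarrow> s j \<le> s i) \<and>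
    (\<forall>j<r. opbd n (\<lambda>a b. A a b - rank_one_sum {..<r} s u v a b) (s j) \<and>
      (\<forall>a<n. app n (\<lambda>a b. A a b - rank_one_sum {..<r} s u v a b) (v j) a = 0) \<and>
      (\<forall>a<n. app n (flip_mat (\<lambda>a b. A a b - rank_one_sum {..<r} s u v a b)) (u j) a = 0))"

lemma app_diff: "app n (\<lambda>a b. A a b - B a b) x = (\<lambda>i. app n A x i - app n B x i)"
  by (simp add: app_def algebra_simps sum_subtractf)

lemma flip_diff: "flip_mat (\<lambda>a b. A a b - B a b) = (\<lambda>a b. flip_mat A a b - flip_mat B a b)"
  by (simp add: flip_mat_def)

text \<open>Deflation by the top singular triple of the remainder \<open>R\<close>. Earlier vectors
  lie in the kernels of \<open>R\<close> and of its transpose, and \<open>t\<close> is positive,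
  hence orthogonality.\<close>

lemma partial_svd_step:
  assumes p: "partial_svd n A r s u v" and nz: "i < n" "j < n" "A i j \<noteq> rank_one_sum {..<r} s u v i j"
  shows "\<exists>s' u' v'. partial_svd n A (Suc r) s' u' v'"
proof -
  define R where "R = (\<lambda>a b. A a b - rank_one_sum {..<r} s u v a b)"
  have "R i j \<noteq> 0" using nz by (simp add: R_def)
  then obtain t x y where t: "0 < t" "nrm n x = 1" "nrm n y = 1" and o: "opbd n R t" "bil n R x y = t"
    and Ry: "\<And>a. a < n \<Longrightarrow> app n R y a = t * x a" and Rx: "\<And>a. a < n \<Longrightarrow> app n (flip_mat R) x a = t * y a"
    using top_singular_triple[OF nz(1,2), of R] by metis
  have u: "orthonormal_on n {..<r} u" and v: "orthonormal_on n {..<r} v" and s: "\<And>j. j < r \<Longrightarrow> 0 < s j"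
    and mono: "\<And>i j. i < r \<Longrightarrow> j < r \<Longrightarrow> i \<le> j \<Longrightarrow> s j \<le> s i"
    and Rs: "\<And>j. j < r \<Longrightarrow> opbd n R (s j)"
    and Rv: "\<And>j a. j < r \<Longrightarrow> a < n \<Longrightarrow> app n R (v j) a = 0"
    and Ru: "\<And>j a. j < r \<Longrightarrow> a < n \<Longrightarrow> app n (flip_mat R) (u j) a = 0"
    using p unfolding partial_svd_def R_def by auto
  have "t * ip n (u j) x = 0" if "j < r" for j
  proof -
    have "t * ip n (u j) x = ip n (u j) (app n R y)"
      unfolding ip_scale_right[symmetric] by (rule ip_cong) (simp_all add: Ry)
    also have "\<dots> = ip n (app n (flip_mat R) (u j)) y" by (simp flip: bil_ip bil_ip_left)
    also have "\<dots> = 0" using Ru[OF that] by (simp add: ip_def)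
    finally show ?thesis .
  qed
  hence ux: "ip n (u j) x = 0" "ip n x (u j) = 0" if "j < r" for j using that t by (auto simp: ip_commute)
  have "t * ip n (v j) y = 0" if "j < r" for j
  proof -
    have "t * ip n (v j) y = ip n (app n (flip_mat R) x) (v j)"
      unfolding ip_scale_right[symmetric] ip_commute[of n _ "v j"] by (rule ip_cong) (simp_all add: Rx)
    also have "\<dots> = ip n x (app n R (v j))" by (simp flip: bil_ip bil_ip_left)
    also have "\<dots> = 0" using Rv[OF that] by (simp add: ip_def)
    finally show ?thesis .
  qed
  hence vy: "ip n (v j) y = 0" "ip n y (v j) = 0" if "j < r" for j using that t by (auto simp: ip_commute)
  have ts: "t \<le> s j" if "j < r" for j
  proof -
    have "bil n R x y \<le> s j * nrm n x * nrm n y" using Rs[OF that] unfolding opbd_def by blast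
    thus ?thesis using o t by simp
  qed
  let ?s = "s(r := t)" and ?u = "u(r := x)" and ?v = "v(r := y)"
  let ?R = "\<lambda>a b. A a b - rank_one_sum {..<Suc r} ?s ?u ?v a b"
  have old: "rank_one_sum {..<r} ?s ?u ?v = rank_one_sum {..<r} s u v"
    unfolding rank_one_sum_def by (intro ext sum.cong) auto
  have R': "?R = (\<lambda>a b. R a b - t * x a * y b)"
    using old by (simp add: R_def rank_one_sum_def fun_eq_iff)
  have ap: "app n ?R z a = app n R z a - t * ip n y z * x a" for z a
    unfolding R' app_diff by (simp add: app_def ip_def sum_distrib_left sum_distrib_right mult_ac)
  have ap': "app n (flip_mat ?R) z a = app n (flip_mat R) z a - t * ip n x z * y a" for z a
    unfolding R' flip_diff app_diff
    by (simp add: flip_mat_def app_def ip_def sum_distrib_left sum_distrib_right mult_ac)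
  have "opbd n ?R t"
  proof (rule opbdI_app)
    show "0 \<le> t" using t by simp
    fix z
    let ?z = "\<lambda>i. z i - ip n y z * y i"
    \<comment> \<open>Subtracting the new rank-one term amounts to removing from \<open>z\<close>
      its component along \<open>y\<close>, which does not lengthen \<open>z\<close>; so the new
      remainder inherits the bound \<open>t\<close>.\<close>
    have "app n ?R z a = app n R ?z a" if "a < n" for a
    proof -
      have "app n R ?z a = app n R z a - ip n y z * app n R y a"
        by (simp add: app_def algebra_simps sum_subtractf sum_distrib_left)
      thus ?thesis using Ry[OF that] by (simp add: ap)
    qed
    hence "nrm n (app n ?R z) = nrm n (app n R ?z)" by (rule nrm_cong)
    also have "\<dots> \<le> t * nrm n ?z" by (rule opbd_app[OF o(1)])
    also have "nrm n ?z \<le> nrm n z"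
    proof (rule power2_le_imp_le)
      have "(nrm n ?z)\<^sup>2 = (nrm n z)\<^sup>2 - (ip n y z)\<^sup>2"
      unfolding nrm_diff_sq nrm_scale ip_scale_right ip_commute[of n z] t
      by (simp add: power2_eq_square)
      thus "(nrm n ?z)\<^sup>2 \<le> (nrm n z)\<^sup>2"
        using zero_le_power2[of "ip n y z"] by linarith
    qed simp
    finally show "nrm n (app n ?R z) \<le> t * nrm n z" using t by simp
  qed
  hence op: "opbd n ?R (?s j)" if "j < Suc r" for j
    using opbd_mono[OF _ ts[of j]] that by (cases "j = r") simp_all
  have ou: "orthonormal_on n {..<Suc r} ?u" and ov: "orthonormal_on n {..<Suc r} ?v"
    using u v ux vy ip_self[of n x] ip_self[of n y] t unfolding orthonormal_on_def
    by (auto simp: less_Suc_eq)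
  have k1: "app n ?R (?v j) a = 0" if "j < Suc r" "a < n" for j a
  proof (cases "j = r")
    case True thus ?thesis unfolding ap using Ry[OF that(2)] t by (simp add: ip_self)
  next
    case False
    hence "j < r" using that by simp
    thus ?thesis unfolding ap using Rv[of j a] vy[of j] that by simp
  qed
  have k2: "app n (flip_mat ?R) (?u j) a = 0" if "j < Suc r" "a < n" for j a
  proof (cases "j = r")
    case True thus ?thesis unfolding ap' using Rx[OF that(2)] t by (simp add: ip_self)
  next
    case False
    hence "j < r" using that by simp
    thus ?thesis unfolding ap' using Ru[of j a] ux[of j] that by simp
  qed
  have pos: "0 < ?s j" if "j < Suc r" for j using that s t by (cases "j = r") simp_all
  have mono': "?s j \<le> ?s i" if "i < Suc r" "j < Suc r" "i \<le> j" for i j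
    using that mono[of i j] ts[of i] by (cases "j = r"; cases "i = r") simp_all
  have "partial_svd n A (Suc r) ?s ?u ?v"
    unfolding partial_svd_def by (intro conjI allI impI ou ov op k1 k2 pos mono')
  thus ?thesis by blast
qed

text \<open>Orthonormality limits the number of deflation steps to \<open>n\<close>, so there is a
  maximal one. There the remainder vanishes, as otherwise a further step would be possible.\<close>

theorem svd_exists:
  obtains r :: nat and s u v where "r \<le> n" "orthonormal_on n {..<r} u" "orthonormal_on n {..<r} v"
    "\<And>j. j < r \<Longrightarrow> (0::real) < s j" "\<And>i j. i < r \<Longrightarrow> j < r \<Longrightarrow> i \<le> j \<Longrightarrow> s j \<le> s i"
    "\<And>i j. i < n \<Longrightarrow> j < n \<Longrightarrow> A i j = rank_one_sum {..<r::nat} s u v i j"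
proof -
  let ?P = "\<lambda>r. \<exists>s u v. partial_svd n A r s u v"
  have bound: "r \<le> n" if "?P r" for r
    using that card_orthonormal_le[of "{..<r}"] unfolding partial_svd_def by auto
  have "?P 0" by (simp add: partial_svd_def orthonormal_on_def)
  define r where "r = (GREATEST r. ?P r)"
  have r: "?P r" "\<And>r'. ?P r' \<Longrightarrow> r' \<le> r"
    unfolding r_def using GreatestI_nat[of ?P 0 n] Greatest_le_nat[of ?P _ n] \<open>?P 0\<close> bound by blast+
  from r(1) obtain s u v where p: "partial_svd n A r s u v" by blast
  have "A i j = rank_one_sum {..<r} s u v i j" if "i < n" "j < n" for i j
    using partial_svd_step[OF p that] r(2)[of "Suc r"] by auto
  moreover note p[unfolded partial_svd_def]
  ultimately show thesis using that[of r u v s] bound[OF r(1)] by blast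
qed

section \<open>Hard thresholding of a perturbed low-rank matrix\<close>

text \<open>Pythagoras in each column, followed by an exchange of sums.\<close>

lemma frobenius_orthonormal_comb:
  assumes "finite J" "orthonormal_on n J u"
  shows "(\<Sum>i<n. \<Sum>j<n. (\<Sum>l\<in>J. u l i * h l j)\<^sup>2) = (\<Sum>l\<in>J. (nrm n (h l))\<^sup>2)"
proof -
  have "(\<Sum>i<n. \<Sum>j<n. (\<Sum>l\<in>J. u l i * h l j)\<^sup>2) = (\<Sum>j<n. (nrm n (\<lambda>i. \<Sum>l\<in>J. h l j * u l i))\<^sup>2)"
    unfolding nrm_sq by (subst sum.swap) (simp only: mult.commute)
  also have "\<dots> = (\<Sum>j<n. \<Sum>l\<in>J. (h l j)\<^sup>2)" by (simp only: nrm_orthonormal_comb[OF assms])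
  also have "\<dots> = (\<Sum>l\<in>J. (nrm n (h l))\<^sup>2)" unfolding nrm_sq by (rule sum.swap)
  finally show ?thesis .
qed

text \<open>With \<open>U\<close>, \<open>F\<close> the orthogonal projections onto the spans of \<open>u\<close> and \<open>f\<close>, the assumption says
  \<open>B = U B + (1 - U) B F\<close>.\<close>
lemma frobenius_le_of_projections:
  assumes J: "finite J" "orthonormal_on n J u" and K: "finite K" "orthonormal_on n K f"
    and B: "opbd n B M"
    and dec: "\<And>i j. i < n \<Longrightarrow> j < n \<Longrightarrow> B i j = (\<Sum>l\<in>J. u l i * app n (flip_mat B) (u l) j) +
      (\<Sum>a\<in>K. f a j * (app n B (f a) i - (\<Sum>l\<in>J. ip n (u l) (app n B (f a)) * u l i)))"
  shows "(\<Sum>i<n. \<Sum>j<n. (B i j)\<^sup>2) \<le> 2 * (real (card J) + real (card K)) * M\<^sup>2"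
proof -
  have M: "0 \<le> M" using B by (simp add: opbd_def)
  \<comment> \<open>\<open>g a\<close> is (1 - U) B applied to \<open>f a\<close>; a complementary
    projection does not increase the norm.\<close>
  define g where "g a i = app n B (f a) i - (\<Sum>l\<in>J. ip n (u l) (app n B (f a)) * u l i)" for a i
  have f1: "nrm n (f a) = 1" if "a \<in> K" for a using orthonormal_on_nrm[OF K(2) that] .
  have u1: "nrm n (u l) = 1" if "l \<in> J" for l using orthonormal_on_nrm[OF J(2) that] .
  have g: "(nrm n (g a))\<^sup>2 \<le> M\<^sup>2" if "a \<in> K" for a
  proof -
    let ?c = "\<lambda>l. ip n (u l) (app n B (f a))"
    have "(nrm n (g a))\<^sup>2 = (nrm n (app n B (f a)))\<^sup>2 - 2 * ip n (app n B (f a)) (\<lambda>i. \<Sum>l\<in>J. ?c l * u l i)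
        + (nrm n (\<lambda>i. \<Sum>l\<in>J. ?c l * u l i))\<^sup>2"
      unfolding g_def by (rule nrm_diff_sq)
    also have "\<dots> = (nrm n (app n B (f a)))\<^sup>2 - (\<Sum>l\<in>J. (?c l)\<^sup>2)"
      unfolding nrm_orthonormal_comb[OF J] ip_sum_right ip_scale_right ip_commute[of n "app n B (f a)"]
      by (simp add: power2_eq_square)
    also have "\<dots> \<le> (nrm n (app n B (f a)))\<^sup>2" by (simp add: sum_nonneg)
    also have "\<dots> \<le> M\<^sup>2" using opbd_app[OF B, of "f a"] f1[OF that] by (intro power_mono) simp_all
    finally show ?thesis .
  qed
  have "(\<Sum>i<n. \<Sum>j<n. (B i j)\<^sup>2) \<le> (\<Sum>i<n. \<Sum>j<n. 2 * (\<Sum>l\<in>J. u l i * app n (flip_mat B) (u l) j)\<^sup>2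
      + 2 * (\<Sum>a\<in>K. f a j * g a i)\<^sup>2)"
  proof (intro sum_mono)
    fix i j assume "i \<in> {..<n}" "j \<in> {..<n}"
    hence "B i j = (\<Sum>l\<in>J. u l i * app n (flip_mat B) (u l) j) + (\<Sum>a\<in>K. f a j * g a i)"
      unfolding g_def using dec[of i j] by simp
    moreover have "(x + y)\<^sup>2 \<le> 2 * x\<^sup>2 + 2 * y\<^sup>2" for x y :: real
      using sum_squares_bound[of x y] by (simp add: power2_sum)
    ultimately show "(B i j)\<^sup>2 \<le> 2 * (\<Sum>l\<in>J. u l i * app n (flip_mat B) (u l) j)\<^sup>2 + 2 * (\<Sum>a\<in>K. f a j * g a i)\<^sup>2"
      by (simp only:)
  qed
  also have "\<dots> = 2 * (\<Sum>i<n. \<Sum>j<n. (\<Sum>l\<in>J. u l i * app n (flip_mat B) (u l) j)\<^sup>2)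
      + 2 * (\<Sum>i<n. \<Sum>j<n. (\<Sum>a\<in>K. f a j * g a i)\<^sup>2)"
    by (simp only: sum.distrib sum_distrib_left)
  also have "\<dots> = 2 * (\<Sum>l\<in>J. (nrm n (app n (flip_mat B) (u l)))\<^sup>2) + 2 * (\<Sum>a\<in>K. (nrm n (g a))\<^sup>2)"
    unfolding frobenius_orthonormal_comb[OF J] sum.swap[of "\<lambda>i j. (\<Sum>a\<in>K. f a j * g a i)\<^sup>2"]
      frobenius_orthonormal_comb[OF K] by (rule refl)
  also have "\<dots> \<le> 2 * (\<Sum>l\<in>J. M\<^sup>2) + 2 * (\<Sum>a\<in>K. M\<^sup>2)"
  proof (intro add_mono mult_left_mono sum_mono g)
    fix l assume "l \<in> J"
    thus "(nrm n (app n (flip_mat B) (u l)))\<^sup>2 \<le> M\<^sup>2"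
      using opbd_app[OF opbd_flip[OF B], of "u l"] u1 by (intro power_mono) simp_all
  qed simp_all
  also have "\<dots> = 2 * (real (card J) + real (card K)) * M\<^sup>2" by (simp add: algebra_simps)
  finally show ?thesis .
qed

lemma orthonormal_delta_sum:
  assumes "finite J" "orthonormal_on n J u" "l \<in> J"
  shows "(\<Sum>m\<in>J. g m * ip n (u m) (u l)) = g l" "(\<Sum>m\<in>J. g m * ip n (u l) (u m)) = g l"
proof -
  have "(\<Sum>m\<in>J. g m * ip n (u m) (u l)) = (\<Sum>m\<in>J. if m = l then g m else 0)"
    using assms by (intro sum.cong refl) (auto simp: orthonormal_on_def)
  also have "\<dots> = g l" using assms by simp
  finally show "(\<Sum>m\<in>J. g m * ip n (u m) (u l)) = g l" .
  thus "(\<Sum>m\<in>J. g m * ip n (u l) (u m)) = g l" by (simp only: ip_commute)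
qed

text \<open>\<open>dec B\<close> is U B + (1 - U) B F, which is linear in \<open>B\<close>, so the
  two terms of the difference are treated separately: U fixes the truncated sum from the left, F
  fixes \<open>P\<close> from the right.\<close>

lemma low_rank_projection_decomposition:
  fixes s :: "'a \<Rightarrow> real" and f :: "'b \<Rightarrow> nat \<Rightarrow> real" and K J u n
  defines "dec B i j \<equiv> (\<Sum>l\<in>J. u l i * app n (flip_mat B) (u l) j) +
      (\<Sum>a\<in>K. f a j * (app n B (f a) i - (\<Sum>l\<in>J. ip n (u l) (app n B (f a)) * u l i)))"
  assumes J: "finite J" "orthonormal_on n J u"
    and P: "\<And>i j. i < n \<Longrightarrow> j < n \<Longrightarrow> P i j = (\<Sum>a\<in>K. app n P (f a) i * f a j)"
    and ij: "i < n" "j < n"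
  shows "rank_one_sum J s u v i j - P i j =
    dec (\<lambda>i j. rank_one_sum J s u v i j - P i j) i j"
proof -
  let ?S = "rank_one_sum J s u v"
  have lin: "dec (\<lambda>i j. A i j - B i j) i j = dec A i j - dec B i j" for A B
    unfolding dec_def flip_diff app_diff ip_diff_right
    by (simp add: algebra_simps sum_subtractf sum.distrib)
  have "(\<Sum>l\<in>J. ip n (u l) (app n ?S x) * u l i) = app n ?S x i" for x i
  proof -
    have "ip n (u l) (app n ?S x) = s l * ip n (v l) x" if "l \<in> J" for l
      unfolding app_rank_one_sum ip_sum_right ip_scale_right by (rule orthonormal_delta_sum(2)[OF J that])
    thus ?thesis by (simp add: app_rank_one_sum)
  qed
  moreover have "(\<Sum>l\<in>J. u l i * app n (flip_mat ?S) (u l) j) = ?S i j"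
  proof -
    have "app n (flip_mat ?S) (u l) j = s l * v l j" if "l \<in> J" for l
    proof -
      have "app n (flip_mat ?S) (u l) j = (\<Sum>m\<in>J. (s m * v m j) * ip n (u m) (u l))"
        unfolding flip_rank_one_sum app_rank_one_sum by (intro sum.cong refl) (simp only: mult_ac)
      thus ?thesis using orthonormal_delta_sum(1)[OF J that, of "\<lambda>m. s m * v m j"] by (simp only:)
    qed
    thus ?thesis unfolding rank_one_sum_def by (intro sum.cong refl) (simp add: mult_ac)
  qed
  ultimately have 1: "dec ?S i j = ?S i j" unfolding dec_def by simp
  have "dec P i j = (\<Sum>l\<in>J. u l i * app n (flip_mat P) (u l) j) + (\<Sum>a\<in>K. app n P (f a) i * f a j)
    - (\<Sum>a\<in>K. \<Sum>l\<in>J. u l i * (ip n (u l) (app n P (f a)) * f a j))"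
    unfolding dec_def by (simp add: algebra_simps sum_subtractf sum_distrib_left)
  also have "(\<Sum>a\<in>K. \<Sum>l\<in>J. u l i * (ip n (u l) (app n P (f a)) * f a j))
    = (\<Sum>l\<in>J. u l i * (\<Sum>a\<in>K. ip n (u l) (app n P (f a)) * f a j))"
    by (subst sum.swap) (simp only: sum_distrib_left)
  \<comment> \<open>P F = P turns the subtracted U P F into U P, which then cancels.\<close>
  also have "\<dots> = (\<Sum>l\<in>J. u l i * app n (flip_mat P) (u l) j)"
  proof (intro sum.cong refl arg_cong2[of _ _ _ _ "(*)"])
    fix l
    have "(\<Sum>a\<in>K. ip n (u l) (app n P (f a)) * f a j) = ip n (u l) (\<lambda>m. \<Sum>a\<in>K. f a j * app n P (f a) m)"
      unfolding ip_sum_right ip_scale_right by (simp only: mult.commute)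
    also have "\<dots> = ip n (u l) (\<lambda>m. P m j)"
      by (rule ip_cong) (simp_all add: P ij mult.commute)
    also have "\<dots> = app n (flip_mat P) (u l) j"
      unfolding ip_def app_def flip_mat_def by (simp only: mult.commute)
    finally show "(\<Sum>a\<in>K. ip n (u l) (app n P (f a)) * f a j) = app n (flip_mat P) (u l) j" .
  qed
  finally have "dec P i j = P i j" using P[OF ij] by simp
  thus ?thesis unfolding lin 1 by simp
qed

text \<open>\<open>P1\<close> and \<open>P2\<close> say P F = P and F P = P. The second puts images
  under \<open>P\<close> into the span of \<open>f\<close>, which bounds \<open>card J\<close>; the
  first serves the Frobenius estimate. The 24 is 2 * 3 * 4: at most \<open>2 * card K\<close>
  directions from \<open>J\<close> and \<open>card K\<close> from \<open>f\<close>, and the square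
  of the norm bound \<open>2 * lam\<close>.\<close>

theorem hard_threshold_deterministic:
  assumes orth: "orthonormal_on n {..<r::nat} u" "orthonormal_on n {..<r} v"
    and s: "\<And>j. j < r \<Longrightarrow> 0 < s j"
    and A: "\<And>i j. i < n \<Longrightarrow> j < n \<Longrightarrow> A i j = rank_one_sum {..<r} s u v i j"
    and W: "opbd n (\<lambda>i j. A i j - P i j) w" and w: "2 * w \<le> lam" and lam: "0 < lam"
    and K: "finite K" "orthonormal_on n K f"
    and P1: "\<And>i j. i < n \<Longrightarrow> j < n \<Longrightarrow> P i j = (\<Sum>a\<in>K. app n P (f a) i * f a j)"
    and P2: "\<And>i j. i < n \<Longrightarrow> j < n \<Longrightarrow> P i j = (\<Sum>a\<in>K. f a i * app n (flip_mat P) (f a) j)"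
  defines "J \<equiv> {j. j < r \<and> lam \<le> s j}"
  shows "opbd n (\<lambda>i j. rank_one_sum J s u v i j - A i j) lam"
    and "(\<Sum>i<n. \<Sum>j<n. (rank_one_sum J s u v i j - P i j)\<^sup>2) \<le> 24 * real (card K) * lam\<^sup>2"
proof -
  have J: "finite J" "J \<subseteq> {..<r}" unfolding J_def by auto
  have uJ: "orthonormal_on n J u" and vJ: "orthonormal_on n J v"
    using orth J(2) by (auto intro: orthonormal_on_subset)
  let ?T = "rank_one_sum J s u v" and ?R = "rank_one_sum ({..<r} - J) s u v"
  have split: "rank_one_sum {..<r} s u v i j = ?T i j + ?R i j" for i j
    unfolding rank_one_sum_def using sum.subset_diff[OF J(2), of "\<lambda>l. s l * u l i * v l j"] by simp
  have "opbd n ?R lam"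
  proof (rule opbd_rank_one_sum)
    fix j assume "j \<in> {..<r} - J"
    thus "0 \<le> s j" "s j \<le> lam" using s[of j] by (auto simp: J_def)
  qed (use lam in \<open>auto intro: orthonormal_on_subset[OF orth(1)] orthonormal_on_subset[OF orth(2)]\<close>)
  hence "opbd n (\<lambda>i j. - ?R i j) lam" by (rule opbd_uminus)
  also have "opbd n (\<lambda>i j. - ?R i j) lam = opbd n (\<lambda>i j. ?T i j - A i j) lam"
    by (rule opbd_cong) (simp add: A split)
  finally show TA: "opbd n (\<lambda>i j. ?T i j - A i j) lam" .
  have w0: "0 \<le> w" using W by (simp add: opbd_def)
  have "opbd n (\<lambda>i j. (?T i j - A i j) + (A i j - P i j)) (lam + w)" by (rule opbd_add[OF TA W])
  hence TP: "opbd n (\<lambda>i j. ?T i j - P i j) (2 * lam)"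
    using opbd_mono[of n _ "lam + w" "2 * lam"] w w0 by simp
  have "3/4 * real (card J) = (\<Sum>j\<in>J. 3/4)" by simp
  also have "\<dots> \<le> (\<Sum>j\<in>J. \<Sum>a\<in>K. (ip n (f a) (u j))\<^sup>2)"
  proof (rule sum_mono)
    fix j assume j: "j \<in> J"
    hence jr: "j < r" and sj: "0 < s j" "lam \<le> s j" using s J by (auto simp: J_def)
    have u1: "nrm n (u j) = 1" and v1: "nrm n (v j) = 1"
      using orthonormal_on_nrm[OF uJ j] orthonormal_on_nrm[OF vJ j] by auto
    have Av: "app n A (v j) i = s j * u j i" if "i < n" for i
    proof -
      have "app n A (v j) i = app n (rank_one_sum {..<r} s u v) (v j) i"
        unfolding app_def by (intro sum.cong refl) (simp add: A that)
      also have "\<dots> = (\<Sum>m<r. (s m * u m i) * ip n (v m) (v j))"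
        unfolding app_rank_one_sum by (intro sum.cong refl) (simp only: mult_ac)
      also have "\<dots> = s j * u j i" by (rule orthonormal_delta_sum(1)) (use orth jr in auto)
      finally show ?thesis .
    qed
    \<comment> \<open>The point in the span of \<open>f\<close> close to \<open>u j\<close>: since
      \<open>A\<close> maps \<open>v j\<close> to \<open>s j * u j\<close>, replacing
      \<open>A\<close> by \<open>P\<close> moves the scaled image by at most \<open>w / s j\<close>,
      hence by at most 1/2.\<close>
    define y where "y = (\<lambda>i. inverse (s j) * app n P (v j) i)"
    have yf: "y i = (\<Sum>a\<in>K. ip n (f a) y * f a i)" if "i < n" for i
    proof -
      have "app n P (v j) i = (\<Sum>m<n. \<Sum>a\<in>K. f a i * app n (flip_mat P) (f a) m * v j m)"
        unfolding app_def[of n P] by (intro sum.cong refl) (simp add: P2 that sum_distrib_right)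
      also have "\<dots> = (\<Sum>a\<in>K. f a i * ip n (app n (flip_mat P) (f a)) (v j))"
        by (subst sum.swap) (simp only: ip_def sum_distrib_left mult.assoc)
      also have "\<dots> = (\<Sum>a\<in>K. ip n (f a) (app n P (v j)) * f a i)"
        unfolding bil_ip_left[symmetric] bil_ip by (simp only: mult.commute)
      finally show ?thesis unfolding y_def ip_scale_right by (simp add: sum_distrib_left mult.assoc)
    qed
    have "nrm n (\<lambda>i. u j i - y i) = nrm n (\<lambda>i. inverse (s j) * app n (\<lambda>i j. A i j - P i j) (v j) i)"
      by (rule nrm_cong) (use sj in \<open>simp add: y_def app_diff Av field_simps\<close>)
    also have "\<dots> \<le> inverse (s j) * w"
      unfolding nrm_scale using opbd_app[OF W, of "v j"] sj by (simp add: v1)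
    also have "\<dots> \<le> 1/2" using w sj by (simp add: field_simps)
    finally have "(nrm n (\<lambda>i. u j i - y i))\<^sup>2 \<le> (1/2)\<^sup>2" by (intro power_mono) auto
    hence 1: "1 - 2 * ip n (u j) y + (nrm n y)\<^sup>2 \<le> 1/4"
      unfolding nrm_diff_sq u1 by (simp add: power2_eq_square)
    define S where "S = (\<Sum>a\<in>K. (ip n (f a) (u j))\<^sup>2)"
    have y2: "(nrm n y)\<^sup>2 = (\<Sum>a\<in>K. (ip n (f a) y)\<^sup>2)"
    proof -
      have "nrm n y = nrm n (\<lambda>i. \<Sum>a\<in>K. ip n (f a) y * f a i)" by (rule nrm_cong) (rule yf)
      thus ?thesis by (simp only: nrm_orthonormal_comb[OF K])
    qed
    have "ip n (u j) y = ip n (u j) (\<lambda>i. \<Sum>a\<in>K. ip n (f a) y * f a i)"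
      by (rule ip_cong) (simp_all add: yf[symmetric])
    also have "\<dots> = (\<Sum>a\<in>K. ip n (f a) y * ip n (f a) (u j))"
      unfolding ip_sum_right ip_scale_right by (simp only: ip_commute)
    finally have "2 * ip n (u j) y = (\<Sum>a\<in>K. 2 * ip n (f a) y * ip n (f a) (u j))"
      by (simp add: sum_distrib_left mult.assoc)
    \<comment> \<open>The squared norm of \<open>y\<close> produced here cancels the one in the
      preceding bound, which leaves \<open>S\<close> at least 1 - 1/4.\<close>
    also have "\<dots> \<le> (\<Sum>a\<in>K. (ip n (f a) y)\<^sup>2 + (ip n (f a) (u j))\<^sup>2)"
      by (intro sum_mono sum_squares_bound)
    also have "\<dots> = (nrm n y)\<^sup>2 + S" unfolding y2 S_def by (rule sum.distrib)
    finally show "3/4 \<le> (\<Sum>a\<in>K. (ip n (f a) (u j))\<^sup>2)" using 1 unfolding S_def by linarith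
  qed
  also have "\<dots> = (\<Sum>a\<in>K. \<Sum>j\<in>J. (ip n (u j) (f a))\<^sup>2)"
    by (subst sum.swap) (simp only: ip_commute)
  also have "\<dots> \<le> (\<Sum>a\<in>K. (nrm n (f a))\<^sup>2)" by (intro sum_mono bessel J uJ)
  also have "\<dots> = (\<Sum>a\<in>K. 1)" by (intro sum.cong refl) (simp only: orthonormal_on_nrm[OF K(2)] power_one)
  finally have card: "3/4 * real (card J) \<le> real (card K)" by simp
  have "(\<Sum>i<n. \<Sum>j<n. (?T i j - P i j)\<^sup>2) \<le> 2 * (real (card J) + real (card K)) * (2 * lam)\<^sup>2"
    by (rule frobenius_le_of_projections[OF J(1) uJ K TP])
      (rule low_rank_projection_decomposition[OF J(1) uJ P1])
  also have "\<dots> \<le> 2 * (3 * real (card K)) * (2 * lam)\<^sup>2"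
    by (intro mult_right_mono mult_left_mono) (use card in auto)
  finally show "(\<Sum>i<n. \<Sum>j<n. (?T i j - P i j)\<^sup>2) \<le> 24 * real (card K) * lam\<^sup>2"
    by (simp add: power_mult_distrib)
qed

section \<open>Rank and norms of matrices\<close>

lemma mult_mat_vec_index:
  fixes A :: "real mat"
  assumes "A \<in> carrier_mat m n" "x \<in> carrier_vec n" "i < m"
  shows "(A *\<^sub>v x) $ i = (\<Sum>j<n. A $$ (i, j) * x $ j)"
  using assms by (simp add: scalar_prod_def atLeast0LessThan)

lemma (in vec_space) mult_mat_vec_in_span:
  assumes A: "A \<in> carrier_mat n nc" and w: "w \<in> carrier_vec nc"
  shows "A *\<^sub>v w \<in> span (set (cols A))"
proof -
  let ?l = "map (\<lambda>j. w $ j \<cdot>\<^sub>v col A j) [0..<nc]"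
  have car: "set (cols A) \<subseteq> carrier_vec n" using cols_dim A by blast
  have "sumlist ?l \<in> span (set (cols A))"
  proof (rule sumlist_in_span[OF car])
    fix x assume "x \<in> set ?l"
    then obtain j where j: "j < nc" "x = w $ j \<cdot>\<^sub>v col A j" by auto
    hence c: "col A j \<in> set (cols A)" using A by (auto simp: cols_def)
    hence "col A j \<in> span (set (cols A))" using span_mem[OF car] by blast
    thus "x \<in> span (set (cols A))" unfolding j(2) using c car by (intro prod_in_span) auto
  qed
  moreover have "sumlist ?l = A *\<^sub>v w"
  proof (rule eq_vecI)
    fix i assume "i < dim_vec (A *\<^sub>v w)"
    hence i: "i < n" using A by simp
    have "sumlist ?l $ i = (\<Sum>j<nc. A $$ (i, j) * w $ j)"
      using A i by (subst sumlist_nth)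
        (auto simp: atLeast0LessThan interv_sum_list_conv_sum_set_nat o_def mult.commute intro!: sum.cong)
    also have "\<dots> = (A *\<^sub>v w) $ i"
      using A w i by (simp add: scalar_prod_def atLeast0LessThan)
    finally show "sumlist ?l $ i = (A *\<^sub>v w) $ i" .
  next
    show "dim_vec (sumlist ?l) = dim_vec (A *\<^sub>v w)" using A by (subst sumlist_dim) auto
  qed
  ultimately show ?thesis by simp
qed

text \<open>\<open>is_svd\<close> indexes a decomposition by the rank of \<open>A\<close>, so
  existence requires the number of triples to be that rank. Columns of \<open>A\<close> are
  combinations of the \<open>u\<close>, and \<open>u l\<close> is the image of \<open>v l\<close>
  divided by \<open>s l\<close>, so both families span the same space.\<close>

lemma rank_of_singular_system:
  fixes A :: "real mat"
  assumes A: "A \<in> carrier_mat n n"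
    and u: "orthonormal_on n {..<r} u" and v: "orthonormal_on n {..<r} v"
    and s: "\<And>j. j < r \<Longrightarrow> 0 < s j"
    and Aeq: "\<And>i j. i < n \<Longrightarrow> j < n \<Longrightarrow> A $$ (i, j) = rank_one_sum {..<r::nat} s u v i j"
  shows "vec_space.rank n A = r"
proof -
  interpret vec_space "TYPE(real)" n .
  define U where "U = mat n r (\<lambda>(i, j). u j i)"
  have U: "U \<in> carrier_mat n r" by (simp add: U_def)
  have colU: "col U j = vec n (u j)" if "j < r" for j using that by (intro eq_vecI) (simp_all add: U_def)
  have uu: "ip n (u i) (u j) = of_bool (i = j)" if "i < r" "j < r" for i j
    using u that by (auto simp: orthonormal_on_def)
  have dist: "distinct (cols U)"
  proof (rule distinct_conv_nth[THEN iffD2], intro allI impI)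
    fix i j assume ij: "i < length (cols U)" "j < length (cols U)" "i \<noteq> j"
    hence r: "i < r" "j < r" using U by auto
    show "cols U ! i \<noteq> cols U ! j"
    proof
      assume "cols U ! i = cols U ! j"
      hence "vec n (u i) = vec n (u j)" using r U colU by (simp add: cols_nth)
      hence "u i a = u j a" if "a < n" for a using that by (metis index_vec)
      hence "ip n (u i) (u j) = ip n (u i) (u i)" by (intro ip_cong) auto
      thus False using uu[OF r] uu[of i i] r ij(3) by simp
    qed
  qed
  have indpt: "lin_indpt (set (cols U))"
  proof (rule ccontr)
    assume "\<not> lin_indpt (set (cols U))"
    then obtain w where w: "w \<in> carrier_vec r" "w \<noteq> 0\<^sub>v r" "U *\<^sub>v w = 0\<^sub>v n"
      using lin_depE[OF U _ dist] by blast
    have "(\<Sum>j<r. w $ j * u j i) = 0" if "i < n" for i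
    proof -
      have "(\<Sum>j<r. w $ j * u j i) = (U *\<^sub>v w) $ i"
        unfolding mult_mat_vec_index[OF U w(1) that] using that
        by (intro sum.cong refl) (simp add: U_def)
      thus ?thesis using w(3) that by simp
    qed
    hence "nrm n (\<lambda>i. \<Sum>j<r. w $ j * u j i) = 0" unfolding nrm_0_iff by blast
    hence "(\<Sum>j<r. (w $ j)\<^sup>2) = 0" using nrm_orthonormal_comb[OF finite_lessThan u, of "\<lambda>j. w $ j"] by simp
    hence "w $ j = 0" if "j < r" for j using that by (simp add: sum_nonneg_eq_0_iff)
    thus False using w(1,2) by (auto simp: vec_eq_iff)
  qed
  have Ucar: "set (cols U) \<subseteq> carrier_vec n" and Acar: "set (cols A) \<subseteq> carrier_vec n"
    using cols_dim U A by blast+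
  have "span (set (cols A)) = span (set (cols U))"
  proof (rule equalityI)
    have "set (cols A) \<subseteq> span (set (cols U))"
    proof
      fix c assume "c \<in> set (cols A)"
      then obtain b where b: "b < n" "c = col A b" using A by (auto simp: cols_def)
      define w where "w = vec r (\<lambda>j. s j * v j b)"
      have w: "w \<in> carrier_vec r" by (simp add: w_def)
      have "U *\<^sub>v w = c"
      proof (rule eq_vecI)
        fix i assume "i < dim_vec c"
        hence i: "i < n" using b A by simp
        have "(U *\<^sub>v w) $ i = rank_one_sum {..<r} s u v i b"
          unfolding mult_mat_vec_index[OF U w i] rank_one_sum_def
          using i by (intro sum.cong refl) (simp add: U_def w_def)
        thus "(U *\<^sub>v w) $ i = c $ i" using Aeq[OF i b(1)] b i A by simp
      qed (use b A U in simp)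
      thus "c \<in> span (set (cols U))" using mult_mat_vec_in_span[OF U w] by simp
    qed
    thus "span (set (cols A)) \<subseteq> span (set (cols U))" by (intro span_subsetI Ucar)
    have "set (cols U) \<subseteq> span (set (cols A))"
    proof
      fix c assume "c \<in> set (cols U)"
      then obtain l where l: "l < r" "c = vec n (u l)"
        using U colU by (auto simp: cols_def)
      define w where "w = vec n (\<lambda>b. inverse (s l) * v l b)"
      have w: "w \<in> carrier_vec n" by (simp add: w_def)
      have "A *\<^sub>v w = c"
      proof (rule eq_vecI)
        fix i assume "i < dim_vec c"
        hence i: "i < n" using l by simp
        have "(A *\<^sub>v w) $ i = inverse (s l) * app n (rank_one_sum {..<r} s u v) (v l) i"
          unfolding mult_mat_vec_index[OF A w i] app_def sum_distrib_left
          using i by (intro sum.cong refl) (simp add: Aeq w_def)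
        also have "app n (rank_one_sum {..<r} s u v) (v l) i = (\<Sum>m<r. (s m * u m i) * ip n (v m) (v l))"
          unfolding app_rank_one_sum by (intro sum.cong refl) (simp only: mult_ac)
        also have "\<dots> = s l * u l i" by (rule orthonormal_delta_sum(1)) (use v l in auto)
        finally show "(A *\<^sub>v w) $ i = c $ i" using s[OF l(1)] l i by simp
      qed (use l A in simp)
      thus "c \<in> span (set (cols A))" using mult_mat_vec_in_span[OF A w] by simp
    qed
    thus "span (set (cols U)) \<subseteq> span (set (cols A))" by (intro span_subsetI Acar)
  qed
  hence "rank A = rank U" by (simp only: rank_def)
  also have "\<dots> = r" by (rule lin_indpt_full_rank[OF U dist indpt])
  finally show ?thesis .
qed

lemma scalar_prod_ip:
  assumes "x \<in> carrier_vec n" "y \<in> carrier_vec n"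
  shows "x \<bullet> y = ip n (\<lambda>i. x $ i) (\<lambda>i. y $ i)"
  using assms by (simp add: scalar_prod_def ip_def atLeast0LessThan)

lemma is_svd_exists:
  assumes A: "A \<in> carrier_mat n n"
  shows "\<exists>s u v. is_svd A s u v"
proof -
  obtain r :: nat and s u v where r: "r \<le> n" "orthonormal_on n {..<r} u" "orthonormal_on n {..<r} v"
    and s: "\<And>j. j < r \<Longrightarrow> 0 < s j" "\<And>i j. i < r \<Longrightarrow> j < r \<Longrightarrow> i \<le> j \<Longrightarrow> s j \<le> s i"
    and Aeq: "\<And>i j. i < n \<Longrightarrow> j < n \<Longrightarrow> A $$ (i, j) = rank_one_sum {..<r::nat} s u v i j"
    using svd_exists[of n "\<lambda>i j. A $$ (i, j)"] by metis
  have rk: "vec_space.rank n A = r" by (rule rank_of_singular_system[OF A r(2,3) s(1) Aeq])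
  have sp: "vec n x \<bullet> vec n y = ip n x y" for x y
    by (simp add: scalar_prod_ip) (rule ip_cong, simp_all)
  have "A = sum_rank_one n n {..<r} s (\<lambda>j. vec n (u j)) (\<lambda>j. vec n (v j))"
    using A by (intro eq_matI) (simp_all add: sum_rank_one_def Aeq rank_one_sum_def)
  hence "is_svd A s (\<lambda>j. vec n (u j)) (\<lambda>j. vec n (v j))"
    unfolding is_svd_def Let_def carrier_matD[OF A] rk sp using r(2,3) s
    by (intro conjI allI impI) (simp_all add: orthonormal_on_def)
  thus ?thesis by blast
qed

text \<open>Unpacks the choice made in \<open>hard_threshold\<close>. Since
  \<open>hard_threshold_deterministic\<close> accepts every decomposition, the chosen one can be
  passed to it as it is.\<close>

lemma hard_thresholdE:
  assumes A: "A \<in> carrier_mat n n"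
  obtains r :: nat and s u v where "orthonormal_on n {..<r} u" "orthonormal_on n {..<r} v"
    "\<forall>j<r. 0 < s j"
    "\<forall>i<n. \<forall>j<n. A $$ (i, j) = rank_one_sum {..<r} s u v i j"
    "hard_threshold l A \<in> carrier_mat n n"
    "\<forall>i<n. \<forall>j<n. hard_threshold l A $$ (i, j) = rank_one_sum {j. j < r \<and> l \<le> s j} s u v i j"
proof -
  define t where "t = (SOME (s, u, v). is_svd A s u v)"
  obtain s u v where t: "t = (s, u, v)" by (cases t)
  have "case t of (s, u, v) \<Rightarrow> is_svd A s u v"
    unfolding t_def by (rule someI_ex) (use is_svd_exists[OF A] in auto)
  hence svd: "is_svd A s u v" by (simp add: t)
  define r where "r = vec_space.rank n A"
  have d: "dim_row A = n" "dim_col A = n" using A by auto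
  note sv = svd[unfolded is_svd_def Let_def d r_def[symmetric]]
  have car: "u j \<in> carrier_vec n" "v j \<in> carrier_vec n" if "j < r" for j using sv that by auto
  let ?u = "\<lambda>j i. u j $ i" and ?v = "\<lambda>j i. v j $ i"
  have ht: "hard_threshold l A = sum_rank_one n n {j. j < r \<and> l \<le> s j} s u v"
    unfolding hard_threshold_def t_def[symmetric] t by (simp add: d r_def)
  show thesis
  proof (rule that[of r ?u ?v s])
    show "orthonormal_on n {..<r} ?u" "orthonormal_on n {..<r} ?v"
      using sv car by (auto simp: orthonormal_on_def simp flip: scalar_prod_ip)
    show "\<forall>j<r. 0 < s j" using sv by blast
    show "hard_threshold l A \<in> carrier_mat n n" by (simp add: ht sum_rank_one_def)
    have "A = sum_rank_one n n {..<r} s u v" using sv by blast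
    hence "A $$ (i, j) = sum_rank_one n n {..<r} s u v $$ (i, j)" for i j by (rule arg_cong)
    thus "\<forall>i<n. \<forall>j<n. A $$ (i, j) = rank_one_sum {..<r} s ?u ?v i j"
      by (simp add: sum_rank_one_def rank_one_sum_def)
    show "\<forall>i<n. \<forall>j<n. hard_threshold l A $$ (i, j) = rank_one_sum {j. j < r \<and> l \<le> s j} s ?u ?v i j"
      unfolding ht by (simp add: sum_rank_one_def rank_one_sum_def)
  qed
qed

section \<open>Operator norm and cut norm of matrices\<close>

lemma l2_norm_eq: "x \<in> carrier_vec n \<Longrightarrow> l2_norm x = nrm n (\<lambda>i. x $ i)"
  unfolding l2_norm_def by (simp add: scalar_prod_ip ip_self)

lemma l2_norm_mult_le:
  assumes B: "B \<in> carrier_mat n n" and b: "opbd n (\<lambda>i j. B $$ (i, j)) M"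
    and x: "x \<in> carrier_vec n" "l2_norm x \<le> 1"
  shows "l2_norm (B *\<^sub>v x) \<le> M"
proof -
  have "l2_norm (B *\<^sub>v x) = nrm n (\<lambda>i. (B *\<^sub>v x) $ i)" using B x by (intro l2_norm_eq) simp
  also have "\<dots> = nrm n (app n (\<lambda>i j. B $$ (i, j)) (\<lambda>i. x $ i))"
    by (rule nrm_cong) (simp only: mult_mat_vec_index[OF B x(1)] app_def)
  also have "\<dots> \<le> M * nrm n (\<lambda>i. x $ i)" by (rule opbd_app[OF b])
  also have "\<dots> \<le> M * 1" using x b by (intro mult_left_mono) (simp_all add: l2_norm_eq opbd_def)
  finally show ?thesis by simp
qed

lemma op_norm_le:
  assumes "B \<in> carrier_mat n n" "opbd n (\<lambda>i j. B $$ (i, j)) M"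
  shows "op_norm B \<le> M"
  unfolding op_norm_def
proof (rule cSUP_least)
  have "0\<^sub>v n \<in> {x \<in> carrier_vec (dim_col B). l2_norm x \<le> 1}" using assms(1) by (simp add: l2_norm_def)
  thus "{x \<in> carrier_vec (dim_col B). l2_norm x \<le> 1} \<noteq> {}" by blast
qed (use l2_norm_mult_le[OF assms] assms(1) in auto)

text \<open>The sum over \<open>S\<close> and \<open>T\<close> is the form at two indicator vectors
  of norm at most sqrt n. The bound \<open>M\<close> makes the set under the supremum in
  \<open>op_norm\<close> bounded, so that single values lie below it.\<close>

lemma cut_norm_le_op_norm:
  assumes B: "B \<in> carrier_mat n n" and b: "opbd n (\<lambda>i j. B $$ (i, j)) M" and n: "0 < n"
  shows "cut_norm B \<le> 1 / real n * op_norm B"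
proof -
  have d: "dim_row B = n" "dim_col B = n" using B by auto
  have le: "l2_norm (B *\<^sub>v x) \<le> op_norm B" if "x \<in> carrier_vec n" "l2_norm x \<le> 1" for x
    unfolding op_norm_def d
    by (rule cSUP_upper) (use that l2_norm_mult_le[OF B b] in \<open>auto intro!: bdd_aboveI2\<close>)
  have "\<bar>\<Sum>i\<in>S. \<Sum>j\<in>T. B $$ (i, j)\<bar> \<le> real n * op_norm B" if S: "S \<subseteq> {..<n}" and T: "T \<subseteq> {..<n}" for S T
  proof -
    \<comment> \<open>The factor \<open>1 / sqrt n\<close> brings the indicator of \<open>T\<close>
      into the unit ball over which \<open>op_norm\<close> is taken.\<close>
    define x where "x = vec n (\<lambda>j. of_bool (j \<in> T) / sqrt n)"
    define y where "y i = (of_bool (i \<in> S) :: real)" for i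
    have x: "x \<in> carrier_vec n" by (simp add: x_def)
    have ind: "nrm n (\<lambda>i. of_bool (i \<in> V)) \<le> sqrt n" for V
    proof -
      have "(\<Sum>i<n. (of_bool (i \<in> V))\<^sup>2 :: real) \<le> (\<Sum>i<n. 1)" by (intro sum_mono) simp
      thus ?thesis unfolding L2_set_def by (intro real_sqrt_le_mono) simp
    qed
    have "nrm n (\<lambda>i. x $ i) = nrm n (\<lambda>i. inverse (sqrt n) * of_bool (i \<in> T))"
      by (rule nrm_cong) (simp add: x_def field_simps)
    also have "\<dots> = inverse (sqrt n) * nrm n (\<lambda>i. of_bool (i \<in> T))" unfolding nrm_scale by simp
    also have "\<dots> \<le> inverse (sqrt n) * sqrt n" using ind by (intro mult_left_mono) auto
    also have "\<dots> = 1" using n by simp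
    finally have x1: "l2_norm x \<le> 1" by (simp only: l2_norm_eq[OF x])
    have Bx: "B *\<^sub>v x \<in> carrier_vec n" using B x by simp
    have "(\<Sum>i\<in>S. \<Sum>j\<in>T. B $$ (i, j)) = (\<Sum>i<n. \<Sum>j<n. of_bool (i \<in> S) * B $$ (i, j) * of_bool (j \<in> T))"
    proof -
      have "(\<Sum>j<n. of_bool (i \<in> S) * B $$ (i, j) * of_bool (j \<in> T)) = of_bool (i \<in> S) * (\<Sum>j\<in>T. B $$ (i, j))" for i
        unfolding sum_distrib_left using T by (intro sum.mono_neutral_cong_right) auto
      moreover have "(\<Sum>i<n. of_bool (i \<in> S) * (\<Sum>j\<in>T. B $$ (i, j))) = (\<Sum>i\<in>S. \<Sum>j\<in>T. B $$ (i, j))"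
        using S by (intro sum.mono_neutral_cong_right) auto
      ultimately show ?thesis by (simp only:)
    qed
    also have "\<dots> = sqrt n * (\<Sum>i<n. y i * (B *\<^sub>v x) $ i)"
    proof -
      have "(\<Sum>j<n. of_bool (i \<in> S) * B $$ (i, j) * of_bool (j \<in> T)) = sqrt n * (y i * (B *\<^sub>v x) $ i)"
        if "i < n" for i
        unfolding mult_mat_vec_index[OF B x that] sum_distrib_left
        using n by (intro sum.cong refl) (simp add: x_def y_def)
      thus ?thesis unfolding sum_distrib_left by (intro sum.cong refl) simp
    qed
    finally have eq: "\<bar>\<Sum>i\<in>S. \<Sum>j\<in>T. B $$ (i, j)\<bar> = sqrt n * \<bar>\<Sum>i<n. y i * (B *\<^sub>v x) $ i\<bar>"
      by (simp add: abs_mult)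
    have "\<bar>\<Sum>i<n. y i * (B *\<^sub>v x) $ i\<bar> \<le> (\<Sum>i<n. \<bar>y i\<bar> * \<bar>(B *\<^sub>v x) $ i\<bar>)"
      unfolding abs_mult[symmetric] by (rule sum_abs)
    also have "\<dots> \<le> nrm n y * nrm n (\<lambda>i. (B *\<^sub>v x) $ i)" by (rule L2_set_mult_ineq)
    also have "\<dots> \<le> sqrt n * op_norm B"
      using ind[of S] le[OF x x1] unfolding y_def l2_norm_eq[OF Bx] by (intro mult_mono) auto
    finally have "sqrt n * \<bar>\<Sum>i<n. y i * (B *\<^sub>v x) $ i\<bar> \<le> sqrt n * (sqrt n * op_norm B)"
      by (intro mult_left_mono) auto
    thus ?thesis unfolding eq by (simp add: mult.assoc[symmetric])
  qed
  hence "Max ((\<lambda>(S, T). \<bar>\<Sum>i\<in>S. \<Sum>j\<in>T. B $$ (i, j)\<bar>) ` (Pow {..<n} \<times> Pow {..<n})) \<le> real n * op_norm B"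
    by (intro Max.boundedI) auto
  hence "cut_norm B \<le> 1 / (real n)\<^sup>2 * (real n * op_norm B)"
    unfolding cut_norm_def d by (intro mult_left_mono) auto
  also have "\<dots> = 1 / real n * op_norm B" using n by (simp add: power2_eq_square)
  finally show ?thesis .
qed

section \<open>Closed walks\<close>

definition steps :: "'a list \<Rightarrow> ('a \<times> 'a) list" where
  "steps xs = zip xs (tl xs)"

text \<open>Unordered pairs, so that traversals in either direction count for the same random entry;
  a list, so that multiplicities survive.\<close>

definition uedges :: "'a list \<Rightarrow> 'a set list" where
  "uedges xs = map (\<lambda>(a, b). {a, b}) (steps xs)"

lemma steps_simps [simp]:
  "steps [] = []" "steps [x] = []" "steps (x # y # ys) = (x, y) # steps (y # ys)"
  by (simp_all add: steps_def)

lemma uedges_simps [simp]: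
  "uedges [] = []" "uedges [x] = []" "uedges (x # y # ys) = {x, y} # uedges (y # ys)"
  by (simp_all add: uedges_def)

text \<open>The closed walks whose weight can have nonzero expectation when the entries of the matrix are
  independent and centered.\<close>
definition doubled_walk :: "'a list \<Rightarrow> bool" where
  "doubled_walk xs \<longleftrightarrow> xs \<noteq> [] \<and> hd xs = last xs \<and> (\<forall>(a, b) \<in> set (steps xs). a \<noteq> b) \<and>
    (\<forall>e \<in> set (uedges xs). 2 \<le> count_list (uedges xs) e)"

text \<open>\<open>L\<close> steps visit \<open>Suc L\<close> positions; a closed walk lists its
  starting point twice.\<close>

definition walks :: "nat \<Rightarrow> nat \<Rightarrow> nat list set" where
  "walks n L = {xs. set xs \<subseteq> {..<n} \<and> length xs = Suc L}"

lemma finite_walks: "finite (walks n L)"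
  unfolding walks_def by (rule finite_lists_length_eq) simp

lemma length_uedges: "length (uedges xs) = length xs - 1"
  by (simp add: uedges_def steps_def)

lemma steps_map: "steps (map f xs) = map (\<lambda>(a, b). (f a, f b)) (steps xs)"
  by (induction xs rule: induct_list012) simp_all

lemma uedges_map: "uedges (map f xs) = map ((`) f) (uedges xs)"
  by (induction xs rule: induct_list012) simp_all

lemma uedges_subset: "e \<in> set (uedges xs) \<Longrightarrow> e \<subseteq> set xs"
  by (induction xs rule: induct_list012) auto

lemma steps_subset: "(a, b) \<in> set (steps xs) \<Longrightarrow> a \<in> set xs \<and> b \<in> set xs"
  by (induction xs rule: induct_list012) auto

lemma count_list_map_inj_on:
  "inj_on g (insert e (set l)) \<Longrightarrow> count_list (map g l) (g e) = count_list l e"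
  by (induction l) (auto simp: inj_on_def)

lemma doubled_walk_map:
  assumes "inj_on f (set xs)" "doubled_walk xs"
  shows "doubled_walk (map f xs)"
proof -
  have inj: "inj_on ((`) f) (set (uedges xs))"
  proof (rule inj_onI)
    fix d e assume "d \<in> set (uedges xs)" "e \<in> set (uedges xs)" "f ` d = f ` e"
    thus "d = e" using inj_on_image_eq_iff[OF assms(1), of d e] uedges_subset by blast
  qed
  have "f a \<noteq> f b" if "(a, b) \<in> set (steps xs)" for a b
    using that assms steps_subset[OF that] unfolding doubled_walk_def inj_on_def by blast
  moreover have "2 \<le> count_list (map ((`) f) (uedges xs)) (f ` e)" if "e \<in> set (uedges xs)" for e
    using that assms inj by (subst count_list_map_inj_on) (auto simp: doubled_walk_def insert_absorb)
  ultimately show ?thesis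
    using assms(2) unfolding doubled_walk_def steps_map uedges_map by (auto simp: hd_map last_map)
qed

text \<open>Read from its end, the walk reaches each new vertex through an edge not seen
  before.\<close>

lemma card_vertices_le: "xs \<noteq> [] \<Longrightarrow> card (set xs) \<le> card (set (uedges xs)) + 1"
proof (induction xs rule: induct_list012)
  case (3 x y zs)
  have IH: "card (set (y # zs)) \<le> card (set (uedges (y # zs))) + 1" using 3 by simp
  show ?case
  proof (cases "x \<in> set (y # zs)")
    case True
    have "card (set (uedges (y # zs))) \<le> card (set (uedges (x # y # zs)))" by (intro card_mono) auto
    hence "card (set (y # zs)) \<le> card (set (uedges (x # y # zs))) + 1"
      by (rule order_trans[OF IH add_right_mono])
    moreover have "set (x # y # zs) = set (y # zs)" using True by auto
    ultimately show ?thesis by (simp only:)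
  next
    case False
    hence "{x, y} \<notin> set (uedges (y # zs))" using uedges_subset by fastforce
    hence "card (set (uedges (x # y # zs))) = Suc (card (set (uedges (y # zs))))" by simp
    moreover have "card (set (x # y # zs)) = Suc (card (set (y # zs)))" using False by simp
    ultimately show ?thesis using IH by (simp only: Suc_eq_plus1 add_le_cancel_right)
  qed
qed simp_all

lemma doubled_walk_card_edges:
  assumes "doubled_walk xs" "length xs = Suc (2 * p)"
  shows "card (set (uedges xs)) \<le> p"
proof -
  have "2 * card (set (uedges xs)) = (\<Sum>e\<in>set (uedges xs). 2)" by simp
  also have "\<dots> \<le> (\<Sum>e\<in>set (uedges xs). count_list (uedges xs) e)"
    using assms(1) by (intro sum_mono) (auto simp: doubled_walk_def)
  also have "\<dots> = 2 * p" using assms(2) by (simp add: sum_count_set length_uedges)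
  finally show ?thesis by simp
qed

text \<open>The shape of a walk in the trace method: two walks agree in which of their positions
  coincide.\<close>

definition renaming :: "'a list \<Rightarrow> 'b list \<Rightarrow> bool" where
  "renaming xs ys \<longleftrightarrow> (\<exists>f. inj_on f (set xs) \<and> ys = map f xs)"

lemma renaming_symD: assumes "renaming xs ys" shows "renaming ys xs"
proof -
  obtain f where f: "inj_on f (set xs)" "ys = map f xs" using assms by (auto simp: renaming_def)
  have "xs = map (inv_into (set xs) f) ys"
    unfolding f(2) map_map by (rule map_idI[symmetric]) (simp add: f(1) inv_into_f_f)
  moreover have "inj_on (inv_into (set xs) f) (set ys)" using f(2) by (simp add: inj_on_inv_into)
  ultimately show ?thesis unfolding renaming_def by blast
qed

lemma renaming_card: "renaming xs ys \<Longrightarrow> card (set xs) = card (set ys)"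
  by (auto simp: renaming_def card_image)

lemma renaming_length: "renaming xs ys \<Longrightarrow> length xs = length ys"
  by (auto simp: renaming_def)

lemma renaming_doubled_walk:
  fixes xs ys :: "'a list"
  shows "renaming xs ys \<Longrightarrow> doubled_walk xs \<longleftrightarrow> doubled_walk ys"
proof -
  have *: "doubled_walk vs" if "renaming us vs" "doubled_walk us" for us vs :: "'a list"
    using that unfolding renaming_def by (auto intro: doubled_walk_map)
  assume "renaming xs ys"
  thus ?thesis using *[of xs ys] *[of ys xs] renaming_symD by blast
qed

text \<open>Renamings into \<open>B\<close> correspond to injections of the vertex set into
  \<open>B\<close>, hence the falling factorial.\<close>

lemma card_renamings:
  fixes xs :: "'a list" and B :: "'b set"
  assumes "finite B"
  shows "card {ys. set ys \<subseteq> B \<and> renaming xs ys} = (\<Prod>i<card (set xs). card B - i)"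
proof -
  let ?F = "{f \<in> set xs \<rightarrow>\<^sub>E B. inj_on f (set xs)}"
  have inj: "inj_on (\<lambda>f. map f xs) ?F"
  proof (rule inj_onI)
    fix f g assume fg: "f \<in> ?F" "g \<in> ?F" "map f xs = map g xs"
    hence "f \<in> set xs \<rightarrow>\<^sub>E B" "g \<in> set xs \<rightarrow>\<^sub>E B" by simp_all
    moreover have "f x = g x" if "x \<in> set xs" for x using fg(3) that by (simp only: map_eq_conv)
    ultimately show "f = g" by (rule PiE_ext)
  qed
  have img: "(\<lambda>f. map f xs) ` ?F = {ys. set ys \<subseteq> B \<and> renaming xs ys}"
  proof (intro equalityI subsetI)
    fix ys assume "ys \<in> {ys. set ys \<subseteq> B \<and> renaming xs ys}"
    then obtain f where f: "inj_on f (set xs)" "ys = map f xs" "set ys \<subseteq> B"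
      unfolding renaming_def by blast
    let ?g = "restrict f (set xs)"
    have mem: "?g \<in> ?F" using f unfolding mem_Collect_eq inj_on_restrict_eq by (intro conjI restrict_PiE_iff[THEN iffD2]) auto
    have eq: "ys = map ?g xs" unfolding f(2) by (rule map_cong) simp_all
    show "ys \<in> (\<lambda>f. map f xs) ` ?F" by (rule image_eqI[of ys "\<lambda>f. map f xs" ?g, OF eq mem])
  next
    fix ys assume "ys \<in> (\<lambda>f. map f xs) ` ?F"
    then obtain f where f: "f \<in> set xs \<rightarrow>\<^sub>E B" "inj_on f (set xs)" "ys = map f xs" by blast
    have "set ys \<subseteq> B" unfolding f(3) set_map using PiE_mem[OF f(1)] by blast
    thus "ys \<in> {ys. set ys \<subseteq> B \<and> renaming xs ys}" using f unfolding renaming_def by blast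
  qed
  have "card {ys. set ys \<subseteq> B \<and> renaming xs ys} = card ?F"
    unfolding img[symmetric] by (rule card_image[OF inj])
  also have "\<dots> = (\<Prod>i<card (set xs). card B - i)"
    using card_inj_on_subset_funcset[of "set xs" B "set xs"] assms by (simp add: atLeast0LessThan)
  finally show ?thesis .
qed

text \<open>Double counting of the pairs of walks that are renamings of each other compares walks on \<open>n\<close>
  vertices with walks on only \<open>2 * p\<close> vertices.\<close>
lemma walk_comparison:
  fixes \<rho> :: real
  assumes p: "0 < p" and \<rho>: "0 \<le> \<rho>" "\<rho> \<le> 1" "real n * \<rho> \<le> real p"
  shows "(\<Sum>xs\<in>{xs\<in>walks n (2 * p). doubled_walk xs}. \<rho> ^ card (set (uedges xs)))
    \<le> real n / real p * real (card {ys\<in>walks (2 * p) (2 * p). doubled_walk ys})"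
proof -
  let ?X = "{xs\<in>walks n (2 * p). doubled_walk xs}" and ?Y = "{ys\<in>walks (2 * p) (2 * p). doubled_walk ys}"
  let ?v = "\<lambda>xs :: nat list. card (set xs)"
  let ?ff = "\<lambda>v. \<Prod>i<v. 2 * p - i"
  have fin: "finite ?X" "finite ?Y" using finite_walks by auto
  have v: "0 < ?v xs" "?v xs \<le> p + 1" if "xs \<in> walks m (2 * p)" "doubled_walk xs" for m and xs :: "nat list"
  proof -
    have ne: "xs \<noteq> []" using that by (auto simp: doubled_walk_def)
    thus "0 < ?v xs" by (simp add: card_gt_0_iff)
    show "?v xs \<le> p + 1"
      using card_vertices_le[OF ne] doubled_walk_card_edges[OF that(2), of p] that(1) by (simp add: walks_def)
  qed
  \<comment> \<open>At most \<open>p + 1\<close> factors occur, with \<open>i\<close> at most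
    \<open>p\<close>, so each is at least \<open>p\<close>. This is why \<open>2 * p\<close>
    vertices are enough.\<close>
  have ff: "p ^ v \<le> ?ff v" if "v \<le> p + 1" for v
  proof -
    have "p ^ v = (\<Prod>i<v. p)" by simp
    also have "\<dots> \<le> ?ff v" using that by (intro prod_mono) auto
    finally show ?thesis .
  qed
  have ff0: "0 < ?ff v" if "v \<le> p + 1" for v
  proof -
    have "0 < p ^ v" using p by simp
    thus ?thesis using ff[OF that] by linarith
  qed
  have cY: "card {ys\<in>?Y. renaming xs ys} = ?ff (?v xs)" if "xs \<in> ?X" for xs
  proof -
    have xs: "length xs = Suc (2 * p)" "doubled_walk xs" using that by (simp_all add: walks_def)
    have "ys \<in> ?Y \<and> renaming xs ys \<longleftrightarrow> set ys \<subseteq> {..<2 * p} \<and> renaming xs ys" for ys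
      using renaming_length[of xs ys] renaming_doubled_walk[of xs ys] xs
      unfolding walks_def mem_Collect_eq by metis
    hence "{ys\<in>?Y. renaming xs ys} = {ys. set ys \<subseteq> {..<2 * p} \<and> renaming xs ys}" by blast
    thus ?thesis using card_renamings[of "{..<2 * p}" xs] by (simp only: card_lessThan finite_lessThan simp_thms True_implies_equals)
  qed
  have cX: "card {xs\<in>?X. renaming xs ys} \<le> n ^ ?v ys" for ys
  proof -
    have "card {xs\<in>?X. renaming xs ys} \<le> card {xs. set xs \<subseteq> {..<n} \<and> renaming ys xs}"
    proof (rule card_mono)
      have "finite {xs. set xs \<subseteq> {..<n} \<and> length xs = length ys}" by (rule finite_lists_length_eq) simp
      thus "finite {xs. set xs \<subseteq> {..<n} \<and> renaming ys xs}"
        by (rule finite_subset[rotated]) (use renaming_length in fastforce)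
      show "{xs\<in>?X. renaming xs ys} \<subseteq> {xs. set xs \<subseteq> {..<n} \<and> renaming ys xs}"
        using renaming_symD[of _ ys] unfolding walks_def by blast
    qed
    also have "\<dots> = (\<Prod>i<?v ys. n - i)" by (simp add: card_renamings)
    also have "\<dots> \<le> (\<Prod>i<?v ys. n)" by (intro prod_mono) auto
    finally show ?thesis by simp
  qed
  \<comment> \<open>The weight \<rho>^(v - 1) of a walk is shared equally among its renamings on
    \<open>2 * p\<close> vertices.\<close>
  define w where "w v = \<rho> ^ (v - 1) / real (?ff v)" for v
  have w0: "0 \<le> w v" for v unfolding w_def by (intro divide_nonneg_nonneg zero_le_power of_nat_0_le_iff \<rho>(1))
  have "(\<Sum>xs\<in>?X. \<rho> ^ card (set (uedges xs))) \<le> (\<Sum>xs\<in>?X. \<rho> ^ (?v xs - 1))"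
  proof (intro sum_mono power_decreasing \<rho>)
    fix xs assume "xs \<in> ?X"
    hence "xs \<noteq> []" by (auto simp: doubled_walk_def)
    thus "?v xs - 1 \<le> card (set (uedges xs))" using card_vertices_le by fastforce
  qed
  also have "\<dots> = (\<Sum>xs\<in>?X. \<Sum>ys\<in>{ys\<in>?Y. renaming xs ys}. w (?v ys))"
  proof (intro sum.cong refl)
    fix xs assume xs: "xs \<in> ?X"
    have "(\<Sum>ys\<in>{ys\<in>?Y. renaming xs ys}. w (?v ys)) = (\<Sum>ys\<in>{ys\<in>?Y. renaming xs ys}. w (?v xs))"
    proof (intro sum.cong refl)
      fix ys assume "ys \<in> {ys\<in>?Y. renaming xs ys}"
      hence "renaming xs ys" by blast
      thus "w (?v ys) = w (?v xs)" by (simp only: renaming_card[of xs ys])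
    qed
    also have "\<dots> = real (?ff (?v xs)) * w (?v xs)" unfolding sum_constant cY[OF xs] by simp
    also have "\<dots> = \<rho> ^ (?v xs - 1)"
    proof -
      have "0 < real (?ff (?v xs))" using ff0[OF v(2)[of xs n]] xs unfolding of_nat_0_less_iff by blast
      moreover have "a * (x / a) = x" if "0 < a" for a x :: real using that by simp
      ultimately show ?thesis unfolding w_def by blast
    qed
    finally show "\<rho> ^ (?v xs - 1) = (\<Sum>ys\<in>{ys\<in>?Y. renaming xs ys}. w (?v ys))" ..
  qed
  also have "\<dots> = (\<Sum>ys\<in>?Y. \<Sum>xs\<in>{xs\<in>?X. renaming xs ys}. w (?v ys))"
    by (rule sum.swap_restrict[OF fin])
  \<comment> \<open>A walk \<open>ys\<close> with v vertices collects from at most n^v walks, and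
    n^v \<rho>^(v - 1) / p^v = (n / p) (n \<rho> / p)^(v - 1).\<close>
  also have "\<dots> \<le> (\<Sum>ys\<in>?Y. real n / real p)"
  proof (rule sum_mono)
    fix ys assume ys: "ys \<in> ?Y"
    obtain k where k: "?v ys = Suc k" using v(1)[of ys "2 * p"] ys gr0_implies_Suc by blast
    have "(\<Sum>xs\<in>{xs\<in>?X. renaming xs ys}. w (?v ys)) = real (card {xs\<in>?X. renaming xs ys}) * w (?v ys)"
      unfolding sum_constant ..
    also have "\<dots> \<le> real (n ^ ?v ys) * w (?v ys)"
      by (intro mult_right_mono w0) (simp only: of_nat_le_iff cX)
    also have "\<dots> = real n * (real n * \<rho>) ^ k / real (?ff (?v ys))"
      unfolding w_def k by (simp only: power_mult_distrib power_Suc of_nat_mult of_nat_power diff_Suc_1 mult_ac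
        times_divide_eq_right)
    also have "\<dots> \<le> real n * real p ^ k / real (p ^ ?v ys)"
    proof (intro frac_le mult_left_mono power_mono)
      show "real (p ^ ?v ys) \<le> real (?ff (?v ys))"
        unfolding of_nat_le_iff using ff[OF v(2)[of ys "2 * p"]] ys by blast
    qed (use p \<rho> in simp_all)
    also have "\<dots> = real n / real p" unfolding k using p by (simp add: field_simps)
    finally show "(\<Sum>xs\<in>{xs\<in>?X. renaming xs ys}. w (?v ys)) \<le> real n / real p" .
  qed
  also have "\<dots> = real n / real p * real (card ?Y)" by simp
  finally show ?thesis .
qed

section \<open>Expected walk weights\<close>

definition edge_set :: "nat \<Rightarrow> (nat \<times> nat) set" where
  "edge_set n = {(i, j). i < j \<and> j < n}"

definition sym_of :: "(nat \<times> nat \<Rightarrow> real) \<Rightarrow> nat \<Rightarrow> nat \<Rightarrow> real" where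
  "sym_of g i j = (if i < j then g (i, j) else if j < i then g (j, i) else 0)"

definition walk_weight :: "('a \<Rightarrow> 'a \<Rightarrow> real) \<Rightarrow> 'a list \<Rightarrow> real" where
  "walk_weight M xs = (\<Prod>(a, b)\<leftarrow>steps xs. M a b)"

lemma finite_edge_set: "finite (edge_set n)"
  by (rule finite_subset[of _ "{..<n} \<times> {..<n}"]) (auto simp: edge_set_def)

definition edge_mult :: "nat list \<Rightarrow> nat \<times> nat \<Rightarrow> nat" where
  "edge_mult xs e = count_list (uedges xs) {fst e, snd e}"

text \<open>Grouping the factors by edge turns the weight into a product of powers of independent
  variables.\<close>

lemma walk_weight_sym_of:
  assumes "set xs \<subseteq> {..<n}" "\<forall>(a, b) \<in> set (steps xs). a \<noteq> b"
  shows "walk_weight (sym_of g) xs = (\<Prod>e\<in>edge_set n. g e ^ edge_mult xs e)"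
  using assms
proof (induction xs rule: induct_list012)
  case (3 x y zs)
  let ?e = "(min x y, max x y)"
  have xy: "x \<noteq> y" "x < n" "y < n" using 3 by auto
  have iff: "{x, y} = {fst e, snd e} \<longleftrightarrow> e = ?e" if "e \<in> edge_set n" for e
    using that xy by (cases e) (auto simp: edge_set_def doubleton_eq_iff min_def max_def)
  have "?e \<in> edge_set n" using xy by (auto simp: edge_set_def min_def max_def)
  have "(\<Prod>e\<in>edge_set n. g e ^ edge_mult (x # y # zs) e) =
      (\<Prod>e\<in>edge_set n. (if e = ?e then g e else 1) * g e ^ edge_mult (y # zs) e)"
    by (intro prod.cong refl) (simp add: edge_mult_def iff)
  also have "\<dots> = (\<Prod>e\<in>edge_set n. if e = ?e then g e else 1) * (\<Prod>e\<in>edge_set n. g e ^ edge_mult (y # zs) e)"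
    by (rule prod.distrib)
  also have "(\<Prod>e\<in>edge_set n. if e = ?e then g e else 1) = g ?e"
    using \<open>?e \<in> edge_set n\<close> finite_edge_set by (simp add: prod.delta)
  also have "g ?e = sym_of g x y" using xy by (auto simp: sym_of_def min_def max_def)
  also have "(\<Prod>e\<in>edge_set n. g e ^ edge_mult (y # zs) e) = walk_weight (sym_of g) (y # zs)"
    using 3 by simp
  finally show ?case by (simp add: walk_weight_def)
qed (simp_all add: walk_weight_def edge_mult_def)

lemma walk_weight_loop:
  assumes "\<not> (\<forall>(a, b) \<in> set (steps xs). a \<noteq> b)"
  shows "walk_weight (sym_of g) xs = 0"
proof -
  obtain a where "(a, a) \<in> set (steps xs)" using assms by auto
  hence "0 \<in> set (map (\<lambda>(a, b). sym_of g a b) (steps xs))" by (force simp: sym_of_def image_iff)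
  thus ?thesis unfolding walk_weight_def by (simp add: prod_list_zero_iff)
qed

lemma set_uedges_eq:
  assumes "set xs \<subseteq> {..<n}" "\<forall>(a, b) \<in> set (steps xs). a \<noteq> b"
  shows "set (uedges xs) = (\<lambda>e. {fst e, snd e}) ` {e \<in> edge_set n. edge_mult xs e \<noteq> 0}"
proof (intro equalityI subsetI)
  fix d assume d: "d \<in> set (uedges xs)"
  then obtain a b where ab: "(a, b) \<in> set (steps xs)" "d = {a, b}" by (auto simp: uedges_def)
  let ?e = "(min a b, max a b)"
  have "a < n" "b < n" "a \<noteq> b" using steps_subset[OF ab(1)] assms ab(1) by auto
  hence "?e \<in> edge_set n" by (auto simp: edge_set_def min_def max_def)
  moreover have "d = {fst ?e, snd ?e}" using ab(2) by (auto simp: min_def max_def)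
  moreover have "edge_mult xs ?e \<noteq> 0"
    unfolding edge_mult_def calculation(2)[symmetric] using d by (simp add: count_list_0_iff)
  ultimately show "d \<in> (\<lambda>e. {fst e, snd e}) ` {e \<in> edge_set n. edge_mult xs e \<noteq> 0}" by blast
next
  fix d assume "d \<in> (\<lambda>e. {fst e, snd e}) ` {e \<in> edge_set n. edge_mult xs e \<noteq> 0}"
  thus "d \<in> set (uedges xs)" by (auto simp: edge_mult_def count_list_0_iff)
qed

lemma card_uedges:
  assumes "set xs \<subseteq> {..<n}" "\<forall>(a, b) \<in> set (steps xs). a \<noteq> b"
  shows "card (set (uedges xs)) = card {e \<in> edge_set n. edge_mult xs e \<noteq> 0}"
proof -
  have "inj_on (\<lambda>e. {fst e, snd e}) (edge_set n)"
    by (auto simp: inj_on_def edge_set_def doubleton_eq_iff)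
  hence "inj_on (\<lambda>e. {fst e, snd e}) {e \<in> edge_set n. edge_mult xs e \<noteq> 0}"
    by (rule inj_on_subset) blast
  thus ?thesis unfolding set_uedges_eq[OF assms] by (rule card_image)
qed

text \<open>Restates doubling through the exponents of \<open>walk_weight_sym_of\<close>: a closed
  walk without loops that fails to be doubled has a factor of exponent exactly 1.\<close>

lemma doubled_walk_iff:
  assumes "set xs \<subseteq> {..<n}" "\<forall>(a, b) \<in> set (steps xs). a \<noteq> b"
  shows "doubled_walk xs \<longleftrightarrow> xs \<noteq> [] \<and> hd xs = last xs \<and> (\<forall>e\<in>edge_set n. edge_mult xs e \<noteq> 1)"
proof -
  have "(\<forall>d \<in> set (uedges xs). 2 \<le> count_list (uedges xs) d) \<longleftrightarrow>
      (\<forall>e\<in>{e \<in> edge_set n. edge_mult xs e \<noteq> 0}. 2 \<le> edge_mult xs e)"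
    unfolding set_uedges_eq[OF assms] edge_mult_def by simp
  also have "\<dots> \<longleftrightarrow> (\<forall>e\<in>edge_set n. edge_mult xs e \<noteq> 1)"
  proof -
    have "(m \<noteq> 0 \<longrightarrow> 2 \<le> m) \<longleftrightarrow> m \<noteq> 1" for m :: nat by linarith
    thus ?thesis by blast
  qed
  finally show ?thesis using assms(2) unfolding doubled_walk_def by blast
qed

section \<open>Independent edges and their central moments\<close>

definition edge_pmf :: "nat \<Rightarrow> (nat \<times> nat \<Rightarrow> real) \<Rightarrow> (nat \<times> nat \<Rightarrow> bool) pmf" where
  "edge_pmf n \<theta> = Pi_pmf (edge_set n) False (\<lambda>e. bernoulli_pmf (\<theta> e))"

definition centered :: "(nat \<times> nat \<Rightarrow> real) \<Rightarrow> (nat \<times> nat \<Rightarrow> bool) \<Rightarrow> nat \<times> nat \<Rightarrow> real" where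
  "centered \<theta> b e = of_bool (b e) - \<theta> e"

text \<open>Finite support makes every function integrable, so traces and exponentials can be
  averaged term by term.\<close>

lemma finite_set_edge_pmf: "finite (set_pmf (edge_pmf n \<theta>))"
proof (rule finite_subset)
  show "set_pmf (edge_pmf n \<theta>) \<subseteq> {b. \<forall>e. (e \<in> edge_set n \<longrightarrow> b e \<in> UNIV) \<and> (e \<notin> edge_set n \<longrightarrow> b e = False)}"
    using set_Pi_pmf_subset[OF finite_edge_set] unfolding edge_pmf_def by fastforce
  show "finite {b. \<forall>e. (e \<in> edge_set n \<longrightarrow> b e \<in> UNIV) \<and> (e \<notin> edge_set n \<longrightarrow> b e = False)}"
    by (rule finite_set_of_finite_funs[OF finite_edge_set]) simp
qed

lemma integrable_edge_pmf [simp]: "integrable (measure_pmf (edge_pmf n \<theta>)) (f :: _ \<Rightarrow> real)"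
  by (rule integrable_measure_pmf_finite[OF finite_set_edge_pmf])

lemma expectation_edge_pmf_prod:
  fixes f :: "nat \<times> nat \<Rightarrow> bool \<Rightarrow> real"
  shows "measure_pmf.expectation (edge_pmf n \<theta>) (\<lambda>b. \<Prod>e\<in>edge_set n. f e (b e)) =
    (\<Prod>e\<in>edge_set n. measure_pmf.expectation (bernoulli_pmf (\<theta> e)) (f e))"
proof -
  let ?M = "edge_pmf n \<theta>"
  have "prob_space.indep_vars (measure_pmf ?M) (\<lambda>_. count_space UNIV) (\<lambda>e b. b e) (edge_set n)"
    unfolding edge_pmf_def by (rule indep_vars_Pi_pmf[OF finite_edge_set])
  hence "prob_space.indep_vars (measure_pmf ?M) (\<lambda>_. borel) (\<lambda>e b. f e (b e)) (edge_set n)"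
    by (rule prob_space.indep_vars_compose2[OF measure_pmf.prob_space_axioms]) simp
  hence "measure_pmf.expectation ?M (\<lambda>b. \<Prod>e\<in>edge_set n. f e (b e)) =
      (\<Prod>e\<in>edge_set n. measure_pmf.expectation ?M (\<lambda>b. f e (b e)))"
    by (rule prob_space.indep_vars_lebesgue_integral[OF measure_pmf.prob_space_axioms finite_edge_set]) simp
  also have "\<dots> = (\<Prod>e\<in>edge_set n. measure_pmf.expectation (bernoulli_pmf (\<theta> e)) (f e))"
  proof (intro prod.cong refl)
    fix e assume e: "e \<in> edge_set n"
    have "bernoulli_pmf (\<theta> e) = map_pmf (\<lambda>b. b e) ?M"
      unfolding edge_pmf_def using Pi_pmf_component[OF finite_edge_set, of e n False] e by simp
    thus "measure_pmf.expectation ?M (\<lambda>b. f e (b e)) = measure_pmf.expectation (bernoulli_pmf (\<theta> e)) (f e)"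
      by simp
  qed
  finally show ?thesis .
qed

text \<open>The central moment of order \<open>k\<close> of the Bernoulli law with parameter
  \<open>t\<close>.\<close>

definition bernoulli_moment :: "real \<Rightarrow> nat \<Rightarrow> real" where
  "bernoulli_moment t k = t * (1 - t) ^ k + (1 - t) * (- t) ^ k"

lemma bernoulli_moment_simps [simp]: "bernoulli_moment t 0 = 1" "bernoulli_moment t (Suc 0) = 0"
  by (simp_all add: bernoulli_moment_def algebra_simps)

text \<open>Yields one factor \<open>t\<close> per distinct edge whatever its multiplicity. Order at
  least 2 lets the second summand be bounded by t^2, and t (1 - t) + t^2 = t.\<close>

lemma abs_bernoulli_moment_le:
  assumes "0 \<le> t" "t \<le> 1" "2 \<le> k" shows "\<bar>bernoulli_moment t k\<bar> \<le> t"
proof -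
  have "\<bar>bernoulli_moment t k\<bar> \<le> \<bar>t * (1 - t) ^ k\<bar> + \<bar>(1 - t) * (- t) ^ k\<bar>"
    unfolding bernoulli_moment_def by (rule abs_triangle_ineq)
  also have "\<dots> = t * (1 - t) ^ k + (1 - t) * t ^ k"
    using assms by (simp add: abs_mult power_abs)
  finally have 1: "\<bar>bernoulli_moment t k\<bar> \<le> t * (1 - t) ^ k + (1 - t) * t ^ k" .
  have "t * (1 - t) ^ k + (1 - t) * t ^ k \<le> t * (1 - t) ^ 1 + (1 - t) * t ^ 2"
    using assms by (intro add_mono mult_left_mono power_decreasing) auto
  also have "\<dots> \<le> t * (1 - t) + t * t"
    using assms by (simp add: power2_eq_square mult_left_le_one_le)
  also have "\<dots> = t" by (simp add: algebra_simps)
  finally show ?thesis using 1 by linarith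
qed

text \<open>The law of \<open>3 * (b - 1/3)\<close>, with \<open>b\<close> Bernoulli of parameter \<open>1/3\<close>, takes the values \<open>2\<close> and \<open>-1\<close>; it is
  centered and all its other moments are at least \<open>1\<close>, which is why it serves as the comparison law.\<close>
lemma bernoulli_moment_third_ge: assumes "k \<noteq> 1" shows "(1/3) ^ k \<le> bernoulli_moment (1/3) k"
proof -
  \<comment> \<open>Scaled by 3^k, the moment is (2^k + 2 (-1)^k) / 3, the moment of the law with
    values 2 and -1; at k = 1 it would be 0.\<close>
  have "(3::real) \<le> 2 ^ k + 2 * (-1) ^ k"
  proof (cases "k < 3")
    case True
    hence "k = 0 \<or> k = 2" using assms by linarith
    thus "3 \<le> (2::real) ^ k + 2 * (-1) ^ k" by (elim disjE) simp_all
  next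
    case False
    hence "(2::real) ^ 3 \<le> 2 ^ k" by (intro power_increasing) auto
    moreover have "(-1::real) ^ k \<ge> -1" by (cases "even k") simp_all
    ultimately show "3 \<le> (2::real) ^ k + 2 * (-1) ^ k" by simp
  qed
  hence "(1/3) ^ k * 3 \<le> (1/3) ^ k * ((2::real) ^ k + 2 * (-1) ^ k)" by (intro mult_left_mono) auto
  also have "\<dots> = 3 * bernoulli_moment (1/3) k"
  proof -
    have "(1 - 1/3 :: real) ^ k = (1/3) ^ k * 2 ^ k" "(- (1/3) :: real) ^ k = (1/3) ^ k * (-1) ^ k"
      unfolding power_mult_distrib[symmetric] by simp_all
    moreover have "c * (a + 2 * b) = 3 * (1/3 * (c * a) + (1 - 1/3) * (c * b))" for a b c :: real
      by (simp add: algebra_simps)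
    ultimately show ?thesis unfolding bernoulli_moment_def by (simp only:)
  qed
  finally show ?thesis by simp
qed

lemma bernoulli_moment_third_nonneg: "0 \<le> bernoulli_moment (1/3) k"
proof (cases "k = 1")
  case False
  have "0 \<le> (1/3 :: real) ^ k" by simp
  thus ?thesis using bernoulli_moment_third_ge[OF False] by (rule order_trans)
qed simp

lemma expectation_walk_weight:
  assumes "set xs \<subseteq> {..<n}" "\<forall>(a, b) \<in> set (steps xs). a \<noteq> b"
    and \<theta>: "\<And>e. e \<in> edge_set n \<Longrightarrow> 0 \<le> \<theta> e \<and> \<theta> e \<le> 1"
  shows "measure_pmf.expectation (edge_pmf n \<theta>) (\<lambda>b. walk_weight (sym_of (centered \<theta> b)) xs) =
    (\<Prod>e\<in>edge_set n. bernoulli_moment (\<theta> e) (edge_mult xs e))"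
proof -
  have "measure_pmf.expectation (edge_pmf n \<theta>) (\<lambda>b. walk_weight (sym_of (centered \<theta> b)) xs) =
    (\<Prod>e\<in>edge_set n. measure_pmf.expectation (bernoulli_pmf (\<theta> e)) (\<lambda>c. (of_bool c - \<theta> e) ^ edge_mult xs e))"
    unfolding walk_weight_sym_of[OF assms(1,2)] centered_def by (rule expectation_edge_pmf_prod)
  also have "\<dots> = (\<Prod>e\<in>edge_set n. bernoulli_moment (\<theta> e) (edge_mult xs e))"
    using \<theta> by (intro prod.cong refl) (simp add: bernoulli_moment_def mult.commute)
  finally show ?thesis .
qed

text \<open>The trace of the \<open>L\<close>-th power, by \<open>closed_walk_sum_eq_trace\<close>,
  kept as a sum over walks so that expectations can be taken walk by walk.\<close>

definition closed_walk_sum :: "nat \<Rightarrow> nat \<Rightarrow> (nat \<Rightarrow> nat \<Rightarrow> real) \<Rightarrow> real" where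
  "closed_walk_sum n L M = (\<Sum>xs\<in>{xs \<in> walks n L. hd xs = last xs}. walk_weight M xs)"

text \<open>A closed walk that is not doubled meets the zero diagonal or has an edge traversed once,
  whose centered variable has mean 0. In a doubled walk every distinct edge contributes at most
  \<rho>.\<close>

lemma expectation_closed_walk_sum_le:
  assumes \<theta>: "\<And>e. e \<in> edge_set n \<Longrightarrow> 0 \<le> \<theta> e \<and> \<theta> e \<le> \<rho>" and \<rho>: "0 \<le> \<rho>" "\<rho> \<le> 1"
  shows "measure_pmf.expectation (edge_pmf n \<theta>) (\<lambda>b. closed_walk_sum n L (sym_of (centered \<theta> b)))
    \<le> (\<Sum>xs\<in>{xs\<in>walks n L. doubled_walk xs}. \<rho> ^ card (set (uedges xs)))"
proof -
  let ?E = "\<lambda>xs. measure_pmf.expectation (edge_pmf n \<theta>) (\<lambda>b. walk_weight (sym_of (centered \<theta> b)) xs)"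
  let ?C = "{xs \<in> walks n L. hd xs = last xs}"
  have \<theta>1: "0 \<le> \<theta> e \<and> \<theta> e \<le> 1" if "e \<in> edge_set n" for e using \<theta>[OF that] \<rho> by linarith
  have "measure_pmf.expectation (edge_pmf n \<theta>) (\<lambda>b. closed_walk_sum n L (sym_of (centered \<theta> b))) = (\<Sum>xs\<in>?C. ?E xs)"
    unfolding closed_walk_sum_def by (rule Bochner_Integration.integral_sum) simp
  also have "\<dots> \<le> (\<Sum>xs\<in>?C. if doubled_walk xs then \<rho> ^ card (set (uedges xs)) else 0)"
  proof (rule sum_mono)
    fix xs assume xs: "xs \<in> ?C"
    hence sub: "set xs \<subseteq> {..<n}" and ne: "xs \<noteq> []" by (auto simp: walks_def)
    show "?E xs \<le> (if doubled_walk xs then \<rho> ^ card (set (uedges xs)) else 0)"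
    proof (cases "\<forall>(a, b) \<in> set (steps xs). a \<noteq> b")
      case False
      hence "\<not> doubled_walk xs" unfolding doubled_walk_def by blast
      thus ?thesis by (simp add: walk_weight_loop[OF False])
    next
      case True
      have E: "?E xs = (\<Prod>e\<in>edge_set n. bernoulli_moment (\<theta> e) (edge_mult xs e))"
        by (rule expectation_walk_weight[OF sub True]) (rule \<theta>1)
      show ?thesis
      proof (cases "doubled_walk xs")
        case False
        then obtain e where e: "e \<in> edge_set n" "edge_mult xs e = 1"
          using doubled_walk_iff[OF sub True] ne xs by auto
        have "?E xs = 0" unfolding E
          by (rule prod_zero[OF finite_edge_set], rule bexI[OF _ e(1)]) (simp add: e(2))
        thus ?thesis using False by simp
      next
        case dw: True
        have "?E xs \<le> (\<Prod>e\<in>edge_set n. \<bar>bernoulli_moment (\<theta> e) (edge_mult xs e)\<bar>)"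
          unfolding E abs_prod[symmetric] by (rule abs_ge_self)
        also have "\<dots> \<le> (\<Prod>e\<in>edge_set n. if edge_mult xs e \<noteq> 0 then \<rho> else 1)"
        proof (intro prod_mono conjI)
          fix e assume e: "e \<in> edge_set n"
          have "edge_mult xs e \<noteq> 1" using dw e doubled_walk_iff[OF sub True] by blast
          thus "\<bar>bernoulli_moment (\<theta> e) (edge_mult xs e)\<bar> \<le> (if edge_mult xs e \<noteq> 0 then \<rho> else 1)"
            using abs_bernoulli_moment_le[of "\<theta> e" "edge_mult xs e"] \<theta>[OF e] \<theta>1[OF e]
            by (cases "edge_mult xs e = 0") auto
        qed simp
        also have "\<dots> = \<rho> ^ card {e \<in> edge_set n. edge_mult xs e \<noteq> 0}"
          using finite_edge_set by (simp add: prod.If_cases Int_def)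
        also have "\<dots> = \<rho> ^ card (set (uedges xs))" by (simp only: card_uedges[OF sub True])
        finally show ?thesis using dw by simp
      qed
    qed
  qed
  also have "\<dots> = (\<Sum>xs\<in>{xs\<in>walks n L. doubled_walk xs}. \<rho> ^ card (set (uedges xs)))"
    using finite_walks by (intro sum.mono_neutral_cong_right) (auto simp: doubled_walk_def)
  finally show ?thesis .
qed

text \<open>Converts the counting of doubled walks into an expected trace: under the comparison law
  no walk contributes negatively, and each doubled one contributes at least
  \<open>(1/3) ^ L\<close>.\<close>

lemma expectation_closed_walk_sum_third_ge:
  "(1/3) ^ L * real (card {xs\<in>walks n L. doubled_walk xs}) \<le>
    measure_pmf.expectation (edge_pmf n (\<lambda>_. 1/3)) (\<lambda>b. closed_walk_sum n L (sym_of (centered (\<lambda>_. 1/3) b)))"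
proof -
  let ?\<theta> = "\<lambda>_ :: nat \<times> nat. 1/3 :: real"
  let ?E = "\<lambda>xs. measure_pmf.expectation (edge_pmf n ?\<theta>) (\<lambda>b. walk_weight (sym_of (centered ?\<theta> b)) xs)"
  let ?C = "{xs \<in> walks n L. hd xs = last xs}"
  have "(1/3) ^ L * real (card {xs\<in>walks n L. doubled_walk xs}) = (\<Sum>xs\<in>{xs\<in>walks n L. doubled_walk xs}. (1/3) ^ L)"
    by simp
  also have "\<dots> = (\<Sum>xs\<in>?C. if doubled_walk xs then (1/3) ^ L else 0)"
    using finite_walks by (intro sum.mono_neutral_cong_left) (auto simp: doubled_walk_def)
  also have "\<dots> \<le> (\<Sum>xs\<in>?C. ?E xs)"
  proof (rule sum_mono)
    fix xs assume xs: "xs \<in> ?C"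
    hence sub: "set xs \<subseteq> {..<n}" and len: "length xs = Suc L" by (auto simp: walks_def)
    show "(if doubled_walk xs then (1/3) ^ L else 0) \<le> ?E xs"
    proof (cases "\<forall>(a, b) \<in> set (steps xs). a \<noteq> b")
      case False
      hence "\<not> doubled_walk xs" unfolding doubled_walk_def by blast
      thus ?thesis by (simp add: walk_weight_loop[OF False])
    next
      case True
      have E: "?E xs = (\<Prod>e\<in>edge_set n. bernoulli_moment (1/3) (edge_mult xs e))"
        by (rule expectation_walk_weight[OF sub True]) simp
      show ?thesis
      proof (cases "doubled_walk xs")
        case False
        thus ?thesis unfolding E by (simp add: prod_nonneg bernoulli_moment_third_nonneg)
      next
        case dw: True
        \<comment> \<open>The weight for a constant off-diagonal matrix, computed step by step and
          edge by edge, replaces an argument that the multiplicities add up to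
          \<open>L\<close>.\<close>
        have "sym_of (\<lambda>_. 1/3) a b = (if a = b then 0 else 1/3)" for a b by (simp add: sym_of_def)
        hence "walk_weight (sym_of (\<lambda>_. 1/3)) xs = (\<Prod>(a, b)\<leftarrow>steps xs. 1/3)"
          unfolding walk_weight_def using True by (intro arg_cong[of _ _ prod_list] map_cong) auto
        also have "\<dots> = (1/3) ^ L"
          using len by (simp add: case_prod_unfold map_replicate_const prod_list_replicate steps_def)
        finally have "(1/3) ^ L = (\<Prod>e\<in>edge_set n. (1/3::real) ^ edge_mult xs e)"
          unfolding walk_weight_sym_of[OF sub True] by (rule sym)
        also have "\<dots> \<le> ?E xs"
          unfolding E using dw doubled_walk_iff[OF sub True]
          by (intro prod_mono conjI bernoulli_moment_third_ge) auto
        finally show ?thesis using dw by simp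
      qed
    qed
  qed
  also have "\<dots> = measure_pmf.expectation (edge_pmf n ?\<theta>) (\<lambda>b. closed_walk_sum n L (sym_of (centered ?\<theta> b)))"
    unfolding closed_walk_sum_def by (rule Bochner_Integration.integral_sum[symmetric]) simp
  finally show ?thesis .
qed

section \<open>Lattice nets and matrix powers\<close>

text \<open>The net consists of the points of the lattice with mesh \<open>1 / (4 * sqrt r)\<close> in the unit ball,
  indexed by their integer coordinates.\<close>
definition net_index :: "nat \<Rightarrow> (nat \<Rightarrow> int) set" where
  "net_index r = {k \<in> {..<r} \<rightarrow>\<^sub>E {- int (16 * r)..int (16 * r)}. (\<Sum>i<r. (k i)\<^sup>2) \<le> int (16 * r)}"

definition net_point :: "nat \<Rightarrow> (nat \<Rightarrow> int) \<Rightarrow> nat \<Rightarrow> real" where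
  "net_point r k = (\<lambda>i. of_int (k i) / (4 * sqrt (real r)))"

lemma finite_net_index: "finite (net_index r)"
  unfolding net_index_def by (rule finite_subset[of _ "{..<r} \<rightarrow>\<^sub>E {- int (16 * r)..int (16 * r)}"])
    (auto intro: finite_PiE)

lemma sum_half_powers: "(\<Sum>j\<in>{- int m..int m}. (1/2::real) ^ nat \<bar>j\<bar>) = 3 - 2 * (1/2) ^ m"
proof (induction m)
  case (Suc m)
  have "{- int (Suc m)..int (Suc m)} = insert (int (Suc m)) (insert (- int (Suc m)) {- int m..int m})"
    by auto
  hence "(\<Sum>j\<in>{- int (Suc m)..int (Suc m)}. (1/2::real) ^ nat \<bar>j\<bar>) =
      (1/2) ^ Suc m + ((1/2) ^ Suc m + (\<Sum>j\<in>{- int m..int m}. (1/2) ^ nat \<bar>j\<bar>))"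
    by (simp add: nat_add_distrib)
  thus ?case unfolding Suc.IH by simp
qed simp

text \<open>On the net the sum of |k i| is at most the sum of squares, hence at most 16 r, so the
  weight 2^(16 r) times the product of the 2^(-|k i|) is at least 1. Over the whole box these
  weights factorise, with coordinate sums at most 3.\<close>

lemma card_net_index: "real (card (net_index r)) \<le> (2 ^ 16 * 3) ^ r"
proof -
  let ?I = "{- int (16 * r)..int (16 * r)}"
  have "real (card (net_index r)) = (\<Sum>k\<in>net_index r. 1)" by simp
  also have "\<dots> \<le> (\<Sum>k\<in>net_index r. 2 ^ (16 * r) * (\<Prod>i<r. (1/2) ^ nat \<bar>k i\<bar>))"
  proof (rule sum_mono)
    fix k assume k: "k \<in> net_index r"
    have "(\<Sum>i<r. \<bar>k i\<bar>) \<le> (\<Sum>i<r. (k i)\<^sup>2)"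
    proof (rule sum_mono)
      fix i
      show "\<bar>k i\<bar> \<le> (k i)\<^sup>2"
      proof (cases "k i = 0")
        case False
        hence "\<bar>k i\<bar> * 1 \<le> \<bar>k i\<bar> * \<bar>k i\<bar>" by (intro mult_left_mono) auto
        thus ?thesis by (simp add: power2_eq_square)
      qed simp
    qed
    also have "\<dots> \<le> int (16 * r)" using k by (simp add: net_index_def)
    finally have "int (\<Sum>i<r. nat \<bar>k i\<bar>) \<le> int (16 * r)" by simp
    hence le: "(\<Sum>i<r. nat \<bar>k i\<bar>) \<le> 16 * r" by (simp only: of_nat_le_iff)
    have "(1::real) = 2 ^ (16 * r) * (1/2) ^ (16 * r)" by (simp only: power_mult_distrib[symmetric]) simp
    also have "\<dots> \<le> 2 ^ (16 * r) * (1/2) ^ (\<Sum>i<r. nat \<bar>k i\<bar>)"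
      by (intro mult_left_mono power_decreasing le) simp_all
    finally show "(1::real) \<le> 2 ^ (16 * r) * (\<Prod>i<r. (1/2) ^ nat \<bar>k i\<bar>)" by (simp only: power_sum)
  qed
  also have "\<dots> \<le> (\<Sum>k\<in>{..<r} \<rightarrow>\<^sub>E ?I. 2 ^ (16 * r) * (\<Prod>i<r. (1/2) ^ nat \<bar>k i\<bar>))"
  proof (rule sum_mono2)
    show "finite ({..<r} \<rightarrow>\<^sub>E ?I)" by (rule finite_PiE) simp_all
    show "net_index r \<subseteq> {..<r} \<rightarrow>\<^sub>E ?I" unfolding net_index_def by blast
  qed (intro mult_nonneg_nonneg prod_nonneg ballI zero_le_power, simp_all only: zero_le_numeral zero_le_divide_1_iff)
  also have "\<dots> = 2 ^ (16 * r) * (\<Prod>i<r. \<Sum>j\<in>?I. (1/2) ^ nat \<bar>j\<bar>)"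
    unfolding sum_distrib_left[symmetric]
    by (subst prod_sum_PiE[OF finite_lessThan finite_atLeastAtMost_int]) (rule refl)
  also have "\<dots> \<le> 2 ^ (16 * r) * (\<Prod>i<r. 3)"
  proof (intro mult_left_mono prod_mono conjI)
    have "(1/2 :: real) ^ (16 * r) \<le> 1" by (rule power_le_one) simp_all
    hence "0 \<le> 3 - 2 * (1/2 :: real) ^ (16 * r)" by linarith
    thus "0 \<le> (\<Sum>j\<in>?I. (1/2::real) ^ nat \<bar>j\<bar>)" by (simp only: sum_half_powers)
    have "0 \<le> (1/2 :: real) ^ (16 * r)" by simp
    hence "3 - 2 * (1/2 :: real) ^ (16 * r) \<le> 3" by linarith
    thus "(\<Sum>j\<in>?I. (1/2::real) ^ nat \<bar>j\<bar>) \<le> 3" by (simp only: sum_half_powers)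
  qed simp
  also have "\<dots> = (2 ^ 16 * 3) ^ r" by (simp only: prod_constant card_lessThan power_mult power_mult_distrib)
  finally show ?thesis .
qed

lemma nrm_net_point_le:
  assumes "0 < r" "k \<in> net_index r" shows "nrm r (net_point r k) \<le> 1"
proof -
  have "real_of_int (\<Sum>i<r. (k i)\<^sup>2) \<le> real_of_int (int (16 * r))"
    unfolding of_int_le_iff using assms(2) by (simp add: net_index_def)
  hence 1: "(\<Sum>i<r. (real_of_int (k i))\<^sup>2) \<le> 16 * real r" by simp
  have "(nrm r (net_point r k))\<^sup>2 = (\<Sum>i<r. (real_of_int (k i))\<^sup>2) / (16 * real r)"
    unfolding nrm_sq net_point_def power_divide sum_divide_distrib by (simp add: power_mult_distrib)
  also have "\<dots> \<le> 1\<^sup>2" using 1 assms(1) by simp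
  finally show ?thesis by (rule power2_le_imp_le) simp
qed

lemma net_approximation:
  assumes r: "0 < r" and x: "nrm r x \<le> 1"
  obtains k where "k \<in> net_index r" "nrm r (\<lambda>i. x i - net_point r k i) \<le> 1/4"
proof -
  define c where "c = 4 * sqrt (real r)"
  have c: "0 < c" "c\<^sup>2 = 16 * real r" using r by (auto simp: c_def power_mult_distrib)
  \<comment> \<open>Rounding towards zero does not enlarge coordinates, so the net point stays in
    the unit ball. The error is at most \<open>1 / c\<close> per coordinate, in norm at most sqrt r
    / c = 1/4.\<close>
  define k where "k = restrict (\<lambda>i. if x i \<ge> 0 then \<lfloor>c * x i\<rfloor> else \<lceil>c * x i\<rceil>) {..<r}"
  have k1: "\<bar>c * x i - of_int (k i)\<bar> \<le> 1" if "i < r" for i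
    using that unfolding k_def by simp linarith
  have k2: "\<bar>real_of_int (k i)\<bar> \<le> \<bar>c * x i\<bar>" if "i < r" for i
  proof (cases "x i \<ge> 0")
    case True
    hence "0 \<le> c * x i" using c by simp
    moreover from this have "0 \<le> \<lfloor>c * x i\<rfloor>" by simp
    ultimately show ?thesis using True that by (simp add: k_def)
  next
    case False
    hence "c * x i \<le> 0" using c by (simp add: mult_le_0_iff)
    moreover from this have "\<lceil>c * x i\<rceil> \<le> 0" by simp
    ultimately show ?thesis using False that by (simp add: k_def)
  qed
  have "(\<Sum>i<r. (real_of_int (k i))\<^sup>2) \<le> (\<Sum>i<r. (c * x i)\<^sup>2)"
    by (intro sum_mono) (simp only: abs_le_square_iff[symmetric] k2 lessThan_iff)
  also have "\<dots> = c\<^sup>2 * (nrm r x)\<^sup>2" by (simp only: nrm_sq power_mult_distrib sum_distrib_left)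
  also have "\<dots> \<le> c\<^sup>2 * 1" using x by (intro mult_left_mono) (auto simp: power_le_one)
  finally have "real_of_int (\<Sum>i<r. (k i)\<^sup>2) \<le> real_of_int (int (16 * r))" using c by simp
  hence sq: "(\<Sum>i<r. (k i)\<^sup>2) \<le> int (16 * r)" by (simp only: of_int_le_iff)
  have "\<bar>k i\<bar> \<le> int (16 * r)" if "i < r" for i
  proof -
    have "\<bar>k i\<bar> \<le> (k i)\<^sup>2"
    proof (cases "k i = 0")
      case False
      hence "\<bar>k i\<bar> * 1 \<le> \<bar>k i\<bar> * \<bar>k i\<bar>" by (intro mult_left_mono) auto
      thus ?thesis by (simp add: power2_eq_square)
    qed simp
    also have "\<dots> \<le> (\<Sum>i<r. (k i)\<^sup>2)" using that by (intro member_le_sum) auto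
    finally show ?thesis using sq by linarith
  qed
  hence "k \<in> {..<r} \<rightarrow>\<^sub>E {- int (16 * r)..int (16 * r)}"
    by (intro PiE_I) (auto simp: k_def abs_le_iff minus_le_iff)
  hence kn: "k \<in> net_index r" using sq by (simp add: net_index_def)
  have "(nrm r (\<lambda>i. x i - net_point r k i))\<^sup>2 \<le> (\<Sum>i<r. 1 / c\<^sup>2)"
    unfolding nrm_sq
  proof (rule sum_mono)
    fix i assume i: "i \<in> {..<r}"
    have "(x i - net_point r k i)\<^sup>2 = (c * x i - of_int (k i))\<^sup>2 / c\<^sup>2"
      unfolding net_point_def c_def[symmetric] power_divide[symmetric] using c(1) by (simp add: diff_divide_distrib)
    also have "\<dots> \<le> 1 / c\<^sup>2"
      using k1[of i] i by (intro divide_right_mono) (auto simp: abs_square_le_1)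
    finally show "(x i - net_point r k i)\<^sup>2 \<le> 1 / c\<^sup>2" .
  qed
  also have "\<dots> = (1/4)\<^sup>2" using c(2) r by (simp add: power2_eq_square)
  finally have "nrm r (\<lambda>i. x i - net_point r k i) \<le> 1/4" by (rule power2_le_imp_le) simp
  thus thesis by (rule that[OF kn])
qed

text \<open>Moving each of the two singular vectors to the net costs at most \<open>s / 4\<close>;
  the total loss \<open>s / 2\<close> is absorbed on the left.\<close>

lemma top_singular_value_le_net:
  assumes r: "0 < r" and s: "opbd r M s" "bil r M u v = s" "nrm r u = 1" "nrm r v = 1"
  shows "\<exists>k\<in>net_index r. \<exists>l\<in>net_index r. s \<le> 2 * bil r M (net_point r k) (net_point r l)"
proof -
  obtain k where k: "k \<in> net_index r" "nrm r (\<lambda>i. u i - net_point r k i) \<le> 1/4"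
    using net_approximation[OF r, of u] s by auto
  obtain l where l: "l \<in> net_index r" "nrm r (\<lambda>i. v i - net_point r l i) \<le> 1/4"
    using net_approximation[OF r, of v] s by auto
  let ?q = "net_point r k" and ?w = "net_point r l"
  have s0: "0 \<le> s" using s by (simp add: opbd_def)
  have le: "bil r M x y \<le> s * (nrm r x * nrm r y)" for x y
    using s(1) by (simp add: opbd_def mult.assoc)
  have "s = bil r M (\<lambda>i. u i - ?q i) v + bil r M ?q (\<lambda>i. v i - ?w i) + bil r M ?q ?w"
    unfolding s(2)[symmetric] bil_def sum.distrib[symmetric] by (intro sum.cong refl) (simp add: algebra_simps)
  also have "\<dots> \<le> s * (1/4) + s * (1/4) + bil r M ?q ?w"
  proof (intro add_mono order_refl)
    show "bil r M (\<lambda>i. u i - ?q i) v \<le> s * (1/4)"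
      using k(2) s s0 by (intro order_trans[OF le] mult_left_mono) auto
    have "nrm r ?q * nrm r (\<lambda>i. v i - ?w i) \<le> 1 * (1/4)"
      by (intro mult_mono nrm_net_point_le r k l) auto
    thus "bil r M ?q (\<lambda>i. v i - ?w i) \<le> s * (1/4)"
      using s0 by (intro order_trans[OF le] mult_left_mono) auto
  qed
  finally have "s \<le> 2 * bil r M ?q ?w" by simp
  thus ?thesis using k(1) l(1) by blast
qed

section \<open>Powers of a matrix and traces over closed walks\<close>

fun mat_power :: "nat \<Rightarrow> (nat \<Rightarrow> nat \<Rightarrow> real) \<Rightarrow> nat \<Rightarrow> nat \<Rightarrow> nat \<Rightarrow> real" where
  "mat_power n M 0 i j = of_bool (i = j)"
| "mat_power n M (Suc k) i j = (\<Sum>l<n. M i l * mat_power n M k l j)"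

lemma sum_walks_eq_mat_power:
  assumes "i < n"
  shows "(\<Sum>xs\<in>{xs\<in>walks n L. hd xs = i \<and> last xs = j}. walk_weight M xs) = mat_power n M L i j"
  using assms
proof (induction L arbitrary: i)
  case 0
  have "{xs\<in>walks n 0. hd xs = i \<and> last xs = j} = (if i = j then {[i]} else {})"
    using 0 by (auto simp: walks_def length_Suc_conv)
  thus ?case by (simp add: walk_weight_def)
next
  case (Suc L)
  let ?W = "{ys\<in>walks n L. last ys = j}"
  have fin: "finite ?W" using finite_walks by simp
  have eq: "{xs\<in>walks n (Suc L). hd xs = i \<and> last xs = j} = (#) i ` ?W"
  proof (intro equalityI subsetI)
    fix xs assume xs: "xs \<in> {xs\<in>walks n (Suc L). hd xs = i \<and> last xs = j}"
    then obtain y ys where "xs = i # y # ys" by (auto simp: walks_def length_Suc_conv)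
    thus "xs \<in> (#) i ` ?W" using xs by (auto simp: walks_def)
  next
    fix xs assume "xs \<in> (#) i ` ?W"
    thus "xs \<in> {xs\<in>walks n (Suc L). hd xs = i \<and> last xs = j}"
      using Suc.prems by (auto simp: walks_def)
  qed
  have "(\<Sum>xs\<in>{xs\<in>walks n (Suc L). hd xs = i \<and> last xs = j}. walk_weight M xs) = (\<Sum>ys\<in>?W. walk_weight M (i # ys))"
    unfolding eq by (subst sum.reindex) (simp_all add: o_def)
  also have "\<dots> = (\<Sum>ys\<in>?W. M i (hd ys) * walk_weight M ys)"
  proof (intro sum.cong refl)
    fix ys assume "ys \<in> ?W"
    then obtain y zs where "ys = y # zs" by (auto simp: walks_def length_Suc_conv)
    thus "walk_weight M (i # ys) = M i (hd ys) * walk_weight M ys" by (simp add: walk_weight_def)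
  qed
  also have "\<dots> = (\<Sum>l<n. \<Sum>ys\<in>{ys\<in>?W. hd ys = l}. M i (hd ys) * walk_weight M ys)"
  proof (rule sum.group[symmetric, OF fin])
    show "hd ` ?W \<subseteq> {..<n}"
    proof
      fix l assume "l \<in> hd ` ?W"
      then obtain ys where ys: "ys \<in> ?W" "l = hd ys" by blast
      then obtain y zs where "ys = y # zs" by (auto simp: walks_def length_Suc_conv)
      thus "l \<in> {..<n}" using ys by (auto simp: walks_def)
    qed
  qed simp
  also have "\<dots> = (\<Sum>l<n. M i l * (\<Sum>ys\<in>{ys\<in>walks n L. hd ys = l \<and> last ys = j}. walk_weight M ys))"
    unfolding sum_distrib_left by (intro sum.cong) auto
  also have "\<dots> = mat_power n M (Suc L) i j" using Suc.IH by simp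
  finally show ?case .
qed

lemma closed_walk_sum_eq_trace: "closed_walk_sum n L M = (\<Sum>i<n. mat_power n M L i i)"
proof -
  let ?C = "{xs\<in>walks n L. hd xs = last xs}"
  have "closed_walk_sum n L M = (\<Sum>i<n. \<Sum>xs\<in>{xs\<in>?C. hd xs = i}. walk_weight M xs)"
    unfolding closed_walk_sum_def
  proof (rule sum.group[symmetric])
    show "hd ` ?C \<subseteq> {..<n}"
    proof
      fix l assume "l \<in> hd ` ?C"
      then obtain ys where ys: "ys \<in> ?C" "l = hd ys" by blast
      then obtain y zs where "ys = y # zs" by (auto simp: walks_def length_Suc_conv)
      thus "l \<in> {..<n}" using ys by (auto simp: walks_def)
    qed
  qed (use finite_walks in simp_all)
  also have "\<dots> = (\<Sum>i<n. \<Sum>xs\<in>{xs\<in>walks n L. hd xs = i \<and> last xs = i}. walk_weight M xs)"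
    by (intro sum.cong refl) auto
  also have "\<dots> = (\<Sum>i<n. mat_power n M L i i)"
    by (intro sum.cong refl sum_walks_eq_mat_power) simp
  finally show ?thesis .
qed

lemma mat_power_add:
  "i < n \<Longrightarrow> mat_power n M (a + b) i j = (\<Sum>l<n. mat_power n M a i l * mat_power n M b l j)"
proof (induction a arbitrary: i)
  case 0
  have "(\<Sum>l<n. mat_power n M 0 i l * mat_power n M b l j) = (\<Sum>l<n. if l = i then mat_power n M b l j else 0)"
    by (intro sum.cong) auto
  thus ?case using 0 by simp
next
  case (Suc a)
  have "mat_power n M (Suc a + b) i j = (\<Sum>m<n. M i m * (\<Sum>l<n. mat_power n M a m l * mat_power n M b l j))"
    unfolding add_Suc mat_power.simps(2) by (intro sum.cong refl arg_cong2[of _ _ _ _ "(*)"] Suc.IH) simp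
  also have "\<dots> = (\<Sum>l<n. \<Sum>m<n. M i m * mat_power n M a m l * mat_power n M b l j)"
    unfolding sum_distrib_left mult.assoc by (rule sum.swap)
  also have "\<dots> = (\<Sum>l<n. mat_power n M (Suc a) i l * mat_power n M b l j)"
    by (simp only: mat_power.simps(2) sum_distrib_right)
  finally show ?case .
qed

lemma mat_power_1: "i < n \<Longrightarrow> j < n \<Longrightarrow> mat_power n M (Suc 0) i j = M i j"
proof -
  assume "j < n"
  moreover have "mat_power n M (Suc 0) i j = (\<Sum>l<n. if l = j then M i l else 0)"
    unfolding mat_power.simps by (intro sum.cong) auto
  ultimately show ?thesis by simp
qed

lemma mat_power_symmetric:
  assumes "\<And>i j. M i j = M j i"
  shows "i < n \<Longrightarrow> j < n \<Longrightarrow> mat_power n M k i j = mat_power n M k j i"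
proof (induction k arbitrary: i j)
  case (Suc k)
  have "mat_power n M (Suc k) i j = mat_power n M (k + Suc 0) i j" by (simp only: add_Suc_right add_0_right)
  also have "\<dots> = (\<Sum>l<n. mat_power n M k i l * mat_power n M (Suc 0) l j)" by (rule mat_power_add[OF Suc.prems(1)])
  also have "\<dots> = (\<Sum>l<n. M j l * mat_power n M k l i)"
  proof (intro sum.cong refl)
    fix l assume "l \<in> {..<n}"
    hence l: "l < n" by simp
    show "mat_power n M k i l * mat_power n M (Suc 0) l j = M j l * mat_power n M k l i"
      unfolding mat_power_1[OF l Suc.prems(2)] Suc.IH[OF Suc.prems(1) l] assms[of l j] by (rule mult.commute)
  qed
  finally show ?case by (simp only: mat_power.simps(2))
qed auto

lemma app_funpow:
  "i < n \<Longrightarrow> (app n M ^^ k) x i = (\<Sum>j<n. mat_power n M k i j * x j)"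
proof (induction k arbitrary: i)
  case 0
  have "(\<Sum>j<n. mat_power n M 0 i j * x j) = (\<Sum>j<n. if j = i then x j else 0)"
    by (intro sum.cong) auto
  thus ?case using 0 by simp
next
  case (Suc k)
  have "(app n M ^^ Suc k) x i = (\<Sum>l<n. M i l * (\<Sum>j<n. mat_power n M k l j * x j))"
    unfolding funpow.simps o_def app_def[of n M] by (intro sum.cong refl arg_cong2[of _ _ _ _ "(*)"])
      (use Suc.IH in \<open>simp add: app_def\<close>)
  also have "\<dots> = (\<Sum>j<n. \<Sum>l<n. M i l * mat_power n M k l j * x j)"
    unfolding sum_distrib_left mult.assoc by (rule sum.swap)
  also have "\<dots> = (\<Sum>j<n. mat_power n M (Suc k) i j * x j)"
    by (simp only: mat_power.simps(2) sum_distrib_right)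
  finally show ?case .
qed

text \<open>The \<open>p\<close>-th power of a symmetric matrix is symmetric, so the trace of its
  square is a squared Frobenius norm. This also gives the nonnegativity that Markov's inequality
  requires.\<close>

lemma closed_walk_sum_eq_frobenius:
  assumes "\<And>i j. M i j = M j i"
  shows "closed_walk_sum n (2 * p) M = (\<Sum>i<n. \<Sum>j<n. (mat_power n M p i j)\<^sup>2)"
  unfolding closed_walk_sum_eq_trace mult_2
proof (intro sum.cong refl)
  fix i assume "i \<in> {..<n}"
  hence i: "i < n" by simp
  show "mat_power n M (p + p) i i = (\<Sum>j<n. (mat_power n M p i j)\<^sup>2)"
    unfolding mat_power_add[OF i] power2_eq_square
    by (intro sum.cong refl arg_cong2[of _ _ _ _ "(*)"] mat_power_symmetric[OF assms]) (simp_all add: i)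
qed

lemma nrm_app_funpow_le:
  assumes "opbd n M s" shows "nrm n ((app n M ^^ k) x) \<le> s ^ k * nrm n x"
proof (induction k)
  case (Suc k)
  have s: "0 \<le> s" using assms by (simp add: opbd_def)
  have "nrm n ((app n M ^^ Suc k) x) \<le> s * nrm n ((app n M ^^ k) x)"
    unfolding funpow.simps o_def by (rule opbd_app[OF assms])
  also have "\<dots> \<le> s * (s ^ k * nrm n x)" by (intro mult_left_mono Suc s)
  finally show ?case by (simp only: power_Suc mult.assoc)
qed simp

lemma nrm_app_funpow_sq_le:
  assumes "nrm n x = 1"
  shows "(nrm n ((app n M ^^ k) x))\<^sup>2 \<le> (\<Sum>i<n. \<Sum>j<n. (mat_power n M k i j)\<^sup>2)"
  unfolding nrm_sq[where x = "(app n M ^^ k) x"]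
proof (rule sum_mono)
  fix i assume "i \<in> {..<n}"
  hence "(app n M ^^ k) x i = ip n (mat_power n M k i) x" by (simp add: app_funpow ip_def)
  moreover have "\<bar>ip n (mat_power n M k i) x\<bar> \<le> nrm n (mat_power n M k i)"
  proof -
    have "\<bar>ip n (mat_power n M k i) x\<bar> \<le> (\<Sum>j<n. \<bar>mat_power n M k i j\<bar> * \<bar>x j\<bar>)"
      unfolding ip_def abs_mult[symmetric] by (rule sum_abs)
    also have "\<dots> \<le> nrm n (mat_power n M k i) * nrm n x" by (rule L2_set_mult_ineq)
    finally show ?thesis using assms by simp
  qed
  ultimately have "((app n M ^^ k) x i)\<^sup>2 \<le> (nrm n (mat_power n M k i))\<^sup>2"
    by (metis abs_ge_zero power2_abs power_mono)
  thus "((app n M ^^ k) x i)\<^sup>2 \<le> (\<Sum>j<n. (mat_power n M k i j)\<^sup>2)" by (simp only: nrm_sq)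
qed

text \<open>Column \<open>j\<close> of the \<open>p\<close>-th power is that power applied to a
  coordinate vector, so its squared norm is at most \<open>s ^ (2 * p)\<close>.\<close>

lemma closed_walk_sum_le_opbd:
  assumes sym: "\<And>i j. M i j = M j i" and s: "opbd n M s"
  shows "closed_walk_sum n (2 * p) M \<le> real n * s ^ (2 * p)"
proof -
  have "closed_walk_sum n (2 * p) M = (\<Sum>j<n. \<Sum>i<n. (mat_power n M p i j)\<^sup>2)"
    unfolding closed_walk_sum_eq_frobenius[OF sym] by (rule sum.swap)
  also have "\<dots> \<le> (\<Sum>j<n. s ^ (2 * p))"
  proof (rule sum_mono)
    fix j assume "j \<in> {..<n}"
    hence j: "j < n" by simp
    let ?e = "\<lambda>k. of_bool (k = j) :: real"
    have "(app n M ^^ p) ?e i = mat_power n M p i j" if "i < n" for i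
      unfolding app_funpow[OF that] using ip_unit[OF j, of "mat_power n M p i"] by (simp only: ip_def)
    hence "(\<Sum>i<n. (mat_power n M p i j)\<^sup>2) = (nrm n ((app n M ^^ p) ?e))\<^sup>2" by (simp add: nrm_sq)
    also have "\<dots> \<le> (s ^ p * nrm n ?e)\<^sup>2"
      by (intro power_mono nrm_app_funpow_le s) simp
    also have "\<dots> = s ^ (2 * p)" unfolding nrm_unit[OF j] by (simp add: power_mult[symmetric] mult.commute)
    finally show "(\<Sum>i<n. (mat_power n M p i j)\<^sup>2) \<le> s ^ (2 * p)" .
  qed
  also have "\<dots> = real n * s ^ (2 * p)" by simp
  finally show ?thesis .
qed

text \<open>By symmetry the top singular pair satisfies M v = s u and M u = s v. Powers of
  \<open>M\<close> send \<open>v\<close> to multiples of \<open>u\<close> and \<open>v\<close> in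
  turn, so the \<open>p\<close>-th power stretches it by exactly \<open>s ^ p\<close>.\<close>

lemma closed_walk_sum_ge_opbd:
  assumes sym: "\<And>i j. M i j = M j i" and p: "0 < p"
  shows "\<exists>s. opbd n M s \<and> s ^ (2 * p) \<le> closed_walk_sum n (2 * p) M"
proof (cases "\<forall>i<n. \<forall>j<n. M i j = 0")
  case True
  hence "opbd n M 0" by (simp add: opbd_def bil_def)
  moreover have "0 \<le> closed_walk_sum n (2 * p) M"
    unfolding closed_walk_sum_eq_frobenius[OF sym] by (intro sum_nonneg) simp
  moreover have "(0::real) ^ (2 * p) = 0" using p by (intro zero_power) simp
  ultimately show ?thesis by metis
next
  case False
  then obtain i j where "i < n" "j < n" "M i j \<noteq> 0" by blast
  then obtain s u v where s: "0 < s" "nrm n u = 1" "nrm n v = 1" "opbd n M s"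
    and u: "\<And>a. a < n \<Longrightarrow> app n M v a = s * u a" and v: "\<And>a. a < n \<Longrightarrow> app n (flip_mat M) u a = s * v a"
    using top_singular_triple[of i n j M] by metis
  have "flip_mat M = M" unfolding flip_mat_def by (intro ext sym)
  hence v': "app n M u a = s * v a" if "a < n" for a using v[OF that] by simp
  have "(app n M ^^ k) v a = s ^ k * (if even k then v a else u a)" if "a < n" for k a
    using that
  proof (induction k arbitrary: a)
    case (Suc k)
    have "(app n M ^^ Suc k) v a = app n M (\<lambda>a. s ^ k * (if even k then v a else u a)) a"
      unfolding funpow.simps o_def app_def[of n M] by (intro sum.cong refl arg_cong2[of _ _ _ _ "(*)"])
        (use Suc.IH in \<open>simp add: app_def\<close>)
    also have "\<dots> = s ^ k * app n M (if even k then v else u) a"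
      by (simp add: app_def sum_distrib_left mult_ac)
    also have "\<dots> = s ^ Suc k * (if even (Suc k) then v a else u a)"
      using u v' Suc.prems by simp
    finally show ?case .
  qed simp
  hence "nrm n ((app n M ^^ p) v) = nrm n (\<lambda>a. s ^ p * (if even p then v else u) a)"
    by (intro nrm_cong) simp
  also have "\<dots> = s ^ p" unfolding nrm_scale using s by (simp split: if_splits)
  finally have "s ^ (2 * p) = (nrm n ((app n M ^^ p) v))\<^sup>2" by (simp add: power_mult[symmetric] mult.commute)
  also have "\<dots> \<le> closed_walk_sum n (2 * p) M"
    unfolding closed_walk_sum_eq_frobenius[OF sym] by (rule nrm_app_funpow_sq_le[OF s(3)])
  finally show ?thesis using s(4) by blast
qed

text \<open>The maximum over the net is replaced by a sum, whose expectation splits; the even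
  exponent makes all terms nonnegative.\<close>

lemma closed_walk_sum_le_net:
  assumes sym: "\<And>i j. M i j = M j i" and r: "0 < r"
  shows "closed_walk_sum r (2 * p) M \<le>
    real r * (\<Sum>k\<in>net_index r. \<Sum>l\<in>net_index r. (2 * bil r M (net_point r k) (net_point r l)) ^ (2 * p))"
proof -
  obtain u v where uv: "nrm r u = 1" "nrm r v = 1" and max: "\<And>x y. bil r M x y \<le> bil r M u v * nrm r x * nrm r y"
    using bil_attains_max[OF r] by metis
  define s where "s = bil r M u v"
  \<comment> \<open>Negating \<open>u\<close> shows that the maximum is nonnegative. The matrix may
    be zero, so \<open>top_singular_triple\<close> is not applicable.\<close>
  have "- s = bil r M (\<lambda>i. - u i) v" by (simp add: s_def bil_def sum_negf)
  also have "\<dots> \<le> s * nrm r (\<lambda>i. - u i) * nrm r v" unfolding s_def by (rule max)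
  also have "nrm r (\<lambda>i. - u i) = 1" using nrm_scale[of "-1" u r] uv by simp
  finally have s0: "0 \<le> s" using uv by simp
  have o: "opbd r M s" unfolding opbd_def using s0 max by (simp add: s_def)
  let ?F = "\<lambda>k l. (2 * bil r M (net_point r k) (net_point r l)) ^ (2 * p)"
  have F: "0 \<le> ?F k l" for k l by (simp add: power_mult)
  obtain k l where kl: "k \<in> net_index r" "l \<in> net_index r" "s \<le> 2 * bil r M (net_point r k) (net_point r l)"
    using top_singular_value_le_net[OF r o s_def[symmetric] uv] by blast
  have "s ^ (2 * p) \<le> ?F k l" by (intro power_mono kl s0)
  also have "\<dots> \<le> (\<Sum>l\<in>net_index r. ?F k l)" by (rule member_le_sum[OF kl(2) F finite_net_index])
  also have "\<dots> \<le> (\<Sum>k\<in>net_index r. \<Sum>l\<in>net_index r. ?F k l)"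
    by (rule member_le_sum[OF kl(1) sum_nonneg[OF F] finite_net_index])
  finally have "real r * s ^ (2 * p) \<le> real r * (\<Sum>k\<in>net_index r. \<Sum>l\<in>net_index r. ?F k l)"
    by (intro mult_left_mono) simp_all
  with closed_walk_sum_le_opbd[OF sym o, of p] show ?thesis by (rule order_trans)
qed

section \<open>Spectral norm of the centered adjacency matrix\<close>

text \<open>Each variable occurs at two positions of the matrix; collecting both makes the form a
  sum of independent terms.\<close>

lemma bil_sym_of:
  "bil n (sym_of g) x y = (\<Sum>e\<in>edge_set n. g e * (x (fst e) * y (snd e) + x (snd e) * y (fst e)))"
proof -
  let ?F = "\<lambda>e. x (fst e) * sym_of g (fst e) (snd e) * y (snd e)"
  have "bil n (sym_of g) x y = (\<Sum>e\<in>{..<n} \<times> {..<n}. ?F e)"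
    unfolding bil_def sum.cartesian_product by (intro sum.cong refl) (simp add: case_prod_unfold)
  also have "\<dots> = (\<Sum>e\<in>edge_set n \<union> prod.swap ` edge_set n. ?F e)"
  proof (rule sum.mono_neutral_right)
    show "edge_set n \<union> prod.swap ` edge_set n \<subseteq> {..<n} \<times> {..<n}" by (auto simp: edge_set_def)
    show "\<forall>e\<in>{..<n} \<times> {..<n} - (edge_set n \<union> prod.swap ` edge_set n). ?F e = 0"
    proof
      fix e assume e: "e \<in> {..<n} \<times> {..<n} - (edge_set n \<union> prod.swap ` edge_set n)"
      have "fst e = snd e"
      proof (rule ccontr)
        assume "fst e \<noteq> snd e"
        hence "e \<in> edge_set n \<or> prod.swap e \<in> edge_set n" using e by (auto simp: edge_set_def)
        moreover have "e = prod.swap (prod.swap e)" by simp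
        ultimately show False using e by blast
      qed
      thus "?F e = 0" by (simp add: sym_of_def)
    qed
  qed simp
  also have "\<dots> = (\<Sum>e\<in>edge_set n. ?F e) + (\<Sum>e\<in>prod.swap ` edge_set n. ?F e)"
    by (intro sum.union_disjoint finite_imageI finite_edge_set) (auto simp: edge_set_def)
  also have "(\<Sum>e\<in>prod.swap ` edge_set n. ?F e) = (\<Sum>e\<in>edge_set n. ?F (prod.swap e))"
    by (subst sum.reindex) (simp_all add: o_def)
  also have "(\<Sum>e\<in>edge_set n. ?F e) + \<dots> = (\<Sum>e\<in>edge_set n. ?F e + ?F (prod.swap e))"
    by (rule sum.distrib[symmetric])
  also have "\<dots> = (\<Sum>e\<in>edge_set n. g e * (x (fst e) * y (snd e) + x (snd e) * y (fst e)))"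
    by (intro sum.cong refl) (auto simp: edge_set_def sym_of_def algebra_simps)
  finally show ?thesis .
qed

text \<open>After (a + b)^2 \<le> 2 (a^2 + b^2), the sum is twice the off-diagonal part of the
  product of the squared norms.\<close>

lemma sum_edge_coefficients_le:
  assumes "nrm n x \<le> 1" "nrm n y \<le> 1"
  shows "(\<Sum>e\<in>edge_set n. (x (fst e) * y (snd e) + x (snd e) * y (fst e))\<^sup>2) \<le> 2"
proof -
  let ?x = "\<lambda>i. (x i)\<^sup>2" and ?y = "\<lambda>i. (y i)\<^sup>2"
  have "(\<Sum>e\<in>edge_set n. (x (fst e) * y (snd e) + x (snd e) * y (fst e))\<^sup>2) \<le>
      (\<Sum>e\<in>edge_set n. 2 * (1 * (?x (fst e) * ?y (snd e) + ?x (snd e) * ?y (fst e))))"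
  proof (rule sum_mono)
    fix e
    have "(a + b)\<^sup>2 \<le> 2 * (a\<^sup>2 + b\<^sup>2)" for a b :: real
      using sum_squares_bound[of a b] by (simp add: power2_sum)
    from this[of "x (fst e) * y (snd e)" "x (snd e) * y (fst e)"]
    show "(x (fst e) * y (snd e) + x (snd e) * y (fst e))\<^sup>2 \<le>
      2 * (1 * (?x (fst e) * ?y (snd e) + ?x (snd e) * ?y (fst e)))"
      by (simp add: power_mult_distrib)
  qed
  also have "\<dots> = 2 * bil n (sym_of (\<lambda>_. 1)) ?x ?y"
    unfolding bil_sym_of by (simp only: sum_distrib_left)
  also have "bil n (sym_of (\<lambda>_. 1)) ?x ?y \<le> (\<Sum>i<n. \<Sum>j<n. ?x i * ?y j)"
    unfolding bil_def
  proof (intro sum_mono)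
    fix i j
    have "?x i * sym_of (\<lambda>_. 1) i j * ?y j = (?x i * ?y j) * sym_of (\<lambda>_. 1) i j" by simp
    also have "\<dots> \<le> (?x i * ?y j) * 1" by (intro mult_left_mono) (auto simp: sym_of_def)
    finally show "?x i * sym_of (\<lambda>_. 1) i j * ?y j \<le> ?x i * ?y j" by simp
  qed
  also have "(\<Sum>i<n. \<Sum>j<n. ?x i * ?y j) = (nrm n x)\<^sup>2 * (nrm n y)\<^sup>2"
    unfolding nrm_sq by (rule sum_product[symmetric])
  also have "\<dots> \<le> 1 * 1" using assms by (intro mult_mono) (auto simp: power_le_one)
  finally show ?thesis by simp
qed

text \<open>Hoeffding's lemma for a centered variable whose range has length 1.\<close>

lemma bernoulli_third_mgf_le:
  fixes t :: real
  shows "measure_pmf.expectation (bernoulli_pmf (1/3)) (\<lambda>c. exp (t * (of_bool c - 1/3))) \<le> exp (t\<^sup>2 / 8)"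
proof -
  have aux: "exp (- h * q) * (1 + q * (exp h - 1)) \<le> exp (h\<^sup>2 / 8)" if "0 \<le> h" "0 \<le> q" for h q :: real
  proof -
    have "1 \<le> exp h" using that by simp
    hence pos: "0 < 1 + q * (exp h - 1)" using that by (intro add_pos_nonneg) auto
    have "exp (- h * q) * (1 + q * (exp h - 1)) = exp (- h * q + ln (1 + q * (exp h - 1)))"
      unfolding exp_add exp_ln[OF pos] ..
    also have "\<dots> \<le> exp (h\<^sup>2 / 8)" using Hoeffdings_lemma_aux[OF that] by (simp only: exp_le_cancel_iff)
    finally show ?thesis .
  qed
  have E: "measure_pmf.expectation (bernoulli_pmf (1/3)) (\<lambda>c. exp (t * (of_bool c - 1/3))) =
      exp (2/3 * t) * (1/3) + exp (- (1/3) * t) * (2/3)"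
    by (subst integral_bernoulli_pmf) (simp_all add: algebra_simps)
  show ?thesis
  proof (cases "0 \<le> t")
    case True
    have e: "exp (2/3 * t) = exp (- t * (1/3)) * exp t" unfolding exp_add[symmetric] by simp
    have e': "exp (- (1/3) * t) = exp (- t * (1/3))" by simp
    have "a * b * (1/3) + a * (2/3) = a * (1 + 1/3 * (b - 1))" for a b :: real
      by (simp add: field_simps)
    hence "exp (2/3 * t) * (1/3) + exp (- (1/3) * t) * (2/3) = exp (- t * (1/3)) * (1 + 1/3 * (exp t - 1))"
      unfolding e e' .
    thus ?thesis unfolding E using aux[OF True, of "1/3"] by simp
  next
    case False
    \<comment> \<open>\<open>Hoeffdings_lemma_aux\<close> needs a nonnegative parameter, so the two
      outcomes swap roles: \<open>- t\<close> for \<open>t\<close> and 2/3 for 1/3.\<close>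
    have e: "exp (- (1/3) * t) = exp (t * (2/3)) * exp (- t)" unfolding exp_add[symmetric] by simp
    have e': "exp (2/3 * t) = exp (t * (2/3))" by (simp add: mult.commute)
    have "a * (1/3) + a * b * (2/3) = a * (1 + 2/3 * (b - 1))" for a b :: real
      by (simp add: field_simps)
    hence "exp (2/3 * t) * (1/3) + exp (- (1/3) * t) * (2/3) = exp (- (- t) * (2/3)) * (1 + 2/3 * (exp (- t) - 1))"
      unfolding e e' by simp
    thus ?thesis unfolding E using aux[of "- t" "2/3"] False by simp
  qed
qed

section \<open>Moments of the dense comparison matrix\<close>

abbreviation third_pmf :: "nat \<Rightarrow> (nat \<times> nat \<Rightarrow> bool) pmf" where
  "third_pmf n \<equiv> edge_pmf n (\<lambda>_. 1/3)"

abbreviation third_mat :: "(nat \<times> nat \<Rightarrow> bool) \<Rightarrow> nat \<Rightarrow> nat \<Rightarrow> real" where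
  "third_mat b \<equiv> sym_of (centered (\<lambda>_. 1/3) b)"

lemma mgf_bil_le:
  assumes "nrm n x \<le> 1" "nrm n y \<le> 1"
  shows "measure_pmf.expectation (third_pmf n) (\<lambda>b. exp (t * bil n (third_mat b) x y)) \<le> exp (t\<^sup>2 / 4)"
proof -
  define a where "a e = x (fst e) * y (snd e) + x (snd e) * y (fst e)" for e
  have a: "(\<Sum>e\<in>edge_set n. (a e)\<^sup>2) \<le> 2" unfolding a_def by (rule sum_edge_coefficients_le[OF assms])
  have "exp (t * bil n (third_mat b) x y) = (\<Prod>e\<in>edge_set n. exp (t * a e * (of_bool (b e) - 1/3)))" for b
    unfolding bil_sym_of exp_sum[OF finite_edge_set, symmetric] sum_distrib_left centered_def a_def
    by (intro arg_cong[of _ _ exp] sum.cong refl) (simp only: mult_ac)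
  hence "measure_pmf.expectation (third_pmf n) (\<lambda>b. exp (t * bil n (third_mat b) x y)) =
      (\<Prod>e\<in>edge_set n. measure_pmf.expectation (bernoulli_pmf (1/3)) (\<lambda>c. exp (t * a e * (of_bool c - 1/3))))"
    using expectation_edge_pmf_prod[of n "\<lambda>_. 1/3" "\<lambda>e c. exp (t * a e * (of_bool c - 1/3))"]
    by (simp only:)
  also have "\<dots> \<le> (\<Prod>e\<in>edge_set n. exp ((t * a e)\<^sup>2 / 8))"
    by (intro prod_mono conjI bernoulli_third_mgf_le Bochner_Integration.integral_nonneg) simp
  also have "\<dots> = exp (t\<^sup>2 / 8 * (\<Sum>e\<in>edge_set n. (a e)\<^sup>2))"
    unfolding exp_sum[OF finite_edge_set, symmetric] sum_distrib_left
    by (simp only: power_mult_distrib times_divide_eq_left)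
  also have "\<dots> \<le> exp (t\<^sup>2 / 8 * 2)"
    unfolding exp_le_cancel_iff by (intro mult_left_mono a) simp
  finally show ?thesis by simp
qed

text \<open>A single term of the exponential series is at most the whole.\<close>

lemma power_le_fact_mult_exp:
  fixes x :: real assumes "0 \<le> x" shows "x ^ m \<le> fact m * exp x"
proof -
  have "x ^ m /\<^sub>R fact m \<le> (\<Sum>k<Suc m. x ^ k /\<^sub>R fact k)"
    by (rule member_le_sum[of m "{..<Suc m}" "\<lambda>k. x ^ k /\<^sub>R fact k"]) (use assms in auto)
  also have "\<dots> \<le> exp x"
    unfolding exp_def by (intro sum_le_suminf summable_exp_generic) (use assms in auto)
  finally show ?thesis by (simp add: field_simps)
qed

lemma moment_bil_le:
  assumes "nrm n x \<le> 1" "nrm n y \<le> 1" and p: "0 < p"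
  shows "measure_pmf.expectation (third_pmf n) (\<lambda>b. (2 * bil n (third_mat b) x y) ^ (2 * p))
    \<le> 2 * (16 * exp 1 * real p) ^ p"
proof -
  let ?E = "measure_pmf.expectation (third_pmf n)"
  let ?Z = "\<lambda>b. bil n (third_mat b) x y"
  \<comment> \<open>With this choice each exponential has expectation at most exp (p / 4), while
    \<open>?t ^ (2 * p)\<close> cancels one of the two factors p^p in the bound for
    \<open>fact (2 * p)\<close>.\<close>
  let ?t = "sqrt (real p)"
  have t: "?t ^ (2 * p) = real p ^ p" by (simp add: power_mult)
  have pw: "real p ^ p * z ^ (2 * p) \<le> fact (2 * p) * (exp (?t * z) + exp (- ?t * z))" for z
  proof -
    have "real p ^ p * z ^ (2 * p) = (?t * z) ^ (2 * p)" by (simp add: power_mult_distrib t)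
    also have "\<dots> = \<bar>?t * z\<bar> ^ (2 * p)" by (simp only: power_mult power2_abs)
    also have "\<dots> \<le> fact (2 * p) * exp \<bar>?t * z\<bar>" by (rule power_le_fact_mult_exp) simp
    also have "exp \<bar>?t * z\<bar> \<le> exp (?t * z) + exp (- ?t * z)" by (cases "0 \<le> ?t * z") simp_all
    finally show ?thesis by simp
  qed
  have "real p ^ p * ?E (\<lambda>b. ?Z b ^ (2 * p)) = ?E (\<lambda>b. real p ^ p * ?Z b ^ (2 * p))" by simp
  also have "\<dots> \<le> ?E (\<lambda>b. fact (2 * p) * (exp (?t * ?Z b) + exp (- ?t * ?Z b)))"
    by (intro integral_mono pw integrable_edge_pmf)
  also have "\<dots> = fact (2 * p) * (?E (\<lambda>b. exp (?t * ?Z b)) + ?E (\<lambda>b. exp (- ?t * ?Z b)))"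
    by simp
  also have "\<dots> \<le> fact (2 * p) * (exp (?t\<^sup>2 / 4) + exp ((- ?t)\<^sup>2 / 4))"
    by (intro mult_left_mono add_mono mgf_bil_le assms) simp
  also have "\<dots> \<le> fact (2 * p) * (2 * exp 1 ^ p)"
  proof (intro mult_left_mono)
    have "exp (real p / 4) \<le> exp (real p * 1)" unfolding exp_le_cancel_iff by simp
    thus "exp (?t\<^sup>2 / 4) + exp ((- ?t)\<^sup>2 / 4) \<le> 2 * exp 1 ^ p"
      unfolding exp_of_nat_mult by simp
  qed simp
  also have "\<dots> \<le> (4 ^ p * (real p ^ p * real p ^ p)) * (2 * exp 1 ^ p)"
  proof (intro mult_right_mono)
    have "(fact (2 * p) :: real) \<le> real ((2 * p) ^ (2 * p))" by (rule fact_le_power)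
    also have "\<dots> = (2 * real p) ^ (2 * p)" by simp
    also have "\<dots> = ((2 * real p)\<^sup>2) ^ p" by (rule power_mult)
    also have "\<dots> = 4 ^ p * (real p ^ p * real p ^ p)"
      unfolding power_mult_distrib[symmetric] by (simp add: power2_eq_square)
    finally show "(fact (2 * p) :: real) \<le> 4 ^ p * (real p ^ p * real p ^ p)" .
  qed simp
  also have "\<dots> = real p ^ p * (2 * (4 ^ p * exp 1 ^ p * real p ^ p))" by (simp only: mult_ac)
  finally have le: "?E (\<lambda>b. ?Z b ^ (2 * p)) \<le> 2 * (4 ^ p * exp 1 ^ p * real p ^ p)"
    using p by (simp only: mult_le_cancel_left_pos zero_less_power of_nat_0_less_iff)
  \<comment> \<open>The factor 2 from the net contributes 4^p; with the 4^p from the factorial this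
    makes the 16.\<close>
  have "?E (\<lambda>b. (2 * ?Z b) ^ (2 * p)) = 2 ^ (2 * p) * ?E (\<lambda>b. ?Z b ^ (2 * p))"
    by (simp add: power_mult_distrib)
  also have "\<dots> \<le> 2 ^ (2 * p) * (2 * (4 ^ p * exp 1 ^ p * real p ^ p))"
    by (intro mult_left_mono le) simp
  also have "\<dots> = 2 * ((2\<^sup>2) ^ p * 4 ^ p * exp 1 ^ p * real p ^ p)" by (simp add: power_mult)
  also have "\<dots> = 2 * (16 * exp 1 * real p) ^ p"
    unfolding power_mult_distrib[symmetric] by simp
  finally show ?thesis .
qed

text \<open>The size bound for the net is \<open>net_const ^ r\<close> with \<open>r = 2 * p\<close>, used for both arguments of the
  bilinear form; \<open>144 = 9 * 16\<close> with \<open>9 ^ p\<close> undoing the scale \<open>1/3\<close> of the comparison matrix.\<close>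
definition net_const :: real where "net_const = 2 ^ 16 * 3"

definition trace_const :: real where "trace_const = 144 * exp 1 * net_const ^ 4"

lemma trace_const_pos: "0 < trace_const"
  by (simp add: trace_const_def net_const_def)

lemma expectation_closed_walk_sum_third_le:
  assumes p: "0 < p"
  shows "measure_pmf.expectation (third_pmf (2 * p)) (\<lambda>b. closed_walk_sum (2 * p) (2 * p) (third_mat b))
    \<le> 4 * real p * (16 * exp 1 * net_const ^ 4 * real p) ^ p"
proof -
  let ?r = "2 * p" and ?N = "net_index (2 * p)"
  let ?E = "measure_pmf.expectation (third_pmf ?r)"
  let ?F = "\<lambda>k l b. (2 * bil ?r (third_mat b) (net_point ?r k) (net_point ?r l)) ^ (2 * p)"
  let ?m = "2 * (16 * exp 1 * real p) ^ p"
  have r: "0 < ?r" using p by simp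
  have sym: "third_mat b i j = third_mat b j i" for b i j by (simp add: sym_of_def)
  have "?E (\<lambda>b. closed_walk_sum ?r (2 * p) (third_mat b)) \<le> ?E (\<lambda>b. real ?r * (\<Sum>k\<in>?N. \<Sum>l\<in>?N. ?F k l b))"
    by (intro integral_mono integrable_edge_pmf closed_walk_sum_le_net[OF sym r])
  also have "\<dots> = real ?r * (\<Sum>k\<in>?N. \<Sum>l\<in>?N. ?E (?F k l))"
    by (subst Bochner_Integration.integral_mult_right_zero, subst Bochner_Integration.integral_sum, simp,
      subst Bochner_Integration.integral_sum, simp, rule refl)
  also have "\<dots> \<le> real ?r * (\<Sum>k\<in>?N. \<Sum>l\<in>?N. ?m)"
    by (intro mult_left_mono sum_mono moment_bil_le nrm_net_point_le r p) simp_all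
  also have "\<dots> = real ?r * (real (card ?N) * real (card ?N) * ?m)" by simp
  also have "\<dots> \<le> real ?r * (net_const ^ ?r * net_const ^ ?r * ?m)"
    using card_net_index[of ?r] unfolding net_const_def
    by (intro mult_left_mono mult_right_mono mult_mono) simp_all
  also have "net_const ^ ?r * net_const ^ ?r = (net_const ^ 4) ^ p"
    unfolding power_add[symmetric] power_mult[symmetric] by (simp add: mult.commute)
  also have "real ?r * ((net_const ^ 4) ^ p * ?m) = 4 * real p * ((16 * exp 1 * real p) ^ p * (net_const ^ 4) ^ p)"
    by simp
  also have "\<dots> = 4 * real p * (16 * exp 1 * net_const ^ 4 * real p) ^ p"
    unfolding power_mult_distrib[symmetric] by (simp only: mult_ac)
  finally show ?thesis .
qed

text \<open>A count obtained through probability. The gain is growth like p^p, where the number of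
  all walks of this length grows like p^(2 p).\<close>

lemma card_doubled_walks_le:
  assumes p: "0 < p"
  shows "real (card {xs\<in>walks (2 * p) (2 * p). doubled_walk xs}) \<le> 4 * real p * (trace_const * real p) ^ p"
proof -
  let ?c = "real (card {xs\<in>walks (2 * p) (2 * p). doubled_walk xs})"
  have "?c = 9 ^ p * ((1/3) ^ (2 * p) * ?c)"
  proof -
    have "(9::real) ^ p * (1/3) ^ (2 * p) = 1"
      unfolding power_mult power_mult_distrib[symmetric] by (simp add: power2_eq_square)
    thus ?thesis by (simp only: mult.assoc[symmetric] mult_1_left)
  qed
  also have "\<dots> \<le> 9 ^ p * (4 * real p * (16 * exp 1 * net_const ^ 4 * real p) ^ p)"
    by (intro mult_left_mono order_trans[OF expectation_closed_walk_sum_third_ge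
      expectation_closed_walk_sum_third_le[OF p]]) simp
  also have "\<dots> = 4 * real p * (9 ^ p * (16 * exp 1 * net_const ^ 4 * real p) ^ p)" by simp
  also have "\<dots> = 4 * real p * (trace_const * real p) ^ p"
  proof -
    have "9 * (16 * exp 1 * net_const ^ 4 * real p) = trace_const * real p" by (simp add: trace_const_def)
    thus ?thesis by (simp only: power_mult_distrib[symmetric])
  qed
  finally show ?thesis .
qed

section \<open>From the expected trace to the operator norm\<close>

lemma expectation_closed_walk_sum_bound:
  assumes \<theta>: "\<And>e. e \<in> edge_set n \<Longrightarrow> 0 \<le> \<theta> e \<and> \<theta> e \<le> \<rho>" and \<rho>: "0 \<le> \<rho>" "\<rho> \<le> 1"
    and p: "0 < p" "real n * \<rho> \<le> real p"
  shows "measure_pmf.expectation (edge_pmf n \<theta>) (\<lambda>b. closed_walk_sum n (2 * p) (sym_of (centered \<theta> b)))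
    \<le> 4 * real n * (trace_const * real p) ^ p"
proof -
  have "measure_pmf.expectation (edge_pmf n \<theta>) (\<lambda>b. closed_walk_sum n (2 * p) (sym_of (centered \<theta> b)))
    \<le> (\<Sum>xs\<in>{xs\<in>walks n (2 * p). doubled_walk xs}. \<rho> ^ card (set (uedges xs)))"
    by (rule expectation_closed_walk_sum_le[OF \<theta> \<rho>])
  also have "\<dots> \<le> real n / real p * real (card {ys\<in>walks (2 * p) (2 * p). doubled_walk ys})"
    by (rule walk_comparison[OF p(1) \<rho> p(2)])
  also have "\<dots> \<le> real n / real p * (4 * real p * (trace_const * real p) ^ p)"
    by (intro mult_left_mono card_doubled_walks_le p) simp
  also have "\<dots> = 4 * real n * (trace_const * real p) ^ p" using p(1) by (simp add: field_simps)
  finally show ?thesis .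
qed

text \<open>The 3 pays for rounding \<rho> n up to an integer; exp 6 provides the margin exp (-6 p)
  in Markov's inequality.\<close>

definition norm_const :: real where "norm_const = sqrt (3 * (trace_const * exp 6))"

lemma norm_const_nonneg: "0 \<le> norm_const"
  using trace_const_pos by (simp add: norm_const_def)

theorem centered_adjacency_opbd:
  assumes \<theta>: "\<And>e. e \<in> edge_set n \<Longrightarrow> 0 \<le> \<theta> e \<and> \<theta> e \<le> \<rho>" and \<rho>: "0 < \<rho>" "\<rho> \<le> 1"
    and n: "1 \<le> n" and ln: "ln (real n) \<le> \<rho> * real n"
  shows "measure_pmf.prob (edge_pmf n \<theta>)
    {b. opbd n (sym_of (centered \<theta> b)) (norm_const * sqrt (\<rho> * real n))} > 1 - 1 / real n"
\<comment> \<open>At \<open>n = 1\<close> the logarithm is 0 and gives no lower bound on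
  \<open>\<rho> * n\<close>, but there the centered matrix is zero.\<close>
proof (cases "n = 1")
  case True
  have "opbd n (sym_of g) (norm_const * sqrt (\<rho> * real n))" for g
    using True \<rho> trace_const_pos by (simp add: opbd_def bil_def sym_of_def norm_const_def)
  thus ?thesis using True by simp
next
  case False
  hence n2: "2 \<le> n" using n by simp
  define p where "p = nat \<lceil>\<rho> * real n\<rceil>"
  define B where "B = trace_const * exp 6"
  have B: "0 < B" using trace_const_pos by (simp add: B_def)
  \<comment> \<open>Rounding up adds less than 1, which is now at most 2 \<rho> n; hence
    \<open>p\<close> is at most 3 \<rho> n.\<close>
  have \<rho>n: "1/2 \<le> \<rho> * real n"
  proof -
    have "ln 2 \<le> ln (real n)" using n2 by simp
    moreover have "(1/2::real) \<le> ln 2" using ln2_ge_two_thirds by simp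
    ultimately show ?thesis using ln by linarith
  qed
  have p: "0 < p" "\<rho> * real n \<le> real p" "real p \<le> 3 * (\<rho> * real n)"
    unfolding p_def using \<rho>n by linarith+
  let ?M = "edge_pmf n \<theta>"
  let ?X = "\<lambda>b. sym_of (centered \<theta> b)"
  let ?T = "\<lambda>b. closed_walk_sum n (2 * p) (?X b)"
  have sym: "?X b i j = ?X b j i" for b i j by (simp add: sym_of_def)
  have Bp: "0 < (B * real p) ^ p" using B p by simp
  have "measure_pmf.prob ?M {b \<in> space ?M. (B * real p) ^ p \<le> ?T b} \<le>
      measure_pmf.expectation ?M ?T / (B * real p) ^ p"
  proof (rule integral_Markov_inequality_measure[where A = "{}"])
    show "AE b in ?M. 0 \<le> ?T b"
      unfolding closed_walk_sum_eq_frobenius[OF sym] by (intro AE_I2 sum_nonneg) simp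
  qed (use Bp in simp_all)
  also have "\<dots> \<le> 4 * real n * (trace_const * real p) ^ p / (B * real p) ^ p"
  proof (intro divide_right_mono expectation_closed_walk_sum_bound)
    show "0 \<le> \<theta> e \<and> \<theta> e \<le> \<rho>" if "e \<in> edge_set n" for e by (rule \<theta>[OF that])
  qed (use \<rho> p Bp in \<open>simp_all add: mult.commute\<close>)
  also have "\<dots> = 4 * real n * inverse (exp 6 ^ p)"
    using trace_const_pos p(1) unfolding B_def by (simp add: power_mult_distrib field_simps)
  \<comment> \<open>From p \<ge> \<rho> n \<ge> ln n. What remains is 4 / n^5, which is below 1 / n
    once n is at least 2.\<close>
  also have "\<dots> \<le> 4 * real n * inverse (real n ^ 6)"
  proof (intro mult_left_mono le_imp_inverse_le)
    have "real n ^ 6 = exp (ln (real n)) ^ 6" using n by simp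
    also have "\<dots> \<le> exp (real p) ^ 6"
    proof (rule power_mono)
      show "exp (ln (real n)) \<le> exp (real p)" using ln p(2) unfolding exp_le_cancel_iff by linarith
    qed simp
    also have "\<dots> = exp 6 ^ p" unfolding exp_of_nat_mult[symmetric] by (simp add: mult.commute)
    finally show "real n ^ 6 \<le> exp 6 ^ p" .
  qed (use n in simp_all)
  also have "\<dots> < 1 / real n"
  proof -
    have "(2::real) ^ 4 \<le> real n ^ 4" using n2 by (intro power_mono) simp_all
    hence "4 * (real n * real n) < real n ^ 4 * (real n * real n)"
      using n2 by (intro mult_strict_right_mono) simp_all
    thus ?thesis using n by (simp add: field_simps power_numeral_reduce)
  qed
  finally have bad: "measure_pmf.prob ?M {b. (B * real p) ^ p \<le> ?T b} < 1 / real n" by simp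
  have "{b. \<not> (B * real p) ^ p \<le> ?T b} \<subseteq> {b. opbd n (?X b) (norm_const * sqrt (\<rho> * real n))}"
  proof clarify
    fix b assume b: "\<not> (B * real p) ^ p \<le> ?T b"
    obtain s where s: "opbd n (?X b) s" "s ^ (2 * p) \<le> ?T b"
      using closed_walk_sum_ge_opbd[of "?X b" p n, OF sym p(1)] by blast
    have "s ^ (2 * p) < (B * real p) ^ p" using s(2) b by linarith
    also have "(B * real p) ^ p = ((sqrt (B * real p))\<^sup>2) ^ p" using B by simp
    also have "\<dots> = sqrt (B * real p) ^ (2 * p)" by (rule power_mult[symmetric])
    finally have "s < sqrt (B * real p)" using B by (intro power_less_imp_less_base[of s "2 * p"]) simp_all
    also have "\<dots> \<le> sqrt (B * (3 * (\<rho> * real n)))"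
      using B p(3) by (intro real_sqrt_le_mono mult_left_mono) simp_all
    also have "\<dots> = norm_const * sqrt (\<rho> * real n)"
      unfolding norm_const_def B_def[symmetric] real_sqrt_mult[symmetric] by (simp only: mult_ac)
    finally show "opbd n (?X b) (norm_const * sqrt (\<rho> * real n))"
      using opbd_mono[OF s(1)] by simp
  qed
  hence "measure_pmf.prob ?M {b. \<not> (B * real p) ^ p \<le> ?T b} \<le>
      measure_pmf.prob ?M {b. opbd n (?X b) (norm_const * sqrt (\<rho> * real n))}"
    by (intro measure_pmf.finite_measure_mono) simp_all
  moreover have "measure_pmf.prob ?M {b. \<not> (B * real p) ^ p \<le> ?T b} =
      1 - measure_pmf.prob ?M {b. (B * real p) ^ p \<le> ?T b}"
    using measure_pmf.prob_compl[of "{b. (B * real p) ^ p \<le> ?T b}" ?M] by (simp add: Compl_eq[symmetric] Collect_neg_eq Compl_eq_Diff_UNIV)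
  ultimately show ?thesis using bad by linarith
qed

section \<open>Block matrices\<close>

text \<open>The rows of \<open>P\<close> are constant on classes, so the projection onto such
  vectors fixes \<open>P\<close> from the right. Only labels that occur index the family, which
  keeps the normalisers positive.\<close>

lemma orthonormal_class_indicators:
  fixes z :: "nat \<Rightarrow> nat" and Q :: "nat \<Rightarrow> nat \<Rightarrow> real" and n :: nat
  defines "f \<equiv> \<lambda>a i. of_bool (z i = a) / sqrt (card {i. i < n \<and> z i = a})"
  defines "P \<equiv> \<lambda>i j. Q (z i) (z j)"
  shows "orthonormal_on n (z ` {..<n}) f"
    and "i < n \<Longrightarrow> j < n \<Longrightarrow> P i j = (\<Sum>a\<in>z ` {..<n}. app n P (f a) i * f a j)"
proof -
  define N where "N a = real (card {i. i < n \<and> z i = a})" for a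
  have fN: "f a i = of_bool (z i = a) / sqrt (N a)" for a i by (simp add: f_def N_def)
  have N: "0 < N a" if "a \<in> z ` {..<n}" for a
  proof -
    obtain i where "i < n" "z i = a" using \<open>a \<in> z ` {..<n}\<close> by blast
    hence "{i. i < n \<and> z i = a} \<noteq> {}" by blast
    thus ?thesis by (simp add: N_def card_gt_0_iff)
  qed
  have sum_class: "(\<Sum>i<n. of_bool (z i = a)) = N a" for a
  proof -
    have "{..<n} \<inter> {i. z i = a} = {i. i < n \<and> z i = a}" by blast
    thus ?thesis unfolding N_def by (simp only: sum_of_bool_eq finite_lessThan)
  qed
  show "orthonormal_on n (z ` {..<n}) f"
    unfolding orthonormal_on_def
  proof (intro ballI)
    fix a b assume a: "a \<in> z ` {..<n}" and "b \<in> z ` {..<n}"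
    show "ip n (f a) (f b) = of_bool (a = b)"
    proof (cases "a = b")
      case True
      have "ip n (f a) (f a) = (\<Sum>i<n. of_bool (z i = a) / N a)"
        unfolding ip_def fN using N[OF a] by (intro sum.cong refl) simp
      also have "\<dots> = N a / N a" by (simp only: sum_divide_distrib[symmetric] sum_class)
      also have "\<dots> = 1" using N[OF a] by simp
      finally show ?thesis using True by simp
    next
      case False
      hence "ip n (f a) (f b) = 0" unfolding ip_def fN by (intro sum.neutral) auto
      thus ?thesis using False by simp
    qed
  qed
  assume ij: "i < n" "j < n"
  have ap: "app n P (f a) i = Q (z i) a * sqrt (N a)" if "a \<in> z ` {..<n}" for a
  proof -
    have "app n P (f a) i = (\<Sum>m<n. Q (z i) a / sqrt (N a) * of_bool (z m = a))"
      unfolding app_def P_def fN by (intro sum.cong refl) simp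
    also have "\<dots> = Q (z i) a / sqrt (N a) * N a" by (simp only: sum_distrib_left[symmetric] sum_class)
    also have "\<dots> = Q (z i) a * (N a / sqrt (N a))" by simp
    also have "N a / sqrt (N a) = sqrt (N a)" by (rule real_div_sqrt) (simp add: N_def)
    finally show ?thesis .
  qed
  have "(\<Sum>a\<in>z ` {..<n}. app n P (f a) i * f a j) = (\<Sum>a\<in>z ` {..<n}. if a = z j then Q (z i) a else 0)"
  proof (intro sum.cong refl)
    fix a assume a: "a \<in> z ` {..<n}"
    show "app n P (f a) i * f a j = (if a = z j then Q (z i) a else 0)"
      unfolding ap[OF a] fN using N[OF a] by simp
  qed
  also have "\<dots> = P i j" using ij by (simp add: P_def sum.delta)
  finally show "P i j = (\<Sum>a\<in>z ` {..<n}. app n P (f a) i * f a j)" ..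
qed

lemma block_matrices_boundedE:
  assumes "\<Theta> \<in> block_matrices_bounded n k \<rho>"
  obtains z :: "nat \<Rightarrow> nat" and Q where "\<Theta> \<in> carrier_mat n n"
    "\<forall>i<n. z i < k"
    "\<forall>a<k. \<forall>b<k. Q $$ (a, b) = Q $$ (b, a)"
    "\<forall>a<k. \<forall>b<k. Q $$ (a, b) \<in> {0..1}"
    "\<forall>i<n. \<forall>j<n. i \<noteq> j \<longrightarrow> \<Theta> $$ (i, j) = Q $$ (z i, z j)"
    "\<forall>i<n. \<Theta> $$ (i, i) = 0"
    "\<forall>i<n. \<forall>j<n. \<bar>\<Theta> $$ (i, j)\<bar> \<le> \<rho>"
proof -
  have b: "\<Theta> \<in> block_matrices n k" and r: "\<forall>i<n. \<forall>j<n. \<bar>\<Theta> $$ (i, j)\<bar> \<le> \<rho>"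
    using assms unfolding block_matrices_bounded_def mem_Collect_eq by (rule conjunct1, rule conjunct2)
  from b have "\<exists>(z :: nat \<Rightarrow> nat) Q. (\<forall>i<n. z i < k) \<and> Q \<in> carrier_mat k k \<and> Q\<^sup>T = Q \<and>
      (\<forall>a<k. \<forall>b<k. Q $$ (a, b) \<in> {0..1}) \<and>
      (\<forall>i<n. \<forall>j<n. i \<noteq> j \<longrightarrow> \<Theta> $$ (i, j) = Q $$ (z i, z j)) \<and> (\<forall>i<n. \<Theta> $$ (i, i) = 0)"
    unfolding block_matrices_def mem_Collect_eq by (rule conjunct2)
  then obtain z :: "nat \<Rightarrow> nat" and Q where z: "\<forall>i<n. z i < k" and Qc: "Q \<in> carrier_mat k k" and Qs: "Q\<^sup>T = Q"
    and Q: "\<forall>a<k. \<forall>b<k. Q $$ (a, b) \<in> {0..1}"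
    and e: "\<forall>i<n. \<forall>j<n. i \<noteq> j \<longrightarrow> \<Theta> $$ (i, j) = Q $$ (z i, z j)" and d: "\<forall>i<n. \<Theta> $$ (i, i) = 0"
    by (elim exE conjE)
  show thesis
  proof (rule that[of z Q])
    show "\<Theta> \<in> carrier_mat n n" using b unfolding block_matrices_def by simp
    show "\<forall>a<k. \<forall>b<k. Q $$ (a, b) = Q $$ (b, a)"
    proof (intro allI impI)
      fix a b assume ab: "a < k" "b < k"
      have "Q $$ (a, b) = Q\<^sup>T $$ (a, b)" by (simp only: Qs)
      also have "\<dots> = Q $$ (b, a)" using ab Qc by simp
      finally show "Q $$ (a, b) = Q $$ (b, a)" .
    qed
  qed (rule z Q e d r)+
qed

text \<open>In 2 (w + 1) \<le> c the \<open>w\<close> covers the noise and the 1 covers the diagonal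
  by which \<open>P\<close> and \<Theta> differ, because \<rho> \<le> sqrt (\<rho> n). The 8 comes
  from the Frobenius bound; the operator norm is first bounded with 2 in its place.\<close>

lemma hard_threshold_bounds:
  assumes A: "A \<in> carrier_mat n n" and \<Theta>: "\<Theta> \<in> block_matrices_bounded n k \<rho>"
    and k: "1 \<le> k" and n: "1 \<le> n" and \<rho>: "0 < \<rho>" "\<rho> \<le> 1"
    and w: "opbd n (\<lambda>i j. A $$ (i, j) - \<Theta> $$ (i, j)) (w * sqrt (\<rho> * real n))"
    and c: "0 \<le> w" "2 * (w + 1) \<le> c"
  defines "B \<equiv> hard_threshold (c * sqrt (\<rho> * real n)) A - \<Theta>"
  shows "1 / real n * frobenius_norm B \<le> 8 * c * sqrt (\<rho> * real k / real n)"
    and "cut_norm B \<le> 1 / real n * op_norm B"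
    and "1 / real n * op_norm B \<le> 8 * c * sqrt (\<rho> / real n)"
proof -
  let ?q = "sqrt (\<rho> * real n)"
  define lam where "lam = c * ?q"
  have q: "0 < ?q" "?q\<^sup>2 = \<rho> * real n" using \<rho> n by auto
  have lam: "0 < lam" using q c by (simp add: lam_def)
  have \<rho>q: "\<rho> \<le> ?q"
  proof (rule real_le_rsqrt)
    have "\<rho> * \<rho> \<le> \<rho> * real n" using \<rho> n by (intro mult_left_mono) simp_all
    thus "\<rho>\<^sup>2 \<le> \<rho> * real n" by (simp add: power2_eq_square)
  qed
  obtain z :: "nat \<Rightarrow> nat" and Q where \<Theta>c: "\<Theta> \<in> carrier_mat n n" and z': "\<forall>i<n. z i < k"
    and Qs': "\<forall>a<k. \<forall>b<k. Q $$ (a, b) = Q $$ (b, a)"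
    and "\<forall>a<k. \<forall>b<k. Q $$ (a, b) \<in> {0..1}"
    and \<Theta>Q': "\<forall>i<n. \<forall>j<n. i \<noteq> j \<longrightarrow> \<Theta> $$ (i, j) = Q $$ (z i, z j)"
    and \<Theta>0': "\<forall>i<n. \<Theta> $$ (i, i) = 0" and \<Theta>\<rho>': "\<forall>i<n. \<forall>j<n. \<bar>\<Theta> $$ (i, j)\<bar> \<le> \<rho>"
    by (rule block_matrices_boundedE[OF \<Theta>], rule that, assumption+)
  note z = z'[rule_format] and Qs = Qs'[rule_format] and \<Theta>Q = \<Theta>Q'[rule_format]
    and \<Theta>0 = \<Theta>0'[rule_format] and \<Theta>\<rho> = \<Theta>\<rho>'[rule_format]
  \<comment> \<open>The diagonal entry of \<open>Q\<close> of a class with a single vertex is not seen by \<open>\<Theta>\<close> and may exceed \<open>\<rho>\<close>.\<close>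
  define Q' where "Q' a b = (if \<bar>Q $$ (a, b)\<bar> \<le> \<rho> then Q $$ (a, b) else 0)" for a b
  define P where "P = (\<lambda>i j. Q' (z i) (z j))"
  define D where "D i = Q' (z i) (z i)" for i
  have Q': "\<bar>Q' a b\<bar> \<le> \<rho>" for a b using \<rho> by (simp add: Q'_def)
  have Psym: "P i j = P j i" if "i < n" "j < n" for i j
    using Qs[OF z z, OF that] by (simp add: P_def Q'_def)
  have P\<Theta>: "P i j = \<Theta> $$ (i, j) + (if i = j then D i else 0)" if "i < n" "j < n" for i j
    using \<Theta>\<rho>[OF that] \<Theta>Q[OF that] \<Theta>0[OF that(1)] by (cases "i = j") (simp_all add: P_def D_def Q'_def)
  let ?K = "z ` {..<n}"
  define f where "f = (\<lambda>a i. of_bool (z i = a) / sqrt (card {i. i < n \<and> z i = a}))"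
  have K: "finite ?K" "orthonormal_on n ?K f"
    using orthonormal_class_indicators(1)[of n z] unfolding f_def by auto
  have P1: "P i j = (\<Sum>a\<in>?K. app n P (f a) i * f a j)" if "i < n" "j < n" for i j
    using orthonormal_class_indicators(2)[OF that, of Q' z] unfolding P_def f_def .
  have P2: "P i j = (\<Sum>a\<in>?K. f a i * app n (flip_mat P) (f a) j)" if "i < n" "j < n" for i j
  proof -
    have "app n (flip_mat P) (f a) j = app n P (f a) j" for a
      unfolding app_def flip_mat_def using that by (intro sum.cong refl) (simp add: Psym)
    thus ?thesis using P1[OF that(2,1)] Psym[OF that] by (simp add: mult.commute)
  qed
  have cardK: "card ?K \<le> k"
  proof -
    have "?K \<subseteq> {..<k}" using z by auto
    hence "card ?K \<le> card {..<k}" by (intro card_mono) simp_all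
    thus ?thesis by simp
  qed
  obtain r :: nat and s u v where orth: "orthonormal_on n {..<r} u" "orthonormal_on n {..<r} v"
    and s': "\<forall>j<r. 0 < s j"
    and Aeq': "\<forall>i<n. \<forall>j<n. A $$ (i, j) = rank_one_sum {..<r} s u v i j"
    and Tc: "hard_threshold lam A \<in> carrier_mat n n"
    and T': "\<forall>i<n. \<forall>j<n. hard_threshold lam A $$ (i, j) = rank_one_sum {j. j < r \<and> lam \<le> s j} s u v i j"
    by (rule hard_thresholdE[OF A, of lam], rule that, assumption+)
  note s = s'[rule_format] and Aeq = Aeq'[rule_format] and T = T'[rule_format]
  define S where "S = rank_one_sum {j. j < r \<and> lam \<le> s j} s u v"
  have "opbd n (\<lambda>i j. (A $$ (i, j) - \<Theta> $$ (i, j)) - (if i = j then D i else 0)) (w * ?q + \<rho>)"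
    by (rule opbd_diff[OF w opbd_diag]) (use \<rho> Q' in \<open>simp_all add: D_def\<close>)
  also have "opbd n (\<lambda>i j. (A $$ (i, j) - \<Theta> $$ (i, j)) - (if i = j then D i else 0)) (w * ?q + \<rho>) =
      opbd n (\<lambda>i j. A $$ (i, j) - P i j) (w * ?q + \<rho>)"
    by (rule opbd_cong) (simp add: P\<Theta>)
  finally have AP: "opbd n (\<lambda>i j. A $$ (i, j) - P i j) (w * ?q + \<rho>)" .
  have "2 * (w * ?q + \<rho>) \<le> 2 * (w + 1) * ?q" using \<rho>q by (simp add: algebra_simps)
  also have "\<dots> \<le> lam" unfolding lam_def using c q by (intro mult_right_mono) simp_all
  finally have wl: "2 * (w * ?q + \<rho>) \<le> lam" .
  note det = hard_threshold_deterministic[where A = "\<lambda>i j. A $$ (i, j)", OF orth s Aeq AP wl lam K P1 P2,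
    folded S_def]
  have Bc: "B \<in> carrier_mat n n" unfolding B_def lam_def[symmetric] using \<Theta>c by (rule minus_carrier_mat)
  have Bij: "B $$ (i, j) = S i j - \<Theta> $$ (i, j)" if "i < n" "j < n" for i j
    unfolding B_def lam_def[symmetric] S_def using Tc \<Theta>c that by (simp add: T)
  have "opbd n (\<lambda>i j. (S i j - A $$ (i, j)) + (A $$ (i, j) - \<Theta> $$ (i, j))) (lam + w * ?q)"
    by (rule opbd_add[OF det(1) w])
  also have "opbd n (\<lambda>i j. (S i j - A $$ (i, j)) + (A $$ (i, j) - \<Theta> $$ (i, j))) (lam + w * ?q) =
      opbd n (\<lambda>i j. B $$ (i, j)) (lam + w * ?q)"
    by (rule opbd_cong) (simp add: Bij)
  finally have Bop: "opbd n (\<lambda>i j. B $$ (i, j)) (2 * lam)"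
  proof (rule opbd_mono)
    have "0 \<le> w * ?q" using c q by (intro mult_nonneg_nonneg) linarith+
    thus "lam + w * ?q \<le> 2 * lam" using wl \<rho> unfolding distrib_left by linarith
  qed
  have qn: "1 / real n * ?q = sqrt (\<rho> / real n)"
    using n by (simp add: real_sqrt_mult real_sqrt_divide field_simps)
  show "cut_norm B \<le> 1 / real n * op_norm B" by (rule cut_norm_le_op_norm[OF Bc Bop]) (use n in simp)
  have "1 / real n * op_norm B \<le> 1 / real n * (2 * lam)"
    by (intro mult_left_mono op_norm_le[OF Bc Bop]) simp
  also have "\<dots> = 2 * c * (1 / real n * ?q)" by (simp add: lam_def)
  also have "\<dots> \<le> 8 * c * (1 / real n * ?q)" using c q by (intro mult_right_mono) simp_all
  finally show "1 / real n * op_norm B \<le> 8 * c * sqrt (\<rho> / real n)" by (simp only: qn)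
  have "(\<Sum>i<n. \<Sum>j<n. (B $$ (i, j))\<^sup>2) \<le>
      (\<Sum>i<n. \<Sum>j<n. 2 * (S i j - P i j)\<^sup>2 + (if i = j then 2 * \<rho>\<^sup>2 else 0))"
  proof (intro sum_mono)
    fix i j assume "i \<in> {..<n}" "j \<in> {..<n}"
    hence ij: "i < n" "j < n" by auto
    have sq: "(x + y)\<^sup>2 \<le> 2 * x\<^sup>2 + 2 * y\<^sup>2" for x y :: real
      using sum_squares_bound[of x y] by (simp add: power2_sum)
    have "B $$ (i, j) = (S i j - P i j) + (if i = j then D i else 0)" by (simp add: Bij P\<Theta> ij)
    hence "(B $$ (i, j))\<^sup>2 \<le> 2 * (S i j - P i j)\<^sup>2 + 2 * (if i = j then D i else 0)\<^sup>2"
      by (simp only: sq)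
    also have "2 * (if i = j then D i else 0)\<^sup>2 \<le> (if i = j then 2 * \<rho>\<^sup>2 else 0)"
    proof -
      have "(D i)\<^sup>2 \<le> \<rho>\<^sup>2" unfolding abs_le_square_iff[symmetric] using Q' \<rho> by (simp add: D_def)
      thus ?thesis by (cases "i = j") simp_all
    qed
    finally show "(B $$ (i, j))\<^sup>2 \<le> 2 * (S i j - P i j)\<^sup>2 + (if i = j then 2 * \<rho>\<^sup>2 else 0)" by simp
  qed
  also have "\<dots> = 2 * (\<Sum>i<n. \<Sum>j<n. (S i j - P i j)\<^sup>2) + real n * (2 * \<rho>\<^sup>2)"
    by (simp add: sum.distrib sum_distrib_left)
  also have "\<dots> \<le> 2 * (24 * real k * lam\<^sup>2) + real n * (2 * \<rho>\<^sup>2)"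
  proof -
    have "24 * real (card ?K) * lam\<^sup>2 \<le> 24 * real k * lam\<^sup>2"
      using cardK by (intro mult_right_mono mult_left_mono) simp_all
    thus ?thesis using det(2) by linarith
  qed
  \<comment> \<open>The diagonal adds 2 n \<rho>^2, at most 2 \<rho> n since \<rho> \<le> 1, and
    this is at most 2 \<open>lam\<close>^2 since \<open>c\<close> is at least 2.\<close>
  also have "\<dots> \<le> 48 * (real k * lam\<^sup>2) + 2 * (real k * lam\<^sup>2)"
  proof -
    have "2 \<le> c" using c unfolding distrib_left by linarith
    hence "1 * ?q \<le> lam" unfolding lam_def using q by (intro mult_right_mono) simp_all
    hence "?q\<^sup>2 \<le> lam\<^sup>2" using q by (intro power_mono) simp_all
    moreover have "\<rho> * (real n * \<rho>) \<le> 1 * (real n * \<rho>)" using \<rho> by (intro mult_right_mono) simp_all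
    hence "real n * \<rho>\<^sup>2 \<le> \<rho> * real n" by (simp add: power2_eq_square mult_ac)
    moreover have "1 * lam\<^sup>2 \<le> real k * lam\<^sup>2" using k by (intro mult_right_mono) simp_all
    ultimately show ?thesis using q(2) by linarith
  qed
  \<comment> \<open>50 is rounded up to a perfect square.\<close>
  also have "\<dots> \<le> 64 * (real k * lam\<^sup>2)" by simp
  also have "\<dots> = (8 * lam * sqrt (real k))\<^sup>2" by (simp add: power_mult_distrib)
  finally have "frobenius_norm B \<le> 8 * lam * sqrt (real k)"
    unfolding frobenius_norm_def carrier_matD[OF Bc] using lam by (intro real_le_lsqrt) simp_all
  hence "1 / real n * frobenius_norm B \<le> 1 / real n * (8 * lam * sqrt (real k))"
    by (intro mult_left_mono) simp_all
  also have "\<dots> = 8 * c * (1 / real n * ?q * sqrt (real k))" by (simp add: lam_def)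
  also have "1 / real n * ?q * sqrt (real k) = sqrt (\<rho> * real k / real n)"
    unfolding qn by (simp add: real_sqrt_mult[symmetric])
  finally show "1 / real n * frobenius_norm B \<le> 8 * c * sqrt (\<rho> * real k / real n)" .
qed

theorem proposition4:
  shows "\<exists>c0::real. c0 > 0 \<and> (\<forall>c\<ge>c0. \<exists>C::real. C > 0 \<and>
    (\<forall>(n::nat) (\<rho>::real) (lam::real).
      n \<ge> 1 \<and> 0 < \<rho> \<and> \<rho> \<le> 1 \<and> \<rho> \<ge> ln (real n) / real n \<and> lam = c * sqrt (\<rho> * real n) \<longrightarrow>
      (\<forall>k \<in> {1..n}. \<forall>\<Theta>0 \<in> block_matrices_bounded n k \<rho>.
        measure_pmf.prob (inhomogeneous_random_graph n \<Theta>0)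
          {A. 1 / real n * frobenius_norm (hard_threshold lam A - \<Theta>0) \<le> C * sqrt (\<rho> * real k / real n) \<and>
              cut_norm (hard_threshold lam A - \<Theta>0) \<le> 1 / real n * op_norm (hard_threshold lam A - \<Theta>0) \<and>
              1 / real n * op_norm (hard_threshold lam A - \<Theta>0) \<le> C * sqrt (\<rho> / real n)}
        > 1 - 1 / real n)))"
\<comment> \<open>Twice the noise bound plus 1 for the diagonal: the threshold has to be at least
  twice the perturbation of \<open>P\<close>.\<close>
proof (rule exI[of _ "2 * (norm_const + 1)"], rule conjI, goal_cases)
  case 1
  show ?case using norm_const_nonneg by simp
next
  case 2
  note nc = norm_const_nonneg
  show ?case
  proof (intro allI impI, rule_tac x = "8 * c" in exI, intro conjI allI impI ballI; (elim conjE)?)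
    fix c assume c: "2 * (norm_const + 1) \<le> c"
    thus "0 < 8 * c" using nc unfolding distrib_left by linarith
    fix n :: nat and \<rho> lam :: real and k and \<Theta> :: "real mat"
    assume n: "1 \<le> n" and \<rho>: "0 < \<rho>" "\<rho> \<le> 1" and ln: "ln (real n) / real n \<le> \<rho>"
      and lam: "lam = c * sqrt (\<rho> * real n)" and k: "k \<in> {1..n}" and \<Theta>: "\<Theta> \<in> block_matrices_bounded n k \<rho>"
    let ?G = "{A. 1 / real n * frobenius_norm (hard_threshold lam A - \<Theta>) \<le> 8 * c * sqrt (\<rho> * real k / real n) \<and>
              cut_norm (hard_threshold lam A - \<Theta>) \<le> 1 / real n * op_norm (hard_threshold lam A - \<Theta>) \<and>
              1 / real n * op_norm (hard_threshold lam A - \<Theta>) \<le> 8 * c * sqrt (\<rho> / real n)}"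
    let ?\<theta> = "\<lambda>e. \<Theta> $$ e"
    let ?H = "{b. opbd n (sym_of (centered ?\<theta> b)) (norm_const * sqrt (\<rho> * real n))}"
    obtain z :: "nat \<Rightarrow> nat" and Q where "\<Theta> \<in> carrier_mat n n" and z': "\<forall>i<n. z i < k"
      and Qs': "\<forall>a<k. \<forall>b<k. Q $$ (a, b) = Q $$ (b, a)"
      and Q01': "\<forall>a<k. \<forall>b<k. Q $$ (a, b) \<in> {0..1}"
      and \<Theta>Q': "\<forall>i<n. \<forall>j<n. i \<noteq> j \<longrightarrow> \<Theta> $$ (i, j) = Q $$ (z i, z j)"
      and \<Theta>0': "\<forall>i<n. \<Theta> $$ (i, i) = 0" and \<Theta>\<rho>': "\<forall>i<n. \<forall>j<n. \<bar>\<Theta> $$ (i, j)\<bar> \<le> \<rho>"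
      by (rule block_matrices_boundedE[OF \<Theta>], rule that, assumption+)
    note z = z'[rule_format] and Qs = Qs'[rule_format] and \<Theta>Q = \<Theta>Q'[rule_format]
      and Q01 = Q01'[rule_format] and \<Theta>0 = \<Theta>0'[rule_format] and \<Theta>\<rho> = \<Theta>\<rho>'[rule_format]
    have \<theta>: "0 \<le> ?\<theta> e \<and> ?\<theta> e \<le> \<rho>" if "e \<in> edge_set n" for e
    proof -
      obtain i j where e: "e = (i, j)" "i < j" "j < n"
        using \<open>e \<in> edge_set n\<close> unfolding edge_set_def by blast
      hence "\<Theta> $$ (i, j) \<in> {0..1}" using \<Theta>Q[of i j] Q01 z by simp
      thus ?thesis using \<Theta>\<rho>[of i j] e by simp
    qed
    \<comment> \<open>\<open>sym_of\<close> reads only entries above the diagonal, so identifying it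
      with the full difference of matrices uses the symmetry of \<Theta>.\<close>
    have \<Theta>sym: "\<Theta> $$ (i, j) = \<Theta> $$ (j, i)" if "i < n" "j < n" "i \<noteq> j" for i j
      using Qs[OF z z, OF that(1,2)] \<Theta>Q[OF that] \<Theta>Q[OF that(2,1)] that(3) by simp
    \<comment> \<open>Once the noise has small norm all three bounds are deterministic, so they hold
      simultaneously on one event without a union bound.\<close>
    have "?H \<subseteq> adjacency_mat n -` ?G"
    proof
      fix b assume b: "b \<in> ?H"
      have A: "adjacency_mat n b \<in> carrier_mat n n" by (simp add: adjacency_mat_def)
      have "sym_of (centered ?\<theta> b) i j = adjacency_mat n b $$ (i, j) - \<Theta> $$ (i, j)" if "i < n" "j < n" for i j
        using that \<Theta>sym[of i j] \<Theta>0[of i] by (cases i j rule: linorder_cases)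
          (simp_all add: sym_of_def centered_def adjacency_mat_def)
      hence "opbd n (sym_of (centered ?\<theta> b)) (norm_const * sqrt (\<rho> * real n)) =
          opbd n (\<lambda>i j. adjacency_mat n b $$ (i, j) - \<Theta> $$ (i, j)) (norm_const * sqrt (\<rho> * real n))"
        by (rule opbd_cong)
      with b have w: "opbd n (\<lambda>i j. adjacency_mat n b $$ (i, j) - \<Theta> $$ (i, j)) (norm_const * sqrt (\<rho> * real n))"
        by simp
      have "1 \<le> k" using k by simp
      note bounds = hard_threshold_bounds[OF A \<Theta> this n \<rho> w nc c]
      show "b \<in> adjacency_mat n -` ?G"
        unfolding lam vimage_eq mem_Collect_eq by (intro conjI bounds)
    qed
    hence le: "measure_pmf.prob (edge_pmf n ?\<theta>) ?H \<le> measure_pmf.prob (edge_pmf n ?\<theta>) (adjacency_mat n -` ?G)"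
      by (intro measure_pmf.finite_measure_mono) simp_all
    have "inhomogeneous_random_graph n \<Theta> = map_pmf (adjacency_mat n) (edge_pmf n ?\<theta>)"
      unfolding inhomogeneous_random_graph_def edge_pmf_def edge_set_def
      by (simp add: case_prod_unfold)
    hence "measure_pmf.prob (inhomogeneous_random_graph n \<Theta>) ?G = measure_pmf.prob (edge_pmf n ?\<theta>) (adjacency_mat n -` ?G)"
      by (simp only: measure_map_pmf)
    moreover have "ln (real n) \<le> \<rho> * real n" using ln n by (simp add: field_simps)
    hence "1 - 1 / real n < measure_pmf.prob (edge_pmf n ?\<theta>) ?H"
      by (intro centered_adjacency_opbd \<theta> \<rho> n)
    ultimately show "1 - 1 / real n < measure_pmf.prob (inhomogeneous_random_graph n \<Theta>) ?G"
      using le by linarith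
  qed
qed

end
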